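(* Let $G$ be a finitely generated group and $S$ a finite generating set. Let $F(n)=2(2n^2+3n-2)^2(2n^2+4n-1)$ and $\check F(n)=4(2n^2+3n-2)^2(n+2)n$. If $G$ contains an element of order at least $F(2|S|^2+28|S|-4)$, then there exists a generating set $T$ containing $S$, with at most $2|S|^2+28|S|$ elements, such that $(G,S,T)$ is a strong colour-rigid triple. If $S$ contains no elements of order $2$ and $G$ has an element of order at least $\check F(2|S|^2+28|S|-4)$, then $T$ can moreover be taken with no element of order $2$.
   Context: Generating sets never contain the identity $1_G$. Elements of infinite order count as having order at least any given number. $S^\pm=S\cup S^{-1}$. $\mathrm{Cay}(G,S)$ is the simple undirected graph with vertex set $G$ and edge set $\{(g,h)\mid g^{-1}h\in S^\pm\}$. $\mathrm{Ball}_{\mathrm{Cay}(G,S)}(1_G)$ is the induced subgraph on $\{1_G\}\cup S^\pm$. For a subgraph $B$ of $\mathrm{Cay}(G,S)$, a colour-preserving automorphism of $B$ is a permutation $\varphi$ of the vertex set of $B$ with $\varphi(gs)\in\{\varphi(g)s,\varphi(g)s^{-1}\}$ for all $g\in G$, $s\in S^\pm$ such that $(g,gs)$ is an edge of $B$. For generating sets $S\subseteq T$, $(G,S,T)$ is a strong colour-rigid triple if every (graph) automorphism of $\mathrm{Ball}_{\mathrm{Cay}(G,T)}(1_G)$ fixing $1_G$ acts by colour-preserving automorphisms on $\mathrm{Ball}_{\mathrm{Cay}(G,S)}(1_G)$, i.e. restricts to a colour-preserving automorphism of $\mathrm{Ball}_{\mathrm{Cay}(G,S)}(1_G)$. *)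

theory Defs
  imports
    "HOL-Algebra.Multiplicative_Group"
    "HOL-Algebra.Generated_Groups"
    "Graph_Theory.Graph_Theory"
begin

text \<open>Generating sets never contain the identity.\<close>

definition generating_set :: "('a, 'b) monoid_scheme \<Rightarrow> 'a set \<Rightarrow> bool" where
  "generating_set G S \<longleftrightarrow> S \<subseteq> carrier G \<and> \<one>\<^bsub>G\<^esub> \<notin> S \<and> generate G S = carrier G"

definition sym_closure :: "('a, 'b) monoid_scheme \<Rightarrow> 'a set \<Rightarrow> 'a set" where
  "sym_closure G S = S \<union> set_inv\<^bsub>G\<^esub> S"

text \<open>A simple undirected graph is represented by a vertex set together with a symmetric
  irreflexive edge relation, i.e. as a \<^locale>\<open>pair_bidirected_digraph\<close>.\<close>

definition cayley_graph :: "('a, 'b) monoid_scheme \<Rightarrow> 'a set \<Rightarrow> 'a pair_pre_digraph" where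
  "cayley_graph G S =
    \<lparr> pverts = carrier G,
      parcs = {(g, h). g \<in> carrier G \<and> h \<in> carrier G \<and>
        inv\<^bsub>G\<^esub> g \<otimes>\<^bsub>G\<^esub> h \<in> sym_closure G S} \<rparr>"

definition pair_induce_subgraph :: "'a pair_pre_digraph \<Rightarrow> 'a set \<Rightarrow> 'a pair_pre_digraph" where
  "pair_induce_subgraph \<Gamma> V = \<lparr> pverts = V, parcs = {e \<in> parcs \<Gamma>. fst e \<in> V \<and> snd e \<in> V} \<rparr>"

lemma with_proj_pair_induce_subgraph:
  "with_proj (pair_induce_subgraph \<Gamma> V) = induce_subgraph (with_proj \<Gamma>) V"
  by (simp add: pair_induce_subgraph_def induce_subgraph_def with_proj_def)

definition cayley_ball :: "('a, 'b) monoid_scheme \<Rightarrow> 'a set \<Rightarrow> 'a pair_pre_digraph" where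
  "cayley_ball G S = pair_induce_subgraph (cayley_graph G S) ({\<one>\<^bsub>G\<^esub>} \<union> sym_closure G S)"

text \<open>Automorphisms are functions on the whole type of which only the values on the vertex set
  matter. In particular, restricting such a function to a subgraph leaves it unchanged.\<close>

definition graph_automorphism :: "'a pair_pre_digraph \<Rightarrow> ('a \<Rightarrow> 'a) \<Rightarrow> bool" where
  "graph_automorphism \<Gamma> \<phi> \<longleftrightarrow>
    bij_betw \<phi> (pverts \<Gamma>) (pverts \<Gamma>) \<and>
    (\<forall>u\<in>pverts \<Gamma>. \<forall>v\<in>pverts \<Gamma>. (\<phi> u, \<phi> v) \<in> parcs \<Gamma> \<longleftrightarrow> (u, v) \<in> parcs \<Gamma>)"

definition colour_preserving_automorphism ::
    "('a, 'b) monoid_scheme \<Rightarrow> 'a set \<Rightarrow> 'a pair_pre_digraph \<Rightarrow> ('a \<Rightarrow> 'a) \<Rightarrow> bool" where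
  "colour_preserving_automorphism G S B \<phi> \<longleftrightarrow>
    bij_betw \<phi> (pverts B) (pverts B) \<and>
    (\<forall>g\<in>carrier G. \<forall>s\<in>sym_closure G S. (g, g \<otimes>\<^bsub>G\<^esub> s) \<in> parcs B \<longrightarrow>
      \<phi> (g \<otimes>\<^bsub>G\<^esub> s) \<in> {\<phi> g \<otimes>\<^bsub>G\<^esub> s, \<phi> g \<otimes>\<^bsub>G\<^esub> inv\<^bsub>G\<^esub> s})"

definition strong_colour_rigid_triple ::
    "('a, 'b) monoid_scheme \<Rightarrow> 'a set \<Rightarrow> 'a set \<Rightarrow> bool" where
  "strong_colour_rigid_triple G S T \<longleftrightarrow>
    generating_set G S \<and> generating_set G T \<and> S \<subseteq> T \<and>
    (\<forall>\<phi>. graph_automorphism (cayley_ball G T) \<phi> \<and> \<phi> \<one>\<^bsub>G\<^esub> = \<one>\<^bsub>G\<^esub> \<longrightarrow>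
      colour_preserving_automorphism G S (cayley_ball G S) \<phi>)"

text \<open>In the library, \<^term>\<open>group.ord G x = 0\<close> means that \<open>x\<close> has infinite order.\<close>

definition order_at_least :: "('a, 'b) monoid_scheme \<Rightarrow> 'a \<Rightarrow> int \<Rightarrow> bool" where
  "order_at_least G x N \<longleftrightarrow> group.ord G x = 0 \<or> int (group.ord G x) \<ge> N"

text \<open>The bounds are integer polynomials: they get evaluated at \<open>-4\<close> when \<open>S\<close> is empty.\<close>

definition F_bound :: "int \<Rightarrow> int" where
  "F_bound n = 2 * (2 * n^2 + 3 * n - 2)^2 * (2 * n^2 + 4 * n - 1)"

definition F_check_bound :: "int \<Rightarrow> int" where
  "F_check_bound n = 4 * (2 * n^2 + 3 * n - 2)^2 * (n + 2) * n"

lemma sym_closure_inv: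
  assumes "group G" "S \<subseteq> carrier G" "x \<in> sym_closure G S"
  shows "x \<in> carrier G" "inv\<^bsub>G\<^esub> x \<in> sym_closure G S"
proof -
  interpret group G by fact
  show "x \<in> carrier G" "inv\<^bsub>G\<^esub> x \<in> sym_closure G S"
    using assms(2,3) by (auto simp: sym_closure_def SET_INV_def)
qed

lemma cayley_graph_simple_undirected:
  assumes "group G" "generating_set G S"
  shows "pair_bidirected_digraph (cayley_graph G S)"
proof -
  interpret group G by fact
  have S: "S \<subseteq> carrier G" "\<one>\<^bsub>G\<^esub> \<notin> S"
    using assms(2) by (auto simp: generating_set_def)
  then have one: "\<one>\<^bsub>G\<^esub> \<notin> sym_closure G S"
    by (auto simp: sym_closure_def SET_INV_def dest: inv_eq_1_iff[THEN iffD1, OF _ sym] subsetD)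
  have sym: "inv\<^bsub>G\<^esub> h \<otimes>\<^bsub>G\<^esub> g \<in> sym_closure G S"
    if "g \<in> carrier G" "h \<in> carrier G" "inv\<^bsub>G\<^esub> g \<otimes>\<^bsub>G\<^esub> h \<in> sym_closure G S" for g h
    using sym_closure_inv(2)[OF \<open>group G\<close> S(1) that(3)] that by (simp add: inv_mult_group)
  show ?thesis
    using one sym
    by unfold_locales (auto simp: cayley_graph_def symmetric_def intro!: symI)
qed

end

theory Submission
  imports Defs
begin

text \<open>The group is embedded by left translations into an additively written (noncommutative) group
  of permutations. An automorphism of the ball that fixes the identity preserves the number of
  triangles through each edge at the identity, and \<open>T\<close> is built so that this
  number is at most \<open>8\<close> for all elements outside a slight extension of \<open>S\<close> and separates the
  elements of the extension up to sign. Hence every element of \<open>S\<close> is fixed or negated, and what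
  remains is to control the signs simultaneously.

  The extra elements come in gadgets \<open>{- d + p | d \<in> A}\<close> with \<open>0 \<in> A\<close> and \<open>A\<close> inside
  the extension; the vertex \<open>p\<close> is then a common neighbour of all nonzero \<open>d \<in> A\<close>. Here
  \<open>p = c b + w\<close> with \<open>c b\<close> a generic power of the element of large order, so that the
  only coincidences are those forced by an element of \<open>S\<close> commuting with or inverting a small power
  of it. A gadget with \<open>A = {0, s}\<close> raises the degree of \<open>s\<close>; hubs, with \<open>A = {0, g, y}\<close>
  for a further generic power \<open>y\<close>, force \<open>g\<close> to keep its sign if \<open>y\<close> does; ties, with
  \<open>A = {0, w, u}\<close>, link the signs of two elements that invert a common power. A pair of elements is
  linked through its number of common neighbours among the gadget vertices. The case
  distinction is governed by which elements of \<open>S\<close> commute with or invert a small power.\<close>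

section \<open>Permutations as an additive group\<close>

text \<open>The passage to a type-class group removes all carrier conditions, so that identities
  between words become plain rewriting. The main obstacle is that every new colour forms triangles
  with all others, while only counts of triangles and common neighbours can be used. Hence gadgets
  are added one at a time, each chosen by counting the exponents that would cause an accident; these
  have to be fewer than the exponents available, and this is where the polynomial bound on the order
  comes from. A gadget element is on at most 2 + 3 + 2 + 1 = 8 triangles, so a generator needs 9:
  one from a hub and eight from increments. The quadratic part of the size bound pays for making all
  degrees distinct. Signs are harder: if a generator inverts a small power, its hub unavoidably
  treats it and its negative alike. Two maps other than the identity have to be tolerated or
  excluded: negation of everything, and negation of the inverted generators only. Involutions need
  no second construction, since a gadget contains one only if some word inverting a power has order
  2, and this is arranged to happen only if \<open>S\<close> has involutions.\<close>

typedef 'a bijection = "{f :: 'a \<Rightarrow> 'a. bij f}"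
  morphisms apply_bijection Bijection
  by (rule exI[of _ id]) simp

instantiation bijection :: (type) group_add
begin

definition "0 = Bijection id"
definition "f + g = Bijection (apply_bijection f \<circ> apply_bijection g)"
definition "- f = Bijection (inv_into UNIV (apply_bijection f))"
definition "f - g = f + - g" for f g :: "'a bijection"

lemma bij_apply_bijection: "bij (apply_bijection f)"
  using apply_bijection[of f] by simp

lemma apply_bijection_zero: "apply_bijection 0 = id"
  by (simp add: zero_bijection_def Bijection_inverse)

lemma apply_bijection_plus: "apply_bijection (f + g) = apply_bijection f \<circ> apply_bijection g"
  by (simp add: plus_bijection_def Bijection_inverse bij_comp bij_apply_bijection)

lemma apply_bijection_uminus: "apply_bijection (- f) = inv_into UNIV (apply_bijection f)"
  by (simp add: uminus_bijection_def Bijection_inverse bij_imp_bij_inv bij_apply_bijection)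

instance
proof
  fix a b c :: "'a bijection"
  note simps = apply_bijection_inject[symmetric] apply_bijection_plus apply_bijection_zero
    apply_bijection_uminus
  show "a + b + c = a + (b + c)" by (simp add: simps comp_assoc)
  show "0 + a = a" by (simp add: simps)
  show "a + 0 = a" by (simp add: simps)
  show "- a + a = 0" by (simp add: simps bij_is_inj[OF bij_apply_bijection])
  show "a + - b = a - b" by (simp add: minus_bijection_def)
qed

end

section \<open>Links and families of gadgets\<close>

definition pm :: "'g::group_add set \<Rightarrow> 'g set" where
  "pm A = A \<union> uminus ` A"

definition pm0 :: "'g::group_add set \<Rightarrow> 'g set" where
  "pm0 A = insert 0 (pm A)"

text \<open>These are the neighbours of \<open>u\<close> inside the neighbourhood of
  \<open>0\<close>. Their number, called the degree of \<open>u\<close> below, counts the triangles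
  on the edge from \<open>0\<close> to \<open>u\<close>.\<close>

definition link :: "'g::group_add set \<Rightarrow> 'g \<Rightarrow> 'g set" where
  "link T u = {v \<in> pm T. - u + v \<in> pm T}"

lemma in_pm: "x \<in> pm A \<longleftrightarrow> x \<in> A \<or> - x \<in> A"
proof -
  have "x \<in> uminus ` A \<longleftrightarrow> - x \<in> A"
    by (metis (no_types, opaque_lifting) image_iff minus_minus)
  then show ?thesis by (auto simp: pm_def)
qed

lemma pm_uminus [simp]: "- x \<in> pm A \<longleftrightarrow> x \<in> pm A"
  by (auto simp: in_pm)

lemma pm0_uminus [simp]: "- x \<in> pm0 A \<longleftrightarrow> x \<in> pm0 A"
  by (simp add: pm0_def)

lemma pm_Un: "pm (A \<union> B) = pm A \<union> pm B"
  by (auto simp: pm_def)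

lemma subset_pm: "A \<subseteq> pm A"
  by (auto simp: pm_def)

lemma pm_mono: "A \<subseteq> B \<Longrightarrow> pm A \<subseteq> pm B"
  by (auto simp: pm_def)

lemma pm0_mono: "A \<subseteq> B \<Longrightarrow> pm0 A \<subseteq> pm0 B"
  using pm_mono by (auto simp: pm0_def)

lemma finite_pm [simp]: "finite A \<Longrightarrow> finite (pm A)"
  by (simp add: pm_def)

lemma finite_pm0 [simp]: "finite A \<Longrightarrow> finite (pm0 A)"
  by (simp add: pm0_def)

lemma card_pm_le: "finite A \<Longrightarrow> card (pm A) \<le> 2 * card A"
  unfolding pm_def by (metis card_Un_le card_image_le add_mono le_refl le_trans mult_2)

lemma card_pm0_le: "finite A \<Longrightarrow> card (pm0 A) \<le> 2 * card A + 1"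
  unfolding pm0_def using card_pm_le[of A] by (simp add: card_insert_if)

lemma finite_link: "finite T \<Longrightarrow> finite (link T u)"
  by (simp add: link_def)

text \<open>Left translation by \<open>- v\<close> moves the edge from \<open>0\<close> to
  \<open>v\<close> to the edge from \<open>- v\<close> to \<open>0\<close>, together with its
  triangles.\<close>

lemma card_link_uminus: "card (link T (- v)) = card (link T v)"
proof -
  have "bij_betw (\<lambda>u. - v + u) (link T v) (link T (- v))"
    by (rule bij_betw_byWitness[where f' = "\<lambda>u. v + u"]) (auto simp: link_def add.assoc[symmetric])
  from bij_betw_same_card[OF this] show ?thesis by simp
qed

text \<open>The edges from \<open>0\<close> to \<open>v\<close> and from \<open>v\<close> to \<open>u\<close> have the colours \<open>v\<close> and \<open>- v + u\<close>. Hence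
  this set counts the triangles at a gadget vertex \<open>v\<close> in which at least two of the three colours
  belong to the gadget.\<close>

definition colour_nbrs :: "'g::group_add set \<Rightarrow> 'g set \<Rightarrow> 'g \<Rightarrow> 'g set" where
  "colour_nbrs S X v = {u \<in> pm S \<union> pm X. - v + u \<in> pm S \<union> pm X \<and> (u \<in> pm X \<or> - v + u \<in> pm X)}"

text \<open>\<open>T\<close> is the set built so far and \<open>V\<close> consists of reserved words
  that must not become gadget colours. The clause on sums excludes triangles with exactly one new
  colour. The next one forces the old colour of a triangle with two new ones into
  \<open>pm S\<close>, so that old gadget elements gain no triangles.\<close>

definition fresh :: "'g::group_add set \<Rightarrow> 'g set \<Rightarrow> 'g set \<Rightarrow> 'g set \<Rightarrow> bool" where
  "fresh S V T X \<longleftrightarrow> finite X \<and> pm X \<inter> V = {} \<and>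
     (\<forall>u\<in>pm X. \<forall>a\<in>pm0 T. \<forall>b\<in>pm0 T. u \<noteq> a + b) \<and>
     (\<forall>u\<in>pm X. \<forall>v\<in>pm X. u + v \<in> pm T \<longrightarrow> u + v \<in> pm S) \<and>
     (\<forall>v\<in>pm X. card (colour_nbrs S X v) \<le> 8)"

definition total :: "'g set \<Rightarrow> 'g set list \<Rightarrow> 'g set" where
  "total S Xs = S \<union> \<Union> (set Xs)"

text \<open>The head of the list is the gadget added last; it is fresh for everything in the
  tail.\<close>

inductive good :: "'g::group_add set \<Rightarrow> 'g set \<Rightarrow> 'g set list \<Rightarrow> bool" for S V where
  good_Nil: "good S V []"
| good_Cons: "good S V Xs \<Longrightarrow> fresh S V (total S Xs) X \<Longrightarrow> good S V (X # Xs)"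

lemma total_Nil [simp]: "total S [] = S"
  by (simp add: total_def)

lemma total_Cons: "total S (X # Xs) = X \<union> total S Xs"
  by (auto simp: total_def)

lemma subset_total: "S \<subseteq> total S Xs"
  by (simp add: total_def)

lemma pm_subset_total: "s \<in> pm S \<Longrightarrow> s \<in> pm (total S Xs)"
  using pm_mono[OF subset_total] by blast

lemma finite_total: "good S V Xs \<Longrightarrow> finite S \<Longrightarrow> finite (total S Xs)"
  by (induction rule: good.induct) (auto simp: total_Cons fresh_def)

lemma freshD:
  assumes "fresh S V T X" "u \<in> pm X"
  shows "u \<notin> V" "u \<notin> pm T" "u \<noteq> 0" "\<And>a b. a \<in> pm0 T \<Longrightarrow> b \<in> pm0 T \<Longrightarrow> u \<noteq> a + b"
    "\<And>v. v \<in> pm X \<Longrightarrow> u + v \<in> pm T \<Longrightarrow> u + v \<in> pm S"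
    "card (colour_nbrs S X u) \<le> 8"
proof -
  show *: "\<And>a b. a \<in> pm0 T \<Longrightarrow> b \<in> pm0 T \<Longrightarrow> u \<noteq> a + b"
    using assms by (auto simp: fresh_def)
  show "u \<notin> pm T" using *[of u 0] by (auto simp: pm0_def)
  show "u \<noteq> 0" using *[of 0 0] by (auto simp: pm0_def)
qed (use assms in \<open>auto simp: fresh_def\<close>)

text \<open>Each gadget was fresh when it was added, and the set built by then contained
  \<open>S\<close>; later additions do not matter.\<close>

lemma good_outside:
  assumes "good S V Xs" "t \<in> pm (total S Xs)" "t \<notin> pm S"
  shows "t \<notin> V \<and> (\<forall>a\<in>pm0 S. \<forall>b\<in>pm0 S. t \<noteq> a + b)"
  using assms
proof (induction rule: good.induct)
  case good_Nil
  then show ?case by simp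
next
  case (good_Cons Xs X)
  show ?case
  proof (cases "t \<in> pm X")
    case True
    show ?thesis
      using freshD[OF good_Cons.hyps(2) True] pm0_mono[OF subset_total[of S Xs]] by blast
  next
    case False
    with good_Cons.prems have "t \<in> pm (total S Xs)"
      by (auto simp: total_Cons pm_Un)
    with good_Cons show ?thesis by simp
  qed
qed

text \<open>In a triangle with colours \<open>s\<close>, \<open>v\<close> and
  \<open>- s + v\<close>, where \<open>s\<close> is old, the other two colours are both new or both
  old: a single new colour would be a sum of two old ones.\<close>

lemma link_fresh:
  assumes fr: "fresh S V T X" and s: "s \<in> pm T"
  shows "link (X \<union> T) s = link T s \<union> link X s" "link T s \<inter> link X s = {}"
proof -
  have "v \<in> link T s \<union> link X s" if v: "v \<in> pm (X \<union> T)" "- s + v \<in> pm (X \<union> T)" for v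
  proof -
    have s0: "s \<in> pm0 T" "- s \<in> pm0 T" using s by (auto simp: pm0_def)
    have "v \<in> pm X \<longleftrightarrow> - s + v \<in> pm X"
    proof
      assume vX: "v \<in> pm X"
      show "- s + v \<in> pm X"
      proof (rule ccontr)
        assume "- s + v \<notin> pm X"
        then have "- s + v \<in> pm0 T" using v by (auto simp: pm_Un pm0_def)
        from freshD(4)[OF fr vX s0(1) this] show False
          by (simp add: add.assoc[symmetric])
      qed
    next
      assume vX: "- s + v \<in> pm X"
      show "v \<in> pm X"
      proof (rule ccontr)
        assume "v \<notin> pm X"
        then have "v \<in> pm0 T" using v by (auto simp: pm_Un pm0_def)
        from freshD(4)[OF fr vX s0(2) this] show False by simp
      qed
    qed
    then show ?thesis using v by (auto simp: link_def pm_Un)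
  qed
  then show "link (X \<union> T) s = link T s \<union> link X s"
    by (auto simp: link_def pm_Un)
  show "link T s \<inter> link X s = {}"
    using freshD(2)[OF fr] by (auto simp: link_def)
qed

text \<open>This additivity allows every gadget to be designed by itself: its contribution to the
  degree of a generator can be read off from the gadget alone.\<close>

lemma link_total:
  assumes "good S V Xs" "finite S" "s \<in> pm S"
  shows "card (link (total S Xs) s) = card (link S s) + (\<Sum>X\<leftarrow>Xs. card (link X s))"
  using assms
proof (induction rule: good.induct)
  case good_Nil
  then show ?case by simp
next
  case (good_Cons Xs X)
  note l = link_fresh[OF good_Cons.hyps(2) pm_subset_total[OF good_Cons.prems(2)]]
  have fin: "finite X" "finite (total S Xs)"
    using good_Cons by (auto simp: fresh_def intro: finite_total)
  show ?case
    unfolding total_Cons l(1)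
    using l(2) good_Cons.IH good_Cons.prems fin by (simp add: card_Un_disjoint finite_link)
qed

text \<open>When \<open>v\<close> enters, all its triangles lie in \<open>colour_nbrs\<close>,
  because \<open>v\<close> is no sum of two old colours. Later gadgets add none: two new colours
  that sum to \<open>v\<close> would force \<open>v\<close> into \<open>pm S\<close>.\<close>

lemma link_gadget_le:
  assumes "good S V Xs" "finite S" "v \<in> pm (total S Xs)" "v \<notin> pm S"
  shows "card (link (total S Xs) v) \<le> 8"
  using assms
proof (induction rule: good.induct)
  case good_Nil
  then show ?case by simp
next
  case (good_Cons Xs X)
  let ?T = "total S Xs"
  note fr = good_Cons.hyps(2)
  have fin: "finite X" "finite ?T"
    using good_Cons by (auto simp: fresh_def intro: finite_total)
  show ?case
  proof (cases "v \<in> pm X")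
    case True
    have "u \<in> colour_nbrs S X v" if "u \<in> link (X \<union> ?T) v" for u
    proof -
      have u: "u \<in> pm X \<or> u \<in> pm ?T" "- v + u \<in> pm X \<or> - v + u \<in> pm ?T"
        using that by (auto simp: link_def pm_Un)
      consider "u \<in> pm X" "- v + u \<in> pm X" | "u \<in> pm X" "- v + u \<in> pm ?T" "- v + u \<notin> pm X"
        | "u \<in> pm ?T" "- v + u \<in> pm X" "u \<notin> pm X"
        | "u \<in> pm ?T" "- v + u \<in> pm ?T" using u by blast
      then show ?thesis
      proof cases
        case 1
        then show ?thesis by (simp add: colour_nbrs_def)
      next
        case 2
        have "- v + u \<in> pm S" using freshD(5)[OF fr, of "- v" u] True 2 by simp
        then show ?thesis using 2 by (simp add: colour_nbrs_def)
      next
        case 3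
        have "u \<in> pm S" using freshD(5)[OF fr, of v "- v + u"] True 3 by (simp add: add.assoc[symmetric])
        then show ?thesis using 3 by (simp add: colour_nbrs_def)
      next
        case 4
        have "v \<noteq> u + - (- v + u)"
          by (rule freshD(4)[OF fr True]) (use 4 in \<open>simp_all only: pm0_def pm_uminus insert_iff simp_thms\<close>)
        then show ?thesis by (simp add: minus_add add.assoc[symmetric])
      qed
    qed
    then have "link (X \<union> ?T) v \<subseteq> colour_nbrs S X v" by blast
    moreover have "finite (colour_nbrs S X v)"
      using fin(1) good_Cons.prems(1) by (simp add: colour_nbrs_def)
    ultimately have "card (link (X \<union> ?T) v) \<le> card (colour_nbrs S X v)"
      by (rule card_mono[rotated])
    also have "\<dots> \<le> 8" using freshD(6)[OF fr True] .
    finally show ?thesis by (simp add: total_Cons)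
  next
    case False
    then have vT: "v \<in> pm ?T" using good_Cons.prems by (auto simp: total_Cons pm_Un)
    have "u \<notin> link X v" for u
    proof
      assume "u \<in> link X v"
      then have u: "u \<in> pm X" "- (- v + u) \<in> pm X" by (auto simp: link_def simp del: minus_add)
      have "u + - (- v + u) = v" by (simp add: minus_add add.assoc[symmetric])
      with freshD(5)[OF fr u] vT good_Cons.prems(3) show False by simp
    qed
    then have "link X v = {}" by blast
    then have "link (X \<union> ?T) v = link ?T v"
      using link_fresh(1)[OF fr vT] by simp
    with good_Cons.IH good_Cons.prems vT show ?thesis by (simp add: total_Cons)
  qed
qed

section \<open>Common neighbours of pairs of generators among the gadget vertices\<close>

definition common_count :: "'g::group_add set list \<Rightarrow> 'g \<Rightarrow> 'g \<Rightarrow> nat" where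
  "common_count Xs k l = (\<Sum>X\<leftarrow>Xs. card (link X k \<inter> link X l))"

lemma common_count_Nil [simp]: "common_count [] k l = 0"
  by (simp add: common_count_def)

lemma common_count_Cons [simp]:
  "common_count (X # Xs) k l = card (link X k \<inter> link X l) + common_count Xs k l"
  by (simp add: common_count_def)

lemma common_count_append [simp]:
  "common_count (Xs @ Ys) k l = common_count Xs k l + common_count Ys k l"
  by (simp add: common_count_def)

text \<open>Common neighbours inside \<open>pm S\<close> depend on the unknown structure of
  \<open>S\<close> and are left out. An automorphism that preserves \<open>pm S\<close> still
  respects the rest.\<close>

lemma common_link_total:
  assumes "good S V Xs" "finite S" "k \<in> pm S" "l \<in> pm S"
  shows "card ((link (total S Xs) k \<inter> link (total S Xs) l) - pm S) = common_count Xs k l"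
  using assms
proof (induction rule: good.induct)
  case good_Nil
  have "link S k \<inter> link S l - pm S = {}" by (auto simp: link_def)
  then show ?case by (metis card.empty common_count_Nil total_Nil)
next
  case (good_Cons Xs X)
  let ?T = "total S Xs"
  note l1 = link_fresh[OF good_Cons.hyps(2) pm_subset_total[OF good_Cons.prems(2)]]
  note l2 = link_fresh[OF good_Cons.hyps(2) pm_subset_total[OF good_Cons.prems(3)]]
  have fin: "finite X" "finite ?T"
    using good_Cons by (auto simp: fresh_def intro: finite_total)
  have dis: "pm X \<inter> pm ?T = {}" using freshD(2)[OF good_Cons.hyps(2)] by auto
  have sub: "link X k \<subseteq> pm X" "link X l \<subseteq> pm X" "link ?T k \<subseteq> pm ?T" "link ?T l \<subseteq> pm ?T"
    "pm S \<subseteq> pm ?T"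
    by (auto simp: link_def pm_subset_total)
  have eq: "(link (X \<union> ?T) k \<inter> link (X \<union> ?T) l) - pm S
      = ((link ?T k \<inter> link ?T l) - pm S) \<union> (link X k \<inter> link X l)"
    unfolding l1(1) l2(1) using dis sub by blast
  have "((link ?T k \<inter> link ?T l) - pm S) \<inter> (link X k \<inter> link X l) = {}"
    using l1(2) by blast
  then have "card ((link (X \<union> ?T) k \<inter> link (X \<union> ?T) l) - pm S)
      = card ((link ?T k \<inter> link ?T l) - pm S) + card (link X k \<inter> link X l)"
    unfolding eq using fin by (intro card_Un_disjoint) (auto simp: finite_link)
  then show ?case
    using good_Cons.IH good_Cons.prems by (simp add: total_Cons)
qed

text \<open>The ball is the cone with apex \<open>0\<close> over the neighbourhood of
  \<open>0\<close>, so an automorphism that fixes \<open>0\<close> amounts to an automorphism of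
  this neighbourhood.\<close>

locale link_automorphism =
  fixes T :: "'g::group_add set" and \<phi> :: "'g \<Rightarrow> 'g"
  assumes bij: "bij_betw \<phi> (pm T) (pm T)"
    and adj: "\<And>u v. u \<in> pm T \<Longrightarrow> v \<in> pm T \<Longrightarrow> - \<phi> u + \<phi> v \<in> pm T \<longleftrightarrow> - u + v \<in> pm T"
begin

lemma image_link:
  assumes "u \<in> pm T"
  shows "\<phi> ` link T u = link T (\<phi> u)"
proof
  show "\<phi> ` link T u \<subseteq> link T (\<phi> u)"
    using bij assms adj by (auto simp: link_def bij_betw_def)
  show "link T (\<phi> u) \<subseteq> \<phi> ` link T u"
  proof
    fix v assume v: "v \<in> link T (\<phi> u)"
    then obtain v' where "v' \<in> pm T" "v = \<phi> v'"
      using bij by (auto simp: link_def bij_betw_def)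
    with v assms adj show "v \<in> \<phi> ` link T u" by (auto simp: link_def)
  qed
qed

lemma inj_on_pm: "A \<subseteq> pm T \<Longrightarrow> inj_on \<phi> A"
  using bij by (auto simp: bij_betw_def intro: inj_on_subset)

lemma card_link: "u \<in> pm T \<Longrightarrow> card (link T (\<phi> u)) = card (link T u)"
  by (metis (no_types, lifting) card_image image_link inj_on_pm link_def mem_Collect_eq subsetI)

end

locale separated_family =
  fixes S V :: "'g::group_add set" and Xs
  assumes finS: "finite S" and good: "good S V Xs"
    and degree_gt: "\<And>s. s \<in> S \<Longrightarrow> 8 < card (link (total S Xs) s)"
    and degree_inj: "\<And>s t. s \<in> S \<Longrightarrow> t \<in> S \<Longrightarrow>
      card (link (total S Xs) s) = card (link (total S Xs) t) \<Longrightarrow> s = t \<or> s = - t"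

locale separated_automorphism = separated_family S V Xs + link_automorphism "total S Xs" \<phi>
  for S V :: "'g::group_add set" and Xs and \<phi> :: "'g \<Rightarrow> 'g"
begin

text \<open>A degree above 8 keeps the image of a generator out of the gadgets, and equality of
  degrees then leaves only the generator and its negative.\<close>

lemma map_pm:
  assumes s: "s \<in> pm S"
  shows "\<phi> s = s \<or> \<phi> s = - s"
proof -
  let ?d = "\<lambda>u. card (link (total S Xs) u)"
  obtain s' where s': "s' \<in> S" "s = s' \<or> s = - s'" using s by (metis in_pm minus_minus)
  have T: "s \<in> pm (total S Xs)" using s by (rule pm_subset_total)
  have d: "?d (\<phi> s) = ?d s'" using card_link[OF T] s'(2) by (auto simp: card_link_uminus)
  have "\<phi> s \<in> pm (total S Xs)" using bij T by (auto simp: bij_betw_def)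
  then have "\<phi> s \<in> pm S"
    using link_gadget_le[OF good finS, of "\<phi> s"] degree_gt[OF s'(1)] d by fastforce
  then obtain t where t: "t \<in> S" "\<phi> s = t \<or> \<phi> s = - t" by (metis in_pm minus_minus)
  then have "?d t = ?d s'" using d by (auto simp: card_link_uminus)
  with degree_inj[OF t(1) s'(1)] t(2) s'(2) show ?thesis by (metis minus_minus)
qed

lemma map_in_pm: "s \<in> pm S \<Longrightarrow> \<phi> s \<in> pm S"
  using map_pm by fastforce

lemma map_uminus:
  assumes s: "s \<in> pm S"
  shows "\<phi> (- s) = - \<phi> s"
proof (cases "- s = s")
  case False
  have "\<phi> (- s) \<noteq> \<phi> s"
    using inj_on_pm[of "{s, - s}"] False pm_subset_total[OF s] by (auto dest: inj_onD)
  then show ?thesis using map_pm[OF s] map_pm[of "- s"] s by auto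
qed (use map_pm[OF s] in auto)

lemma image_pm: "\<phi> ` pm S = pm S"
proof -
  have "inj_on \<phi> (pm S)" by (rule inj_on_pm) (auto intro: pm_subset_total)
  then show ?thesis using map_in_pm finS by (simp add: endo_inj_surj image_subsetI)
qed

lemma common_count_map:
  assumes "k \<in> pm S" "l \<in> pm S"
  shows "common_count Xs (\<phi> k) (\<phi> l) = common_count Xs k l"
proof -
  let ?T = "total S Xs" and ?C = "\<lambda>k l. (link (total S Xs) k \<inter> link (total S Xs) l) - pm S"
  have T: "k \<in> pm ?T" "l \<in> pm ?T" using assms by (auto intro: pm_subset_total)
  have sub: "link ?T k \<subseteq> pm ?T" "link ?T l \<subseteq> pm ?T" "pm S \<subseteq> pm ?T"
    by (auto simp: link_def intro: pm_subset_total)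
  have inj: "inj_on \<phi> (pm ?T)" by (rule inj_on_pm) simp
  have "\<phi> ` ?C k l = ?C (\<phi> k) (\<phi> l)"
  proof -
    have "\<phi> ` ?C k l = \<phi> ` (link ?T k \<inter> link ?T l) - \<phi> ` pm S"
      by (rule inj_on_image_set_diff[OF inj]) (use sub in auto)
    also have "\<phi> ` (link ?T k \<inter> link ?T l) = \<phi> ` link ?T k \<inter> \<phi> ` link ?T l"
      by (rule inj_on_image_Int[OF inj]) (use sub in auto)
    finally show ?thesis by (simp add: image_link[OF T(1)] image_link[OF T(2)] image_pm)
  qed
  moreover have "inj_on \<phi> (?C k l)" by (rule inj_on_pm) (use sub in auto)
  ultimately have "card (?C (\<phi> k) (\<phi> l)) = card (?C k l)" by (metis card_image)
  then show ?thesis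
    using common_link_total[OF good finS] assms map_in_pm by simp
qed

end

section \<open>Gadgets\<close>

declare add_uminus_conv_diff [simp del]

text \<open>Rewriting with these turns a word into a right-nested sum of letters and negated
  letters; the simp rule that reintroduces subtraction is switched off for this purpose.\<close>

lemmas group_word = diff_conv_add_uminus add.assoc minus_add

definition gadget :: "'g::group_add \<Rightarrow> 'g set \<Rightarrow> 'g set" where
  "gadget p A = (\<lambda>d. - d + p) ` A"

lemma card_gadget_le: "finite A \<Longrightarrow> card (gadget p A) \<le> card A"
  by (simp add: gadget_def card_image_le)

lemma in_pm_gadget: "v \<in> pm (gadget p A) \<longleftrightarrow> (\<exists>d\<in>A. v = - d + p \<or> v = - p + d)"
proof -
  have "- v = - d + p \<longleftrightarrow> v = - p + d" for d
    using neg_equal_iff_equal[of v "- p + d"] by (simp add: minus_add)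
  then show ?thesis by (auto simp: in_pm gadget_def)
qed

lemma colour_nbrs_uminus: "card (colour_nbrs S X (- v)) = card (colour_nbrs S X v)"
proof -
  have "bij_betw (\<lambda>u. - v + u) (colour_nbrs S X v) (colour_nbrs S X (- v))"
    by (rule bij_betw_byWitness[where f' = "\<lambda>u. v + u"])
      (auto simp: colour_nbrs_def add.assoc[symmetric])
  from bij_betw_same_card[OF this] show ?thesis by simp
qed

text \<open>This solves for the colours \<open>k\<close> whose link contains a given gadget vertex.
  The solutions \<open>- d + e\<close> at the vertex \<open>- d + p\<close> are always there; all
  others contain \<open>p\<close> twice and are coincidences to be controlled by the choice of
  \<open>p\<close>.\<close>

lemma uminus_add_in_pm_gadget:
  "- k + (- d + p) \<in> pm (gadget p A) \<longleftrightarrow> (\<exists>e\<in>A. k = - d + e \<or> k = - d + (p + (- e + p)))"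
  "- k + (- p + d) \<in> pm (gadget p A) \<longleftrightarrow>
    (\<exists>e\<in>A. k = - p + (d + (- e + p)) \<or> k = - p + (d + (- p + e)))"
proof -
  have solve: "- k + a = b \<longleftrightarrow> k = a + - b" for a b :: 'a
  proof
    assume "- k + a = b"
    then have "k + (- k + a) = k + b" by simp
    then show "k = a + - b" by (simp add: add.assoc)
  qed (simp add: group_word)
  show "- k + (- d + p) \<in> pm (gadget p A) \<longleftrightarrow> (\<exists>e\<in>A. k = - d + e \<or> k = - d + (p + (- e + p)))"
    unfolding in_pm_gadget solve by (simp add: group_word)
  show "- k + (- p + d) \<in> pm (gadget p A) \<longleftrightarrow>
    (\<exists>e\<in>A. k = - p + (d + (- e + p)) \<or> k = - p + (d + (- p + e)))"
    unfolding in_pm_gadget solve by (simp add: group_word disj_commute)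
qed

text \<open>The neighbours of \<open>- d + p\<close> in the relevant triangles: at most two of the form \<open>- e + p\<close>, three
  of the form \<open>- p + e\<close>, two of the form \<open>- d + e\<close>, and \<open>- d + p - \<delta> + p\<close>.\<close>

lemma fresh_gadget:
  assumes A: "finite A" "card A \<le> 3" and ST: "S \<subseteq> T" "0 \<notin> pm T"
    and V: "\<And>v. - v \<in> V \<longleftrightarrow> v \<in> V"
    and outside: "\<And>d. d \<in> A \<Longrightarrow> - d + p \<notin> V"
      "\<And>d a b. d \<in> A \<Longrightarrow> a \<in> pm0 T \<Longrightarrow> b \<in> pm0 T \<Longrightarrow> - d + p \<noteq> a + b"
    and triv: "\<And>d e. d \<in> A \<Longrightarrow> e \<in> A \<Longrightarrow> - d + e \<in> pm T \<Longrightarrow> - d + e \<in> pm S"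
    and conj: "\<And>d e. d \<in> A \<Longrightarrow> e \<in> A \<Longrightarrow> - p + (d + (- e + p)) \<in> pm T \<Longrightarrow>
      - p + (d + (- e + p)) \<in> pm S"
    and invt: "\<And>d e. d \<in> A \<Longrightarrow> e \<in> A \<Longrightarrow> - d + (p + (- e + p)) \<in> pm T \<Longrightarrow>
      - d + (p + (- e + p)) \<in> pm S"
    and uniq: "\<And>d e. d \<in> A \<Longrightarrow> e \<in> A \<Longrightarrow> - d + (p + (- e + p)) \<in> pm S \<Longrightarrow> e = \<delta>"
  shows "fresh S V T (gadget p A)"
  unfolding fresh_def
proof (intro conjI ballI impI)
  let ?X = "gadget p A"
  show "finite ?X" using A by (simp add: gadget_def)
  have neg: "- (- d + p) = - p + d" for d by (simp add: group_word)
  have pmV: "- p + d \<notin> V" if "d \<in> A" for d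
    using outside(1)[OF that] V[of "- p + d"] by (simp add: group_word)
  show "pm ?X \<inter> V = {}" using outside(1) pmV by (auto simp: in_pm_gadget)
  show sum: "u \<noteq> a + b" if "u \<in> pm ?X" "a \<in> pm0 T" "b \<in> pm0 T" for u a b
  proof
    assume eq: "u = a + b"
    from that(1) obtain d where d: "d \<in> A" "u = - d + p \<or> - u = - d + p"
      by (auto simp: in_pm_gadget group_word)
    from d(2) show False
    proof
      assume "u = - d + p" with outside(2)[OF d(1) that(2,3)] eq show False by simp
    next
      assume "- u = - d + p"
      with outside(2)[OF d(1), of "- b" "- a"] that(2,3) eq show False by (simp add: minus_add)
    qed
  qed
  have X0: "0 \<notin> pm ?X" using sum[of 0 0 0] by (auto simp: pm0_def)
  have S0: "0 \<notin> pm S" using ST pm_mono[OF ST(1)] by blast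
  show "u + v \<in> pm S" if "u \<in> pm ?X" "v \<in> pm ?X" "u + v \<in> pm T" for u v
  proof -
    from that(1,2) obtain d e where de: "d \<in> A" "e \<in> A" "u = - d + p \<or> u = - p + d"
        "v = - e + p \<or> v = - p + e"
      by (auto simp: in_pm_gadget)
    from de(3,4) consider "u = - d + p" "v = - e + p" | "u = - d + p" "v = - p + e"
      | "u = - p + d" "v = - e + p" | "u = - p + d" "v = - p + e" by blast
    then show ?thesis
    proof cases
      case 1
      then show ?thesis using invt[OF de(1,2)] that(3) by (simp add: group_word)
    next
      case 2
      then show ?thesis using triv[OF de(1,2)] that(3) by (simp add: group_word)
    next
      case 3
      then show ?thesis using conj[OF de(1,2)] that(3) by (simp add: group_word)
    next
      case 4
      then have "- (u + v) = - e + (p + (- d + p))" by (simp add: group_word)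
      with invt[OF de(2,1)] that(3) show ?thesis by (metis pm_uminus)
    qed
  qed
  have bound: "card (colour_nbrs S ?X (- d + p)) \<le> 8" if d: "d \<in> A" for d
  proof -
    let ?N = "(\<lambda>e. - e + p) ` (A - {d}) \<union> (\<lambda>e. - p + e) ` A \<union> (\<lambda>e. - d + e) ` (A - {d})
      \<union> {- d + (p + (- \<delta> + p))}"
    have "colour_nbrs S ?X (- d + p) \<subseteq> ?N"
    proof
      fix u assume u: "u \<in> colour_nbrs S ?X (- d + p)"
      let ?t = "- (- d + p) + u"
      have u_eq: "u = - d + (p + ?t)" by (simp add: group_word)
      have u0: "u \<noteq> 0" "?t \<noteq> 0" using u X0 S0 by (auto simp: colour_nbrs_def)
      show "u \<in> ?N"
      proof (cases "u \<in> pm ?X")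
        case True
        then obtain e where e: "e \<in> A" "u = - e + p \<or> u = - p + e" by (auto simp: in_pm_gadget)
        moreover have "e \<noteq> d" if "u = - e + p" using u0(2) that by (auto simp: group_word)
        ultimately show ?thesis by blast
      next
        case False
        then have uS: "u \<in> pm S" and "?t \<in> pm ?X" using u by (auto simp: colour_nbrs_def)
        then obtain e where e: "e \<in> A" "?t = - e + p \<or> ?t = - p + e" by (auto simp: in_pm_gadget)
        from e(2) show ?thesis
        proof
          assume t: "?t = - e + p"
          have "u = - d + (p + (- e + p))" using u_eq unfolding t .
          with uniq[OF d e(1)] uS show ?thesis by auto
        next
          assume t: "?t = - p + e"
          have "u = - d + e" using u_eq unfolding t by simp
          with e(1) u0(1) show ?thesis by auto
        qed
      qed
    qed
    moreover have "card ?N \<le> 2 + 3 + 2 + 1"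
    proof -
      have "card (A - {d}) \<le> 2" using A d by simp
      then have "card ((\<lambda>e. - e + p) ` (A - {d})) \<le> 2" "card ((\<lambda>e. - d + e) ` (A - {d})) \<le> 2"
        "card ((\<lambda>e. - p + e) ` A) \<le> 3"
        using A by (meson card_image_le finite_Diff le_trans)+
      moreover have "card {- d + (p + (- \<delta> + p))} \<le> 1" by simp
      ultimately show ?thesis
        by (intro order_trans[OF card_Un_le] add_mono)
    qed
    moreover have "finite ?N" using A by simp
    ultimately have "card (colour_nbrs S ?X (- d + p)) \<le> 2 + 3 + 2 + 1"
      using card_mono by (meson le_trans)
    then show ?thesis by simp
  qed
  show "card (colour_nbrs S ?X v) \<le> 8" if "v \<in> pm ?X" for v
  proof -
    from that obtain d where d: "d \<in> A" "v = - d + p \<or> v = - (- d + p)"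
      by (auto simp: in_pm_gadget group_word)
    then show ?thesis using bound[OF d(1)] colour_nbrs_uminus[of S ?X "- d + p"] by auto
  qed
qed

section \<open>A large cyclic subgroup\<close>

text \<open>Equal values occur only at indices more than \<open>M\<close> apart, so each block of
  \<open>M\<close> consecutive indices contains a given value at most once, and
  \<open>{1..L}\<close> meets at most \<open>L div M + 1\<close> blocks.\<close>

lemma card_fibres_le:
  fixes h :: "nat \<Rightarrow> 'b" and M L :: nat
  assumes M: "0 < M" and F: "finite F"
    and far: "\<And>i j. 1 \<le> i \<Longrightarrow> i < j \<Longrightarrow> j \<le> L \<Longrightarrow> h i = h j \<Longrightarrow> M < j - i"
  shows "card {j \<in> {1..L}. h j \<in> F} \<le> card F * (L div M + 1)"
proof -
  have one: "card {j \<in> {1..L}. h j = f} \<le> L div M + 1" for f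
  proof -
    have "inj_on (\<lambda>j. j div M) {j \<in> {1..L}. h j = f}"
    proof (rule linorder_inj_onI)
      fix i j assume ij: "i < j" "i \<in> {j \<in> {1..L}. h j = f}" "j \<in> {j \<in> {1..L}. h j = f}"
      then have "M < j - i" using far[of i j] by auto
      then have "i + M \<le> j" by simp
      then have "(i + M) div M \<le> j div M" by (rule div_le_mono)
      then show "i div M \<noteq> j div M" using M div_add_self2[of M i] by linarith
    qed auto
    then have "card {j \<in> {1..L}. h j = f} = card ((\<lambda>j. j div M) ` {j \<in> {1..L}. h j = f})"
      by (simp add: card_image)
    also have "\<dots> \<le> card {..L div M}"
      by (rule card_mono) (auto intro: div_le_mono)
    finally show ?thesis by simp
  qed
  have "{j \<in> {1..L}. h j \<in> F} = (\<Union>f\<in>F. {j \<in> {1..L}. h j = f})" by auto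
  also have "card \<dots> \<le> (\<Sum>f\<in>F. card {j \<in> {1..L}. h j = f})"
    by (rule card_UN_le[OF F])
  also have "\<dots> \<le> (\<Sum>f\<in>F. L div M + 1)"
    by (rule sum_mono) (rule one)
  finally show ?thesis by simp
qed

lemma card_preimage_le:
  fixes h :: "nat \<Rightarrow> 'b"
  assumes "finite F" and "\<And>i j. 1 \<le> i \<Longrightarrow> i < j \<Longrightarrow> j \<le> L \<Longrightarrow> h i \<noteq> h j"
  shows "card {j \<in> {1..L}. h j \<in> F} \<le> card F"
proof (rule card_inj_on_le)
  show "inj_on h {j \<in> {1..L}. h j \<in> F}"
    by (rule linorder_inj_onI) (use assms in auto)
qed (use assms in auto)

lemma exists_avoiding:
  fixes L :: nat
  assumes "card (\<Union>B\<in>\<B>. B \<inter> {1..L}) < L"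
  shows "\<exists>j\<in>{1..L}. \<forall>B\<in>\<B>. j \<notin> B"
proof (rule ccontr)
  assume "\<not> ?thesis"
  then have "{1..L} \<subseteq> (\<Union>B\<in>\<B>. B \<inter> {1..L})" by auto
  then have "card {1..L} \<le> card (\<Union>B\<in>\<B>. B \<inter> {1..L})"
    by (rule card_mono[rotated]) (rule finite_subset[of _ "{1..L}"], auto)
  with assms show False by simp
qed

text \<open>\<open>c i\<close> is the \<open>i\<close>-th power of the element of large order. Only
  the nonvanishing below \<open>N\<close> is recorded, so that infinite order and large finite order
  need no distinction.\<close>

locale cyclic_part =
  fixes c :: "int \<Rightarrow> 'g::group_add" and N :: int
  assumes c_add: "c (i + j) = c i + c j"
    and c_neq_0: "0 < i \<Longrightarrow> i < N \<Longrightarrow> c i \<noteq> 0"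
begin

lemma c_0 [simp]: "c 0 = 0"
  using c_add[of 0 0] by (metis add.right_neutral add_left_cancel)

lemma c_uminus: "c (- i) = - c i"
  using c_add[of i "- i"] by (simp add: eq_neg_iff_add_eq_0 c_add[symmetric])

lemma c_commute: "c i + c j = c j + c i"
  by (metis c_add add.commute)

lemma c_inj:
  assumes "c i = c j" "\<bar>i - j\<bar> < N"
  shows "i = j"
proof -
  have "c (i - j) = 0" "c (j - i) = 0"
    using assms(1) c_add[of i "- j"] c_add[of j "- i"] by (simp_all add: c_uminus group_word)
  with c_neq_0[of "i - j"] c_neq_0[of "j - i"] assms(2) show ?thesis by force
qed

text \<open>Conjugation by \<open>q\<close> takes \<open>c j\<close> to \<open>c i\<close>.
  Commuting (\<open>j = i\<close>) and inverting (\<open>j = - i\<close>) are the cases of interest.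
  The common notion composes, so the parity rules for words in inverting elements all follow from
  one lemma.\<close>

definition slides :: "int \<Rightarrow> int \<Rightarrow> 'g \<Rightarrow> bool" where
  "slides i j q \<longleftrightarrow> c i + q = q + c j"

abbreviation commutes :: "int \<Rightarrow> 'g \<Rightarrow> bool" where
  "commutes i \<equiv> slides i i"

abbreviation inverts :: "int \<Rightarrow> 'g \<Rightarrow> bool" where
  "inverts i \<equiv> slides i (- i)"

lemma slidesD: "slides i j q \<Longrightarrow> c i + (q + r) = q + (c j + r)"
  by (simp add: slides_def add.assoc[symmetric])

lemma slides_0 [simp]: "slides i j 0 \<longleftrightarrow> c i = c j"
  by (simp add: slides_def)

lemma slides_add_index:
  assumes "slides i j q" "slides i' j' q"
  shows "slides (i + i') (j + j') q"
proof -
  have "c i + (c i' + q) = (c i + q) + c j'"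
    using assms(2) by (simp add: slides_def add.assoc)
  also have "\<dots> = q + c j + c j'" using assms(1) by (simp add: slides_def)
  finally show ?thesis by (simp add: slides_def c_add add.assoc)
qed

lemma slides_uminus_index:
  assumes "slides i j q"
  shows "slides (- i) (- j) q"
proof -
  have "- c i + (c i + q) + - c j = - c i + (q + c j) + - c j"
    using assms by (simp only: slides_def)
  then show ?thesis by (simp add: slides_def c_uminus group_word)
qed

lemma slides_mult_nat: "slides i j q \<Longrightarrow> slides (i * int n) (j * int n) q"
proof (induction n)
  case (Suc n)
  then show ?case using slides_add_index[of i j q "i * int n" "j * int n"]
    by (simp add: algebra_simps)
qed (simp add: slides_def)

lemma slides_mult:
  assumes "slides i j q"
  shows "slides (i * n) (j * n) q"
proof (cases "n \<ge> 0")
  case True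
  then show ?thesis using slides_mult_nat[OF assms, of "nat n"] by simp
next
  case False
  then show ?thesis using slides_uminus_index[OF slides_mult_nat[OF assms, of "nat (- n)"]] by simp
qed

lemma commutes_dvd: "commutes i q \<Longrightarrow> i dvd j \<Longrightarrow> commutes j q"
  using slides_mult by (auto elim!: dvdE)

lemma inverts_dvd: "inverts i q \<Longrightarrow> i dvd j \<Longrightarrow> inverts j q"
  using slides_mult[of i "- i" q] by (auto elim!: dvdE)

lemma slides_add: "slides i j q \<Longrightarrow> slides j l r \<Longrightarrow> slides i l (q + r)"
  unfolding slides_def by (metis add.assoc)

lemma slides_uminus:
  assumes "slides i j q"
  shows "slides j i (- q)"
proof -
  have "- q + (c i + q) + - q = - q + (q + c j) + - q"
    using assms by (simp only: slides_def)
  then show ?thesis by (simp add: slides_def group_word)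
qed

lemma commutes_c [simp]: "commutes i (c j)"
  by (simp add: slides_def c_commute)

lemma commutes_uminus [simp]: "commutes i (- q) \<longleftrightarrow> commutes i q"
  using slides_uminus[of i i q] slides_uminus[of i i "- q"] by auto

lemma inverts_uminus [simp]: "inverts i (- q) \<longleftrightarrow> inverts i q"
proof -
  have "inverts i (- r)" if "inverts i r" for r
    using slides_uminus_index[OF slides_uminus[OF that]] by simp
  from this[of q] this[of "- q"] show ?thesis by auto
qed

lemma commutes_add: "commutes i q \<Longrightarrow> commutes i r \<Longrightarrow> commutes i (q + r)"
  by (rule slides_add)

lemma inverts_add1: "inverts i q \<Longrightarrow> commutes i r \<Longrightarrow> inverts i (q + r)"
  by (rule slides_add) (auto dest: slides_uminus_index)

lemma inverts_add2: "commutes i q \<Longrightarrow> inverts i r \<Longrightarrow> inverts i (q + r)"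
  by (rule slides_add)

lemma commutes_add_inverts: "inverts i q \<Longrightarrow> inverts i r \<Longrightarrow> commutes i (q + r)"
  by (rule slides_add) (auto dest: slides_uminus_index)

text \<open>Otherwise \<open>c i = c (- i)\<close>, although the two indices differ by less than
  \<open>N\<close>.\<close>

lemma not_commutes_inverts:
  assumes "commutes i q" "inverts i q" "0 < i" "2 * i < N"
  shows False
proof -
  have "q + c i = q + c (- i)" using assms by (simp add: slides_def)
  then have "c i = c (- i)" by simp
  from c_inj[OF this] assms show False by simp
qed

lemma not_commutes_inverts_mult:
  assumes "commutes i q" "inverts j q" "0 < i" "0 < j" "2 * (i * j) < N"
  shows False
proof (rule not_commutes_inverts)
  show "commutes (i * j) q" "inverts (i * j) q"
    using assms commutes_dvd inverts_dvd by simp_all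
qed (use assms in auto)

lemma inverts_iff: "inverts i q \<longleftrightarrow> c i + (q + c i) = q"
proof -
  have "c i + q = q + - c i \<longleftrightarrow> c i + q + c i = q + - c i + c i" by (simp only: add_right_cancel)
  then show ?thesis by (simp add: slides_def c_uminus add.assoc)
qed

text \<open>The parameter is \<open>D * j\<close> with \<open>j\<close> at most \<open>L\<close>,
  counted against the bad \<open>j\<close>. The same coincidence at two values of \<open>j\<close>
  forces an element to commute with, or to invert, \<open>c\<close> at \<open>D\<close> times their
  difference. By the dichotomies \<open>resQ\<close> and \<open>resA\<close>, either this happens at
  \<open>D\<close> already and is reported in the conclusion, or the bad values are more than
  \<open>M\<close> apart and hence few.\<close>

lemma generic_parameter:
  fixes T V A Q :: "'g set" and D L M :: nat and w :: 'g
  assumes fin: "finite T" "finite V" "finite A" "finite Q"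
    and pos: "0 < D" "0 < M" and DL: "2 * int (D * L) < N"
    and diff: "\<And>d e. d \<in> A \<Longrightarrow> e \<in> A \<Longrightarrow> d \<noteq> e \<Longrightarrow> d + - e \<in> pm Q"
    and resQ: "\<And>q. q \<in> Q \<Longrightarrow> commutes (int D) q \<or> (\<forall>l\<in>{1..M}. \<not> commutes (int (D * l)) q)"
    and resA: "\<And>e. e \<in> A \<Longrightarrow>
      inverts (int D) (w + - e) \<or> (\<forall>l\<in>{1..M}. \<not> inverts (int (D * l)) (w + - e))"
    and count: "card A * (card V + card (pm0 T) ^ 2)
      + (card Q * card (pm0 T) + card A * (card A * card (pm0 T))) * (L div M + 1) < L"
  obtains b where "int D dvd b" "0 < b" "b \<le> int (D * L)"
    "\<And>d. d \<in> A \<Longrightarrow> - d + (c b + w) \<notin> V"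
    "\<And>d x y. d \<in> A \<Longrightarrow> x \<in> pm0 T \<Longrightarrow> y \<in> pm0 T \<Longrightarrow> - d + (c b + w) \<noteq> x + y"
    "\<And>d e. d \<in> A \<Longrightarrow> e \<in> A \<Longrightarrow> d \<noteq> e \<Longrightarrow>
      - (c b + w) + (d + (- e + (c b + w))) \<in> pm0 T \<Longrightarrow> commutes (int D) (d + - e)"
    "\<And>d e. d \<in> A \<Longrightarrow> e \<in> A \<Longrightarrow>
      - d + ((c b + w) + (- e + (c b + w))) \<in> pm0 T \<Longrightarrow> inverts (int D) (w + - e)"
proof -
  let ?p = "\<lambda>j. c (int (D * j)) + w"
  let ?\<tau> = "card (pm0 T)" and ?l = "L div M + 1"
  let ?W = "V \<union> (\<lambda>(x, y). x + y) ` (pm0 T \<times> pm0 T)"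
  let ?AT = "(\<lambda>(d, x). d + x) ` (A \<times> pm0 T)"
  let ?Q' = "{q \<in> Q. \<not> commutes (int D) q}" and ?A' = "{e \<in> A. \<not> inverts (int D) (w + - e)}"
  \<comment> \<open>\<open>B1\<close> is about new colours that hit \<open>V\<close> or sums of two
    old ones, \<open>B2\<close> about conjugates of differences by \<open>p\<close>, and
    \<open>B3\<close> about the twists \<open>p - e + p\<close>.\<close>
  define B1 where "B1 d = {j \<in> {1..L}. - d + ?p j \<in> ?W}" for d
  define B2 where "B2 q = {j \<in> {1..L}. - ?p j + (q + ?p j) \<in> pm0 T}" for q
  define B3 where "B3 e = {j \<in> {1..L}. ?p j + (- e + ?p j) \<in> ?AT}" for e
  let ?\<B> = "B1 ` A \<union> B2 ` ?Q' \<union> B3 ` ?A'"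
  have finW: "finite ?W" "finite ?AT" using fin by auto
  have cardW: "card ?W \<le> card V + ?\<tau> ^ 2"
    using fin by (intro order_trans[OF card_Un_le] add_left_mono order_trans[OF card_image_le])
      (auto simp: card_cartesian_product power2_eq_square)
  have cardAT: "card ?AT \<le> card A * ?\<tau>"
    using fin by (intro order_trans[OF card_image_le]) (auto simp: card_cartesian_product)
  have shift: "?p j = c (int (D * (j - i))) + ?p i" if "i < j" for i j
  proof -
    have "int (D * j) = int (D * (j - i)) + int (D * i)"
      using that by (simp add: of_nat_diff algebra_simps)
    then show ?thesis by (simp only: c_add add.assoc)
  qed
  have shift': "c (int (D * i)) + c (int (D * (j - i))) = c (int (D * j))" if "i < j" for i j
  proof -
    have "int (D * j) = int (D * i) + int (D * (j - i))"
      using that by (simp add: of_nat_diff algebra_simps)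
    then show ?thesis by (simp only: c_add)
  qed
  have card1: "card (B1 d) \<le> card V + ?\<tau> ^ 2" if "d \<in> A" for d
    unfolding B1_def
  proof (rule order_trans[OF card_preimage_le[OF finW(1)] cardW])
    fix i j assume ij: "1 \<le> i" "i < j" "j \<le> L"
    have "int (D * j) \<le> int (D * L)" "int (D * i) < int (D * j)" using ij pos by auto
    then have "c (int (D * i)) \<noteq> c (int (D * j))"
      using c_inj[of "int (D * i)" "int (D * j)"] DL by linarith
    then show "- d + ?p i \<noteq> - d + ?p j" by (simp del: of_nat_mult)
  qed
  have card2: "card (B2 q) \<le> ?\<tau> * ?l" if q: "q \<in> ?Q'" for q
    unfolding B2_def
  proof (rule card_fibres_le[OF pos(2)])
    fix i j assume ij: "1 \<le> i" "i < j" "j \<le> L" and eq: "- ?p i + (q + ?p i) = - ?p j + (q + ?p j)"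
    let ?c = "c (int (D * (j - i)))"
    from eq have "?c + (?p i + (- ?p i + (q + ?p i)) + - ?p i)
        = ?c + (?p i + (- ?p j + (q + ?p j)) + - ?p i)" by simp
    then have "?c + q = q + ?c"
      unfolding shift[OF ij(2)] by (simp add: group_word del: of_nat_mult)
    then have "commutes (int (D * (j - i))) q" by (simp add: slides_def)
    moreover have "\<forall>l\<in>{1..M}. \<not> commutes (int (D * l)) q" using resQ[of q] q by blast
    moreover have "j - i \<ge> 1" using ij(2) by simp
    ultimately show "M < j - i" by (meson atLeastAtMost_iff not_le)
  qed (use fin in simp)
  have card3: "card (B3 e) \<le> (card A * ?\<tau>) * ?l" if e: "e \<in> ?A'" for e
    unfolding B3_def
  proof (rule order_trans[OF card_fibres_le[OF pos(2) finW(2)] mult_right_mono[OF cardAT]])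
    fix i j assume ij: "1 \<le> i" "i < j" "j \<le> L" and eq: "?p i + (- e + ?p i) = ?p j + (- e + ?p j)"
    let ?c = "c (int (D * (j - i)))" and ?i = "c (int (D * i))"
    \<comment> \<open>Cancelling the outer powers and \<open>w\<close> leaves the equation saying
      that \<open>w - e\<close> inverts \<open>c (D * (j - i))\<close>.\<close>
    have "?i + ((w + - e) + ?i) + w = ?i + (?c + ((w + - e) + (?c + ?i))) + w"
    proof -
      have "?p j = ?i + ?c + w" "?p j = ?c + ?i + w"
        using shift'[OF ij(2)] shift[OF ij(2)] by (simp_all add: add.assoc del: of_nat_mult)
      with eq have "?p i + (- e + ?p i) = ?i + ?c + w + (- e + (?c + ?i + w))" by metis
      then show ?thesis by (simp add: group_word del: of_nat_mult)
    qed
    then have "(w + - e) + ?i = ?c + ((w + - e) + (?c + ?i))"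
      by (simp only: add_left_cancel add_right_cancel)
    then have "(w + - e) + ?i = (?c + ((w + - e) + ?c)) + ?i" by (simp only: add.assoc)
    then have "w + - e = ?c + ((w + - e) + ?c)" by (simp only: add_right_cancel)
    then have "inverts (int (D * (j - i))) (w + - e)" by (simp add: inverts_iff del: of_nat_mult)
    moreover have "\<forall>l\<in>{1..M}. \<not> inverts (int (D * l)) (w + - e)" using resA[of e] e by blast
    moreover have "j - i \<ge> 1" using ij(2) by simp
    ultimately show "M < j - i" by (meson atLeastAtMost_iff not_le)
  qed simp
  have cardU: "card (\<Union> (f ` I)) \<le> card I * n" if "finite I" "\<And>i. i \<in> I \<Longrightarrow> card (f i) \<le> n"
    for f :: "'g \<Rightarrow> nat set" and I n
    using card_UN_le[OF that(1), of f] sum_bounded_above[of I "\<lambda>i. card (f i)" n] that by simp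
  have U1: "card (\<Union> (B1 ` A)) \<le> card A * (card V + ?\<tau> ^ 2)"
    using fin card1 by (intro cardU) auto
  have "card (\<Union> (B2 ` ?Q')) \<le> card ?Q' * (?\<tau> * ?l)"
    using fin card2 by (intro cardU) auto
  also have "\<dots> \<le> card Q * (?\<tau> * ?l)"
    using fin by (intro mult_right_mono card_mono) auto
  finally have U2: "card (\<Union> (B2 ` ?Q')) \<le> card Q * (?\<tau> * ?l)" .
  have "card (\<Union> (B3 ` ?A')) \<le> card ?A' * (card A * ?\<tau> * ?l)"
    using fin card3 by (intro cardU) auto
  also have "\<dots> \<le> card A * (card A * ?\<tau> * ?l)"
    using fin by (intro mult_right_mono card_mono) auto
  finally have U3: "card (\<Union> (B3 ` ?A')) \<le> card A * (card A * ?\<tau> * ?l)" .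
  have "card (\<Union> ?\<B>) \<le> card (\<Union> (B1 ` A)) + card (\<Union> (B2 ` ?Q')) + card (\<Union> (B3 ` ?A'))"
    unfolding Union_Un_distrib
    using card_Un_le[of "\<Union> (B1 ` A) \<union> \<Union> (B2 ` ?Q')" "\<Union> (B3 ` ?A')"]
      card_Un_le[of "\<Union> (B1 ` A)" "\<Union> (B2 ` ?Q')"] by linarith
  also have "\<dots> \<le> card A * (card V + ?\<tau>^2)
      + (card Q * ?\<tau> + card A * (card A * ?\<tau>)) * ?l"
    using U1 U2 U3 by (simp add: algebra_simps)
  finally have "card (\<Union> ?\<B>) < L" using count by linarith
  moreover have "B \<inter> {1..L} = B" if "B \<in> ?\<B>" for B
  proof -
    have "B1 d \<subseteq> {1..L}" "B2 d \<subseteq> {1..L}" "B3 d \<subseteq> {1..L}" for d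
      unfolding B1_def B2_def B3_def by (rule Collect_restrict)+
    with that show ?thesis by blast
  qed
  then have "(\<Union>B\<in>?\<B>. B \<inter> {1..L}) = \<Union> ?\<B>" by simp
  ultimately obtain j where j: "j \<in> {1..L}" "\<And>B. B \<in> ?\<B> \<Longrightarrow> j \<notin> B"
    using exists_avoiding[of L ?\<B>] by auto
  let ?b = "int (D * j)"
  show ?thesis
  proof (rule that[of ?b])
    show "int D dvd ?b" "0 < ?b" "?b \<le> int (D * L)" using j pos by auto
    have W: "- d + ?p j \<notin> ?W" if "d \<in> A" for d
    proof -
      have "j \<notin> B1 d" using j(2) that by blast
      then show ?thesis using j(1) by (simp only: B1_def mem_Collect_eq simp_thms)
    qed
    show "- d + ?p j \<notin> V" if "d \<in> A" for d
      using W[OF that] by blast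
    show "- d + ?p j \<noteq> x + y" if "d \<in> A" "x \<in> pm0 T" "y \<in> pm0 T" for d x y
      using W[OF that(1)] that(2,3) by (metis (mono_tags, lifting) UnI2 image_eqI mem_Sigma_iff prod.case)
    show "commutes (int D) (d + - e)"
      if "d \<in> A" "e \<in> A" "d \<noteq> e" "- ?p j + (d + (- e + ?p j)) \<in> pm0 T" for d e
    proof (rule ccontr)
      assume nc: "\<not> commutes (int D) (d + - e)"
      from diff[OF that(1-3)] consider "d + - e \<in> Q" | "- (d + - e) \<in> Q" by (auto simp: in_pm)
      then show False
      proof cases
        case 1
        have "- ?p j + ((d + - e) + ?p j) \<in> pm0 T"
          using that(4) by (simp only: add.assoc)
        then have "j \<in> B2 (d + - e)" "d + - e \<in> ?Q'"
          using 1 nc j(1) by (simp_all add: B2_def del: of_nat_mult)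
        then show False using j(2) by blast
      next
        case 2
        have "- (- ?p j + (d + (- e + ?p j))) = - ?p j + (- (d + - e) + ?p j)"
          by (simp add: group_word del: of_nat_mult)
        then have "- ?p j + (- (d + - e) + ?p j) \<in> pm0 T"
          using that(4) by (metis pm0_uminus)
        moreover have "\<not> commutes (int D) (- (d + - e))" using nc by (subst commutes_uminus)
        ultimately have "j \<in> B2 (- (d + - e))" "- (d + - e) \<in> ?Q'"
          using 2 j(1) by (auto simp: B2_def simp del: of_nat_mult)
        then show False using j(2) by blast
      qed
    qed
    show "inverts (int D) (w + - e)"
      if "d \<in> A" "e \<in> A" "- d + (?p j + (- e + ?p j)) \<in> pm0 T" for d e
    proof (rule ccontr)
      assume "\<not> inverts (int D) (w + - e)"
      moreover have "?p j + (- e + ?p j) \<in> ?AT"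
        using that by (intro image_eqI[of _ _ "(d, - d + (?p j + (- e + ?p j)))"]) auto
      ultimately have "j \<in> B3 e" "e \<in> ?A'"
        using that(2) j(1) by (simp_all only: B3_def mem_Collect_eq simp_thms)
      then show False using j(2) by blast
    qed
  qed
qed

end

context cyclic_part
begin

text \<open>The colours \<open>k\<close> of the edges of the gadget at \<open>- d + p\<close> and at \<open>- p + d\<close>, where \<open>p = c b + w\<close>
  and \<open>b\<close> is a generic multiple of \<open>D\<close>.\<close>

definition colours_left :: "int \<Rightarrow> 'g \<Rightarrow> 'g set \<Rightarrow> 'g \<Rightarrow> 'g set" where
  "colours_left D w A d = {- d + e |e. e \<in> A} \<union> {- d + (w + (- e + w)) |e. e \<in> A \<and> inverts D (w + - e)}"

definition colours_right :: "int \<Rightarrow> 'g \<Rightarrow> 'g set \<Rightarrow> 'g \<Rightarrow> 'g set" where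
  "colours_right D w A d = {- w + (d + (- e + w)) |e. e \<in> A \<and> commutes D (d + - e)} \<union>
     {- w + (d + (- w + e)) |e. e \<in> A \<and> inverts D (w + - d)}"

text \<open>A power that commutes with \<open>q\<close> cancels from the conjugate, so the result no
  longer depends on the generic \<open>b\<close>. The next lemma does the same for twists.\<close>

lemma conj_commutes: "commutes b q \<Longrightarrow> - (c b + w) + (q + (c b + w)) = - w + (q + w)"
proof -
  assume q: "commutes b q"
  show ?thesis using slidesD[OF q, of w] by (simp add: group_word flip: slidesD[OF q])
qed

lemma twist_inverts: "inverts b (w + - e) \<Longrightarrow> (c b + w) + (- e + (c b + w)) = w + (- e + w)"
proof -
  assume "inverts b (w + - e)"
  then have "c b + (w + - e + c b) = w + - e" by (simp only: inverts_iff)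
  then have "c b + (w + - e + c b) + w = w + - e + w" by simp
  then show ?thesis by (simp add: add.assoc)
qed

text \<open>Of all coincidences only those with \<open>commutes D\<close> or
  \<open>inverts D\<close> survive the generic choice, and in these the power \<open>c b\<close>
  cancels. The hypotheses \<open>right\<close>, \<open>left\<close> and \<open>uniq\<close> are
  therefore about words in \<open>w\<close> and \<open>A\<close> alone, and so are the colour sets
  in the conclusion.\<close>

lemma exists_gadget:
  fixes S T V A Q :: "'g set" and D L M :: nat and w :: 'g
  assumes fin: "finite T" "finite V" "finite Q" and ST: "S \<subseteq> T" "0 \<notin> pm T"
    and V: "\<And>v. - v \<in> V \<longleftrightarrow> v \<in> V"
    and A: "finite A" "card A \<le> 3" "A \<subseteq> pm0 S" "0 \<in> A"
    and outside: "\<And>t a b. t \<in> pm T \<Longrightarrow> t \<notin> pm S \<Longrightarrow> a \<in> pm0 S \<Longrightarrow> b \<in> pm0 S \<Longrightarrow> t \<noteq> a + b"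
    and pos: "0 < D" "0 < M" and DL: "2 * int (D * L) < N"
    and diff: "\<And>d e. d \<in> A \<Longrightarrow> e \<in> A \<Longrightarrow> d \<noteq> e \<Longrightarrow> d + - e \<in> pm Q"
    and resQ: "\<And>q. q \<in> Q \<Longrightarrow> commutes (int D) q \<or> (\<forall>l\<in>{1..M}. \<not> commutes (int (D * l)) q)"
    and resA: "\<And>e. e \<in> A \<Longrightarrow>
      inverts (int D) (w + - e) \<or> (\<forall>l\<in>{1..M}. \<not> inverts (int (D * l)) (w + - e))"
    and count: "card A * (card V + card (pm0 T) ^ 2)
      + (card Q * card (pm0 T) + card A * (card A * card (pm0 T))) * (L div M + 1) < L"
    and right: "\<And>d e. d \<in> A \<Longrightarrow> e \<in> A \<Longrightarrow> d \<noteq> e \<Longrightarrow> commutes (int D) (d + - e) \<Longrightarrow>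
      - w + (d + (- e + w)) \<in> pm T \<Longrightarrow> - w + (d + (- e + w)) \<in> pm S"
    and left: "\<And>d e. d \<in> A \<Longrightarrow> e \<in> A \<Longrightarrow> inverts (int D) (w + - e) \<Longrightarrow>
      - d + (w + (- e + w)) \<in> pm T \<Longrightarrow> - d + (w + (- e + w)) \<in> pm S"
    and uniq: "\<And>e. e \<in> A \<Longrightarrow> inverts (int D) (w + - e) \<Longrightarrow> e = \<delta>"
  obtains b where "int D dvd b" "0 < b" "b \<le> int (D * L)" "fresh S V T (gadget (c b + w) A)"
    "\<And>d k. d \<in> A \<Longrightarrow> k \<in> pm S \<Longrightarrow>
      - d + (c b + w) \<in> link (gadget (c b + w) A) k \<longleftrightarrow> k \<in> colours_left (int D) w A d"
    "\<And>d k. d \<in> A \<Longrightarrow> k \<in> pm S \<Longrightarrow>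
      - (c b + w) + d \<in> link (gadget (c b + w) A) k \<longleftrightarrow> k \<in> colours_right (int D) w A d"
    "\<And>d e. d \<in> A \<Longrightarrow> e \<in> A \<Longrightarrow> - d + (c b + w) = - (c b + w) + e \<Longrightarrow> inverts (int D) (w + - d)"
    "\<And>x. x \<in> gadget (c b + w) A \<Longrightarrow> x + x = 0 \<Longrightarrow>
      \<exists>d\<in>A. inverts (int D) (w + - d) \<and> (w + - d) + (w + - d) = 0"
proof -
  obtain b where b: "int D dvd b" "0 < b" "b \<le> int (D * L)"
    and gV: "\<And>d. d \<in> A \<Longrightarrow> - d + (c b + w) \<notin> V"
    and gT: "\<And>d x y. d \<in> A \<Longrightarrow> x \<in> pm0 T \<Longrightarrow> y \<in> pm0 T \<Longrightarrow> - d + (c b + w) \<noteq> x + y"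
    and g2: "\<And>d e. d \<in> A \<Longrightarrow> e \<in> A \<Longrightarrow> d \<noteq> e \<Longrightarrow>
      - (c b + w) + (d + (- e + (c b + w))) \<in> pm0 T \<Longrightarrow> commutes (int D) (d + - e)"
    and g3: "\<And>d e. d \<in> A \<Longrightarrow> e \<in> A \<Longrightarrow>
      - d + ((c b + w) + (- e + (c b + w))) \<in> pm0 T \<Longrightarrow> inverts (int D) (w + - e)"
    using generic_parameter[where T = T and V = V and A = A and Q = Q and D = D and L = L and M = M
        and w = w, OF fin(1,2) A(1) fin(3) pos DL diff resQ resA count] by blast
  let ?p = "c b + w" and ?X = "gadget (c b + w) A"
  have pmT: "x \<in> pm0 T" if "x \<in> pm T" for x using that by (simp add: pm0_def)
  have pmS: "x \<in> pm T" if "x \<in> pm S" for x using that pm_mono[OF ST(1)] by blast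
  have T0: "0 \<in> pm0 T" by (simp add: pm0_def)
  have conj: "- ?p + (d + (- e + ?p)) = - w + (d + (- e + w))" if "commutes (int D) (d + - e)" for d e
    using conj_commutes[OF commutes_dvd[OF that b(1)], of w] by (simp add: add.assoc)
  have twist: "?p + (- e + ?p) = w + (- e + w)" if "inverts (int D) (w + - e)" for e
    using twist_inverts[OF inverts_dvd[OF that b(1)]] .
  have twist': "- ?p + (d + - ?p) = - w + (d + - w)" if "inverts (int D) (w + - d)" for d
  proof -
    have "- (?p + (- d + ?p)) = - (w + (- d + w))" using twist[OF that] by simp
    then show ?thesis by (simp add: group_word)
  qed
  have fresh: "fresh S V T ?X"
  proof (rule fresh_gadget[where \<delta> = \<delta>])
    \<comment> \<open>A sum of two elements of \<open>pm0 S\<close> that lies in \<open>pm T\<close>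
      already lies in \<open>pm S\<close>, because gadget elements are never such sums.\<close>
    show "- d + e \<in> pm S" if "d \<in> A" "e \<in> A" "- d + e \<in> pm T" for d e
      using outside[of "- d + e" "- d" e] that A(3) by auto
    show "- ?p + (d + (- e + ?p)) \<in> pm S"
      if "d \<in> A" "e \<in> A" "- ?p + (d + (- e + ?p)) \<in> pm T" for d e
    proof -
      have "d \<noteq> e" using that(3) ST(2) by (auto simp: group_word)
      with g2 that have "commutes (int D) (d + - e)" by (blast intro: pmT)
      with right that conj \<open>d \<noteq> e\<close> show ?thesis by metis
    qed
    show "- d + (?p + (- e + ?p)) \<in> pm S"
      if "d \<in> A" "e \<in> A" "- d + (?p + (- e + ?p)) \<in> pm T" for d e
      using left[OF that(1,2)] g3[OF that(1,2) pmT[OF that(3)]] that(3) twist by metis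
    show "e = \<delta>" if "d \<in> A" "e \<in> A" "- d + (?p + (- e + ?p)) \<in> pm S" for d e
      using uniq g3[OF that(1,2) pmT[OF pmS[OF that(3)]]] that(2) by blast
  qed (use A ST V gV gT in auto)
  show ?thesis
  proof (rule that[OF b fresh])
    have tl: "- k + (- d + ?p) \<in> pm ?X \<longleftrightarrow> k \<in> colours_left (int D) w A d"
      if dk: "d \<in> A" "k \<in> pm S" for d k
    proof -
      have "- k + (- d + ?p) \<in> pm ?X \<longleftrightarrow> (\<exists>e\<in>A. k = - d + e \<or> k = - d + (?p + (- e + ?p)))"
        by (rule uminus_add_in_pm_gadget)
      also have "\<dots> \<longleftrightarrow> k \<in> colours_left (int D) w A d"
      proof -
        have "k = - d + (?p + (- e + ?p)) \<longleftrightarrow> inverts (int D) (w + - e) \<and> k = - d + (w + (- e + w))"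
          if "e \<in> A" for e
          using g3[OF dk(1) that] dk(2) twist[of e] pmT[OF pmS[OF dk(2)]] by metis
        then show ?thesis by (auto simp: colours_left_def)
      qed
      finally show ?thesis .
    qed
    show "- d + ?p \<in> link ?X k \<longleftrightarrow> k \<in> colours_left (int D) w A d" if "d \<in> A" "k \<in> pm S" for d k
      using tl[OF that] that by (auto simp: link_def in_pm_gadget)
    have tr: "- k + (- ?p + d) \<in> pm ?X \<longleftrightarrow> k \<in> colours_right (int D) w A d"
      if dk: "d \<in> A" "k \<in> pm S" for d k
    proof -
      have "- k + (- ?p + d) \<in> pm ?X
          \<longleftrightarrow> (\<exists>e\<in>A. k = - ?p + (d + (- e + ?p)) \<or> k = - ?p + (d + (- ?p + e)))"
        by (rule uminus_add_in_pm_gadget)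
      also have "\<dots> \<longleftrightarrow> k \<in> colours_right (int D) w A d"
      proof -
        have k0: "k \<noteq> 0" using dk(2) ST(2) pmS by blast
        have "k = - ?p + (d + (- e + ?p)) \<longleftrightarrow> commutes (int D) (d + - e) \<and> k = - w + (d + (- e + w))"
          if "e \<in> A" for e
        proof (cases "d = e")
          case True
          then show ?thesis using k0 by (simp add: group_word)
        next
          case False
          then show ?thesis
            using g2[OF dk(1) that] dk(2) conj[of d e] pmT[OF pmS[OF dk(2)]] by metis
        qed
        moreover have "k = - ?p + (d + (- ?p + e)) \<longleftrightarrow>
            inverts (int D) (w + - d) \<and> k = - w + (d + (- w + e))" if "e \<in> A" for e
        proof -
          have "- ?p + (d + (- ?p + e)) = - w + (d + (- w + e))" if "inverts (int D) (w + - d)"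
          proof -
            have "- ?p + (d + - ?p) + e = - w + (d + - w) + e" using twist'[OF that] by simp
            then show ?thesis by (simp add: add.assoc)
          qed
          moreover have "inverts (int D) (w + - d)" if k: "k = - ?p + (d + (- ?p + e))"
          proof -
            have "- k = - e + (?p + (- d + ?p))" unfolding k by (simp add: group_word)
            moreover have "- k \<in> pm0 T" using dk(2) pmT pmS by simp
            ultimately show ?thesis using g3[OF \<open>e \<in> A\<close> dk(1)] by simp
          qed
          ultimately show ?thesis by metis
        qed
        ultimately show ?thesis by (auto simp: colours_right_def)
      qed
      finally show ?thesis .
    qed
    show "- ?p + d \<in> link ?X k \<longleftrightarrow> k \<in> colours_right (int D) w A d" if "d \<in> A" "k \<in> pm S" for d k
      using tr[OF that] that by (auto simp: link_def in_pm_gadget)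
    show "inverts (int D) (w + - d)" if "d \<in> A" "e \<in> A" "- d + ?p = - ?p + e" for d e
    proof -
      have "?p + (- d + ?p) = e" using that(3) by simp
      then have "- e + (?p + (- d + ?p)) = 0" by simp
      with g3[OF that(2,1)] T0 show ?thesis by simp
    qed
    show "\<exists>d\<in>A. inverts (int D) (w + - d) \<and> (w + - d) + (w + - d) = 0"
      if x: "x \<in> ?X" "x + x = 0" for x
    proof -
      from x(1) obtain d where d: "d \<in> A" "x = - d + ?p" by (auto simp: gadget_def)
      have eq: "- d + (?p + (- d + ?p)) = 0" using x(2) d(2) by (simp add: add.assoc)
      have i: "inverts (int D) (w + - d)" using g3[OF d(1) d(1)] eq T0 by simp
      then have "- d + (w + (- d + w)) = 0" using eq twist[OF i] by simp
      then have "w + (- d + w) = d" by (metis add.right_neutral add_minus_cancel)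
      then have "w + (- d + w) + - d = 0" by simp
      then show ?thesis using d(1) i by (auto simp: add.assoc)
    qed
  qed
qed

end

section \<open>Increments, ties and hubs\<close>

text \<open>Four letters are enough: the longest equations that would express a generic power
  through generators are of the kind \<open>y = w + (- g + (w + - k))\<close>.\<close>

definition words :: "'g::group_add set \<Rightarrow> 'g set" where
  "words S = (\<lambda>(a, b, d, e). a + (b + (d + e))) ` (pm0 S \<times> pm0 S \<times> pm0 S \<times> pm0 S)"

lemma wordsI: "a \<in> pm0 S \<Longrightarrow> b \<in> pm0 S \<Longrightarrow> d \<in> pm0 S \<Longrightarrow> e \<in> pm0 S \<Longrightarrow> a + (b + (d + e)) \<in> words S"
  unfolding words_def by (rule image_eqI[of _ _ "(a, b, d, e)"]) auto

lemma zero_in_pm0 [simp]: "0 \<in> pm0 S"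
  by (simp add: pm0_def)

lemma pm0I: "a \<in> pm S \<Longrightarrow> a \<in> pm0 S"
  by (simp add: pm0_def)

lemma wordsI3: "a \<in> pm0 S \<Longrightarrow> b \<in> pm0 S \<Longrightarrow> d \<in> pm0 S \<Longrightarrow> a + (b + d) \<in> words S"
  using wordsI[of a S b d 0] by simp

lemma wordsI2: "a \<in> pm0 S \<Longrightarrow> b \<in> pm0 S \<Longrightarrow> a + b \<in> words S"
  using wordsI3[of a S b 0] by simp

lemma wordsI1: "a \<in> pm0 S \<Longrightarrow> a \<in> words S"
  using wordsI2[of a S 0] by simp

lemma words_uminus: "a \<in> words S \<Longrightarrow> - a \<in> words S"
proof -
  assume "a \<in> words S"
  then obtain x y z t where "a = x + (y + (z + t))" "x \<in> pm0 S" "y \<in> pm0 S" "z \<in> pm0 S" "t \<in> pm0 S"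
    by (auto simp: words_def)
  then show ?thesis using wordsI[of "- t" S "- z" "- y" "- x"] by (simp add: group_word)
qed

lemma words_uminus_iff [simp]: "- a \<in> words S \<longleftrightarrow> a \<in> words S"
  using words_uminus[of a] words_uminus[of "- a"] by auto

lemma words_mono: "S \<subseteq> S' \<Longrightarrow> words S \<subseteq> words S'"
  unfolding words_def by (intro image_mono Sigma_mono pm0_mono)

lemmas words_intros = wordsI wordsI3 wordsI2 wordsI1

lemma finite_words: "finite S \<Longrightarrow> finite (words S)"
  and card_words_le: "finite S \<Longrightarrow> card (words S) \<le> card (pm0 S) ^ 4"
proof -
  assume S: "finite S"
  let ?P = "pm0 S"
  show "finite (words S)" unfolding words_def using S by simp
  have "card (words S) \<le> card (?P \<times> ?P \<times> ?P \<times> ?P)"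
    unfolding words_def by (rule card_image_le) (use S in simp)
  then show "card (words S) \<le> card ?P ^ 4"
    by (simp add: card_cartesian_product power4_eq_xxxx)
qed

locale gadget_setting = cyclic_part c N for c :: "int \<Rightarrow> 'g::group_add" and N +
  fixes S T V :: "'g set" and L M :: nat
  assumes finT: "finite T" and finV: "finite V" and ST: "S \<subseteq> T" and T0: "0 \<notin> pm T"
    and V_uminus: "\<And>v. - v \<in> V \<longleftrightarrow> v \<in> V"
    and outside: "\<And>t a b. t \<in> pm T \<Longrightarrow> t \<notin> pm S \<Longrightarrow> a \<in> pm0 S \<Longrightarrow> b \<in> pm0 S \<Longrightarrow> t \<noteq> a + b"
    and outside_V: "\<And>t. t \<in> pm T \<Longrightarrow> t \<notin> pm S \<Longrightarrow> t \<notin> V"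
    and M: "0 < M"
begin

lemma two_words_in_pm: "a + b \<in> pm T \<Longrightarrow> a \<in> pm0 S \<Longrightarrow> b \<in> pm0 S \<Longrightarrow> a + b \<in> pm S"
  using outside by blast

lemma S0: "0 \<notin> pm S"
  using T0 pm_mono[OF ST] by blast

lemma pm_not_0: "k \<in> pm S \<Longrightarrow> k \<noteq> 0"
  using S0 by blast

text \<open>The dichotomy behind the generic choice: whether \<open>q\<close> commutes with some
  \<open>c (D * l)\<close>, for \<open>l\<close> up to \<open>M\<close>, is decided at
  \<open>D\<close>.\<close>

definition resolves :: "nat \<Rightarrow> 'g \<Rightarrow> bool" where
  "resolves D q \<longleftrightarrow>
    (commutes (int D) q \<or> (\<forall>l\<in>{1..M}. \<not> commutes (int (D * l)) q))"

definition twist_resolves :: "nat \<Rightarrow> 'g \<Rightarrow> bool" where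
  "twist_resolves D q \<longleftrightarrow>
    (inverts (int D) q \<or> (\<forall>l\<in>{1..M}. \<not> inverts (int (D * l)) q))"

lemma not_inverts_mult:
  assumes "commutes (int D) q" "0 < D" "2 * int (D * L) < N" "l \<in> {1..L}"
  shows "\<not> inverts (int (D * l)) q"
proof
  assume i: "inverts (int (D * l)) q"
  have "commutes (int (D * l)) q" using commutes_dvd[OF assms(1)] by simp
  moreover have "int (D * l) \<le> int (D * L)" "0 < int (D * l)" using assms by auto
  ultimately show False using not_commutes_inverts[OF _ i] assms(3) by linarith
qed

text \<open>The gadgets with generic \<open>b\<close>, with all conditions that depend on \<open>b\<close> eliminated.\<close>

definition is_gadget :: "nat \<Rightarrow> 'g \<Rightarrow> 'g set \<Rightarrow> 'g set \<Rightarrow> bool" where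
  "is_gadget D w A X \<longleftrightarrow> (\<exists>b. X = gadget (c b + w) A \<and> fresh S V T X \<and>
    (\<forall>d\<in>A. \<forall>k\<in>pm S. - d + (c b + w) \<in> link X k \<longleftrightarrow> k \<in> colours_left (int D) w A d) \<and>
    (\<forall>d\<in>A. \<forall>k\<in>pm S. - (c b + w) + d \<in> link X k \<longleftrightarrow> k \<in> colours_right (int D) w A d) \<and>
    (\<forall>d\<in>A. \<forall>e\<in>A. - d + (c b + w) = - (c b + w) + e \<longrightarrow> inverts (int D) (w + - d)) \<and>
    (\<forall>x\<in>X. x + x = 0 \<longrightarrow> (\<exists>d\<in>A. inverts (int D) (w + - d) \<and> (w + - d) + (w + - d) = 0)))"

lemma is_gadgetE:
  assumes "is_gadget D w A X"
  obtains b where "X = gadget (c b + w) A" "fresh S V T X"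
    "\<And>d k. d \<in> A \<Longrightarrow> k \<in> pm S \<Longrightarrow>
      - d + (c b + w) \<in> link X k \<longleftrightarrow> k \<in> colours_left (int D) w A d"
    "\<And>d k. d \<in> A \<Longrightarrow> k \<in> pm S \<Longrightarrow>
      - (c b + w) + d \<in> link X k \<longleftrightarrow> k \<in> colours_right (int D) w A d"
    "\<And>d e. d \<in> A \<Longrightarrow> e \<in> A \<Longrightarrow> - d + (c b + w) = - (c b + w) + e \<Longrightarrow> inverts (int D) (w + - d)"
    "\<And>x. x \<in> X \<Longrightarrow> x + x = 0 \<Longrightarrow>
      \<exists>d\<in>A. inverts (int D) (w + - d) \<and> (w + - d) + (w + - d) = 0"
  using assms unfolding is_gadget_def by (elim exE conjE) (rule that; (assumption | blast))

text \<open>Every gadget vertex has the form \<open>- d + p\<close> or \<open>- p + d\<close>.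
  Different descriptions may give the same vertex, so this bounds the count only from above.\<close>

lemma is_gadget_card_le:
  assumes X: "is_gadget D w A X" and A: "finite A" and kl: "k \<in> pm S" "l \<in> pm S"
  shows "card (link X k \<inter> link X l) \<le>
    card {d \<in> A. k \<in> colours_left (int D) w A d \<and> l \<in> colours_left (int D) w A d} +
    card {d \<in> A. k \<in> colours_right (int D) w A d \<and> l \<in> colours_right (int D) w A d}"
proof -
  obtain b where b: "X = gadget (c b + w) A"
    and l: "\<And>d k. d \<in> A \<Longrightarrow> k \<in> pm S \<Longrightarrow>
      - d + (c b + w) \<in> link X k \<longleftrightarrow> k \<in> colours_left (int D) w A d"
    and r: "\<And>d k. d \<in> A \<Longrightarrow> k \<in> pm S \<Longrightarrow>
      - (c b + w) + d \<in> link X k \<longleftrightarrow> k \<in> colours_right (int D) w A d"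
    using X by (elim is_gadgetE) (rule that; simp)
  let ?L = "{d \<in> A. k \<in> colours_left (int D) w A d \<and> l \<in> colours_left (int D) w A d}"
  let ?R = "{d \<in> A. k \<in> colours_right (int D) w A d \<and> l \<in> colours_right (int D) w A d}"
  have "link X k \<inter> link X l \<subseteq> (\<lambda>d. - d + (c b + w)) ` ?L \<union> (\<lambda>d. - (c b + w) + d) ` ?R"
  proof
    fix v assume v: "v \<in> link X k \<inter> link X l"
    then have "v \<in> pm X" by (simp add: link_def)
    then obtain d where "d \<in> A" "v = - d + (c b + w) \<or> v = - (c b + w) + d"
      by (auto simp: b in_pm_gadget)
    then show "v \<in> (\<lambda>d. - d + (c b + w)) ` ?L \<union> (\<lambda>d. - (c b + w) + d) ` ?R"
      using l r kl v by blast
  qed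
  then have "card (link X k \<inter> link X l) \<le>
      card ((\<lambda>d. - d + (c b + w)) ` ?L \<union> (\<lambda>d. - (c b + w) + d) ` ?R)"
    using A by (intro card_mono) auto
  also have "\<dots> \<le> card ?L + card ?R"
    using A by (intro order_trans[OF card_Un_le] add_mono card_image_le) auto
  finally show ?thesis .
qed

lemma is_gadget_empty:
  assumes X: "is_gadget D w A X" and A: "finite A" and kl: "k \<in> pm S" "l \<in> pm S"
    and "\<And>d. d \<in> A \<Longrightarrow> k \<in> colours_left (int D) w A d \<Longrightarrow> l \<in> colours_left (int D) w A d \<Longrightarrow> False"
    and "\<And>d. d \<in> A \<Longrightarrow> k \<in> colours_right (int D) w A d \<Longrightarrow> l \<in> colours_right (int D) w A d \<Longrightarrow> False"
  shows "card (link X k \<inter> link X l) = 0"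
proof -
  have "{d \<in> A. k \<in> colours_left (int D) w A d \<and> l \<in> colours_left (int D) w A d} = {}"
    "{d \<in> A. k \<in> colours_right (int D) w A d \<and> l \<in> colours_right (int D) w A d} = {}"
    using assms(5,6) by blast+
  with is_gadget_card_le[OF X A kl] show ?thesis by simp
qed

text \<open>The vertex \<open>p\<close>, described by \<open>d = 0\<close>, is a common neighbour of
  all nonzero elements of \<open>A\<close>.\<close>

lemma is_gadget_card_pos:
  assumes X: "is_gadget D w A X" and A: "finite A" "0 \<in> A" and kl: "k \<in> pm S \<inter> A" "l \<in> pm S \<inter> A"
  shows "0 < card (link X k \<inter> link X l)"
proof -
  obtain b where b: "X = gadget (c b + w) A"
    and l: "\<And>d k. d \<in> A \<Longrightarrow> k \<in> pm S \<Longrightarrow>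
      - d + (c b + w) \<in> link X k \<longleftrightarrow> k \<in> colours_left (int D) w A d"
    using X by (elim is_gadgetE) (rule that; simp)
  have "k \<in> colours_left (int D) w A 0" "l \<in> colours_left (int D) w A 0"
    using kl by (auto simp: colours_left_def)
  then have "- 0 + (c b + w) \<in> link X k \<inter> link X l"
    using l A(2) kl by blast
  moreover have "finite (link X k \<inter> link X l)"
    using A(1) by (simp add: b gadget_def finite_link)
  ultimately show ?thesis using card_gt_0_iff by blast
qed

lemma is_gadgetI:
  assumes fin: "finite Q" and A: "finite A" "card A \<le> 3" "A \<subseteq> pm0 S" "0 \<in> A"
    and D: "0 < D" and DL: "2 * int (D * L) < N"
    and diff: "\<And>d e. d \<in> A \<Longrightarrow> e \<in> A \<Longrightarrow> d \<noteq> e \<Longrightarrow> d + - e \<in> pm Q"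
    and resQ: "\<And>q. q \<in> Q \<Longrightarrow> resolves D q"
    and resA: "\<And>e. e \<in> A \<Longrightarrow> twist_resolves D (w + - e)"
    and count: "card A * (card V + card (pm0 T) ^ 2)
      + (card Q * card (pm0 T) + card A * (card A * card (pm0 T))) * (L div M + 1) < L"
    and right: "\<And>d e. d \<in> A \<Longrightarrow> e \<in> A \<Longrightarrow> d \<noteq> e \<Longrightarrow> commutes (int D) (d + - e) \<Longrightarrow>
      - w + (d + (- e + w)) \<in> pm T \<Longrightarrow> - w + (d + (- e + w)) \<in> pm S"
    and left: "\<And>d e. d \<in> A \<Longrightarrow> e \<in> A \<Longrightarrow> inverts (int D) (w + - e) \<Longrightarrow>
      - d + (w + (- e + w)) \<in> pm T \<Longrightarrow> - d + (w + (- e + w)) \<in> pm S"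
    and uniq: "\<And>e. e \<in> A \<Longrightarrow> inverts (int D) (w + - e) \<Longrightarrow> e = \<delta>"
  shows "\<exists>X. is_gadget D w A X"
proof -
  note resQ' = resQ[unfolded resolves_def] and resA' = resA[unfolded twist_resolves_def]
  show ?thesis
  proof (rule exists_gadget[where S = S and T = T and V = V and Q = Q and A = A and D = D and w = w
        and L = L and M = M and \<delta> = \<delta>, OF finT finV fin ST T0 V_uminus A outside D M DL diff resQ'
        resA' count right left uniq])
    fix b
    let ?X = "gadget (c b + w) A"
    assume "fresh S V T ?X"
      "\<And>d k. d \<in> A \<Longrightarrow> k \<in> pm S \<Longrightarrow> - d + (c b + w) \<in> link ?X k \<longleftrightarrow> k \<in> colours_left (int D) w A d"
      "\<And>d k. d \<in> A \<Longrightarrow> k \<in> pm S \<Longrightarrow> - (c b + w) + d \<in> link ?X k \<longleftrightarrow> k \<in> colours_right (int D) w A d"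
      "\<And>d e. d \<in> A \<Longrightarrow> e \<in> A \<Longrightarrow> - d + (c b + w) = - (c b + w) + e \<Longrightarrow> inverts (int D) (w + - d)"
      "\<And>x. x \<in> ?X \<Longrightarrow> x + x = 0 \<Longrightarrow>
        \<exists>d\<in>A. inverts (int D) (w + - d) \<and> (w + - d) + (w + - d) = 0"
    then have "is_gadget D w A ?X"
      unfolding is_gadget_def by (intro exI[of _ b]) blast
    then show "\<exists>X. is_gadget D w A X" ..
  qed
qed

end

context cyclic_part
begin

lemma commutes_add_c_iff [simp]: "commutes i (q + c j) \<longleftrightarrow> commutes i q"
proof
  assume "commutes i (q + c j)"
  then have "commutes i ((q + c j) + - c j)" by (rule commutes_add) simp
  then show "commutes i q" by (simp add: group_word)
qed (simp add: commutes_add)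

lemma inverts_add_c_iff [simp]: "inverts i (q + c j) \<longleftrightarrow> inverts i q"
proof
  assume "inverts i (q + c j)"
  then have "inverts i ((q + c j) + - c j)" by (rule inverts_add1) simp
  then show "inverts i q" by (simp add: group_word)
qed (simp add: inverts_add1)

lemma commutes_neq_inverts:
  "commutes i q \<Longrightarrow> inverts i r \<Longrightarrow> 0 < i \<Longrightarrow> 2 * i < N \<Longrightarrow> q \<noteq> r"
  using not_commutes_inverts by blast

end

context gadget_setting
begin

lemma count_mono:
  assumes "2 \<le> n" "card A \<le> n" "card Q \<le> m"
    and "n * (card V + card (pm0 T) ^ 2) + (m * card (pm0 T) + n * (n * card (pm0 T))) * (L div M + 1) < L"
  shows "card A * (card V + card (pm0 T) ^ 2)
      + (card Q * card (pm0 T) + card A * (card A * card (pm0 T))) * (L div M + 1) < L"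
  using assms(2,3)
  by (intro le_less_trans[OF _ assms(4)] add_mono mult_le_mono) auto

lemma not_commutes_mult:
  assumes "inverts (int D) q" "0 < D" "2 * int (D * L) < N" "l \<in> {1..L}"
  shows "\<not> commutes (int (D * l)) q"
proof
  assume i: "commutes (int (D * l)) q"
  have "inverts (int (D * l)) q" using inverts_dvd[OF assms(1)] by simp
  moreover have "int (D * l) \<le> int (D * L)" "0 < int (D * l)" using assms by auto
  ultimately show False using not_commutes_inverts[OF i] assms(3) by linarith
qed

lemma twist_resolves_commutes:
  assumes "commutes (int D) q" "0 < D" "2 * int (D * L) < N" "M \<le> L"
  shows "twist_resolves D q"
  using not_inverts_mult[OF assms(1-3)] assms(4) by (auto simp: twist_resolves_def)

lemma resolves_inverts:
  assumes "inverts (int D) q" "0 < D" "2 * int (D * L) < N" "M \<le> L"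
  shows "resolves D q"
  using not_commutes_mult[OF assms(1-3)] assms(4) by (auto simp: resolves_def)

lemma two_D_less:
  assumes "0 < D" "2 * int (D * L) < N" "M \<le> L"
  shows "0 < int D" "2 * int D < N"
proof -
  have "D * 1 \<le> D * L" using M assms(3) by (intro mult_le_mono) auto
  then show "2 * int D < N" using assms(2) by linarith
qed (use assms(1) in simp)

lemma not_inverts_commutes:
  assumes "commutes (int D) q" "0 < D" "2 * int (D * L) < N" "M \<le> L"
  shows "\<not> inverts (int D) q"
  using not_commutes_inverts[OF assms(1)] two_D_less[OF assms(2-4)] by blast

text \<open>Besides \<open>p\<close>, the vertex \<open>- p + s\<close> is joined to
  \<open>s\<close> if \<open>s\<close> commutes with or inverts \<open>c D\<close>; this second
  triangle halves the number of increments needed. The price in the inverting case is that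
  \<open>s + s\<close> may gain triangles, too.\<close>

lemma exists_increment:
  assumes s: "s \<in> pm S"
    and D: "0 < D" "2 * int (D * L) < N" "M \<le> L" and res: "resolves D s" "twist_resolves D s"
    and count: "2 * (card V + card (pm0 T) ^ 2)
      + (1 * card (pm0 T) + 2 * (2 * card (pm0 T))) * (L div M + 1) < L"
  obtains X b where "fresh S V T X" "X = gadget (c b + 0) {0, s}"
    "0 < card (link X s)" "commutes (int D) s \<or> inverts (int D) s \<Longrightarrow> 2 \<le> card (link X s)"
    "\<And>k. k \<in> pm S \<Longrightarrow> k \<noteq> s \<Longrightarrow> k \<noteq> - s \<Longrightarrow>
      (inverts (int D) s \<Longrightarrow> k \<noteq> s + s \<and> k \<noteq> - (s + s)) \<Longrightarrow> link X k = {}"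
    "\<And>x. x \<in> X \<Longrightarrow> x + x = 0 \<Longrightarrow> s + s = 0"
proof -
  let ?A = "{0, s}"
  have s0: "s \<noteq> 0" using s S0 by blast
  have spm: "s \<in> pm0 S" "- s \<in> pm0 S" using s by (auto simp: pm0_def)
  have n0: "\<not> inverts (int D) 0"
    by (rule not_inverts_commutes[OF _ D]) simp
  have "\<exists>X. is_gadget D 0 ?A X"
  proof (rule is_gadgetI[where Q = "{s}" and \<delta> = s])
    show "d + - e \<in> pm {s}" if "d \<in> ?A" "e \<in> ?A" "d \<noteq> e" for d e
      using that by (auto simp: in_pm)
    show "twist_resolves D (0 + - e)" if "e \<in> ?A" for e
      using that res(2) twist_resolves_commutes[of D 0, OF _ D] by (auto simp: twist_resolves_def)
    show "card ?A * (card V + card (pm0 T) ^ 2)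
      + (card {s} * card (pm0 T) + card ?A * (card ?A * card (pm0 T))) * (L div M + 1) < L"
      using s0 by (intro count_mono[OF _ _ _ count]) auto
    show "- 0 + (d + (- e + 0)) \<in> pm S"
      if "d \<in> ?A" "e \<in> ?A" "- 0 + (d + (- e + 0)) \<in> pm T" for d e
      using two_words_in_pm[of d "- e"] that spm by auto
    show "- d + (0 + (- e + 0)) \<in> pm S"
      if "d \<in> ?A" "e \<in> ?A" "- d + (0 + (- e + 0)) \<in> pm T" for d e
      using two_words_in_pm[of "- d" "- e"] that spm by auto
    show "e = s" if "e \<in> ?A" "inverts (int D) (0 + - e)" for e
      using that n0 by auto
  qed (use s0 spm D res in \<open>auto simp: card_insert_if\<close>)
  then obtain X where X: "is_gadget D 0 ?A X" ..
  then obtain b where b: "X = gadget (c b + 0) ?A" and fr: "fresh S V T X"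
    and l: "\<And>d k. d \<in> ?A \<Longrightarrow> k \<in> pm S \<Longrightarrow>
      - d + (c b + 0) \<in> link X k \<longleftrightarrow> k \<in> colours_left (int D) 0 ?A d"
    and r: "\<And>d k. d \<in> ?A \<Longrightarrow> k \<in> pm S \<Longrightarrow>
      - (c b + 0) + d \<in> link X k \<longleftrightarrow> k \<in> colours_right (int D) 0 ?A d"
    and dist: "\<And>d e. d \<in> ?A \<Longrightarrow> e \<in> ?A \<Longrightarrow> - d + (c b + 0) = - (c b + 0) + e \<Longrightarrow>
      inverts (int D) (0 + - d)"
    and invol: "\<And>x. x \<in> X \<Longrightarrow> x + x = 0 \<Longrightarrow>
      \<exists>d\<in>?A. inverts (int D) (0 + - d) \<and> (0 + - d) + (0 + - d) = 0"
    by (rule is_gadgetE) blast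
  have finX: "finite X" using fr by (simp add: fresh_def)
  show ?thesis
  proof (rule that[OF fr b])
    show "0 < card (link X s)"
      using is_gadget_card_pos[OF X, of s s] s by simp
    show "2 \<le> card (link X s)" if *: "commutes (int D) s \<or> inverts (int D) s"
    proof -
      have "s \<in> colours_left (int D) 0 ?A 0" by (force simp: colours_left_def)
      moreover have "s \<in> colours_right (int D) 0 ?A s"
        using * by (force simp: colours_right_def)
      ultimately have "{- 0 + (c b + 0), - (c b + 0) + s} \<subseteq> link X s"
        using l[of 0 s] r[of s s] s by simp
      moreover have "- 0 + (c b + 0) \<noteq> - (c b + 0) + s"
        using dist[of 0 s] n0 by auto
      ultimately show ?thesis
        using card_mono[OF finite_link[OF finX], of "{- 0 + (c b + 0), - (c b + 0) + s}" s] by simp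
    qed
    show "link X k = {}" if k: "k \<in> pm S" "k \<noteq> s" "k \<noteq> - s"
        "inverts (int D) s \<Longrightarrow> k \<noteq> s + s \<and> k \<noteq> - (s + s)" for k
    proof -
      have k0: "k \<noteq> 0" using k(1) by (rule pm_not_0)
      have "card (link X k \<inter> link X k) = 0"
      proof (rule is_gadget_empty[OF X])
        show False if "d \<in> ?A" "k \<in> colours_left (int D) 0 ?A d" for d
          using that k k0 n0 by (auto simp: colours_left_def minus_add)
        show False if "d \<in> ?A" "k \<in> colours_right (int D) 0 ?A d" for d
          using that k k0 n0 by (auto simp: colours_right_def minus_add)
      qed (use k in auto)
      then show ?thesis using finX by (simp add: finite_link)
    qed
    show "s + s = 0" if "x \<in> X" "x + x = 0" for x
    proof -
      from invol[OF that] n0 have "- s + - s = 0" by auto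
      then have "- (s + s) = 0" by (simp add: minus_add)
      then show ?thesis by simp
    qed
  qed
qed

text \<open>The shift is \<open>w\<close> because with shift \<open>0\<close> both \<open>w\<close>
  and \<open>u\<close> would pass the inversion test and \<open>uniq\<close> would fail; with shift
  \<open>w\<close> only \<open>e = 0\<close> passes. One forced colour,
  \<open>- u + (w + w)\<close>, is not a sum of two generators, and \<open>V\<close> keeps it from
  being the colour of an earlier gadget.\<close>

lemma exists_tie:
  assumes w: "w \<in> pm S" "inverts (int D) w" and u: "u \<in> pm S" "inverts (int D) u"
    and wu: "u \<noteq> w" "u \<noteq> - w"
    and D: "0 < D" "2 * int (D * L) < N" "M \<le> L"
    and V: "- u + (w + w) \<in> V"
    and count: "3 * (card V + card (pm0 T) ^ 2)
      + (3 * card (pm0 T) + 3 * (3 * card (pm0 T))) * (L div M + 1) < L"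
  obtains X b where "fresh S V T X" "X = gadget (c b + w) {0, w, u}"
    "0 < card (link X w \<inter> link X u)"
    "u + u \<noteq> 0 \<Longrightarrow> card (link X w \<inter> link X (- u)) = 0"
    "u + u \<noteq> 0 \<Longrightarrow> w + w \<noteq> 0 \<Longrightarrow> card (link X (- w) \<inter> link X u) = 0"
    "\<And>k. k \<in> pm S \<Longrightarrow> link X k \<noteq> {} \<Longrightarrow>
      k \<in> pm {w, u, w + w, - w + u, - u + (w + w)}"
    "\<And>k. k \<in> pm S \<Longrightarrow> 0 < card (link X w \<inter> link X k) \<Longrightarrow> k \<in> {w, - w, u, w + w, - (w + w), - w + u}"
    "\<And>x. x \<in> X \<Longrightarrow> x + x = 0 \<Longrightarrow> w + w = 0"
proof -
  let ?A = "{0, w, u}" and ?D = "int D"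
  note iD = not_inverts_commutes[OF _ D] and D2 = two_D_less[OF D]
  have w0: "w \<noteq> 0" "u \<noteq> 0" using w u S0 by blast+
  have pm: "w \<in> pm0 S" "- w \<in> pm0 S" "u \<in> pm0 S" "- u \<in> pm0 S" using w u by (auto simp: pm0_def)
  have com: "commutes ?D (w + w)" "commutes ?D (w + - u)" "commutes ?D (u + - w)"
    "commutes ?D (- w + u)" "commutes ?D (- u + w)" "commutes ?D (- (w + w))"
    using w(2) u(2) by (simp_all add: commutes_add_inverts minus_add)
  have ncom: "\<not> commutes ?D w" "\<not> commutes ?D u"
    using w(2) u(2) D2 not_commutes_inverts by blast+
  have ninv: "\<not> inverts ?D 0" "\<not> inverts ?D (w + - u)"
    by (rule iD; simp add: com)+
  have ivt: "e = 0" if "e \<in> ?A" "inverts ?D (w + - e)" for e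
    using that ninv by auto
  have "\<exists>X. is_gadget D w ?A X"
  proof (rule is_gadgetI[where Q = "{w, u, w + - u}" and \<delta> = 0])
    show "d + - e \<in> pm {w, u, w + - u}" if "d \<in> ?A" "e \<in> ?A" "d \<noteq> e" for d e
      using that by (auto simp: in_pm minus_add)
    show "resolves D q" if "q \<in> {w, u, w + - u}" for q
      using that resolves_inverts[OF w(2) D] resolves_inverts[OF u(2) D] com(2)
      by (auto simp: resolves_def)
    show "twist_resolves D (w + - e)" if "e \<in> ?A" for e
      using that w(2) twist_resolves_commutes[OF com(2) D] twist_resolves_commutes[of D 0, OF _ D]
      by (auto simp: twist_resolves_def)
    show "card ?A * (card V + card (pm0 T) ^ 2)
      + (card {w, u, w + - u} * card (pm0 T) + card ?A * (card ?A * card (pm0 T))) * (L div M + 1) < L"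
      by (rule count_mono[OF _ _ _ count]) (auto simp: card_insert_if)
    show "- w + (d + (- e + w)) \<in> pm S"
      if "d \<in> ?A" "e \<in> ?A" "d \<noteq> e" "commutes ?D (d + - e)" "- w + (d + (- e + w)) \<in> pm T" for d e
    proof -
      have "d = w \<and> e = u \<or> d = u \<and> e = w" using that ncom by auto
      then show ?thesis
        using that(5) two_words_in_pm[of "- u" w] two_words_in_pm[of "- w" u] pm by auto
    qed
    show "- d + (w + (- e + w)) \<in> pm S"
      if "d \<in> ?A" "e \<in> ?A" "inverts ?D (w + - e)" "- d + (w + (- e + w)) \<in> pm T" for d e
      using that(1,4) outside_V[of "- u + (w + w)"] V two_words_in_pm[of w w] pm w(1)
      unfolding ivt[OF that(2,3)] by auto
    show "e = 0" if "e \<in> ?A" "inverts ?D (w + - e)" for e by (rule ivt[OF that])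
  qed (use pm D in \<open>auto simp: card_insert_if\<close>)
  then obtain X where X: "is_gadget D w ?A X" ..
  then obtain b where b: "X = gadget (c b + w) ?A" and fr: "fresh S V T X"
    and invol: "\<And>x. x \<in> X \<Longrightarrow> x + x = 0 \<Longrightarrow>
      \<exists>d\<in>?A. inverts (int D) (w + - d) \<and> (w + - d) + (w + - d) = 0"
    by (rule is_gadgetE) blast
  have finX: "finite X" using fr by (simp add: fresh_def)
  have left: "k \<in> (if d = 0 then {0, w, u, w + w}
      else if d = w then {- w, 0, - w + u, w} else {- u, - u + w, 0, - u + (w + w)})"
    if "d \<in> ?A" "k \<in> colours_left ?D w ?A d" for d k
    using that ninv wu w0 by (auto simp: colours_left_def)
  have right: "k \<in> (if d = 0 then {0, - w + - w, - w, - w + (- w + u)}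
      else if d = w then {0, - u + w} else {0, - w + u})"
    if "d \<in> ?A" "k \<in> colours_right ?D w ?A d" for d k
    using that ninv wu w0 ncom by (auto simp: colours_right_def)
  \<comment> \<open>Words with an even number of letters \<open>w\<close> and \<open>u\<close>
    commute with \<open>c D\<close>, those with an odd number invert it, so words of different
    parity are different.\<close>
  have types: "a \<noteq> e" if "commutes ?D a" "inverts ?D e" for a e
    using commutes_neq_inverts[OF that] D2 by blast
  have ivs: "inverts ?D (- w)" "inverts ?D (- u)" using w u by simp_all
  have tw: "w + w \<noteq> w" "w + w \<noteq> u" "w + w \<noteq> - u" "w + w \<noteq> - w"
    "- w + u \<noteq> w" "- w + u \<noteq> - w" "- w + u \<noteq> u" "- w + u \<noteq> - u"
    "- u + w \<noteq> w" "- u + w \<noteq> - w" "- u + w \<noteq> u" "- u + w \<noteq> - u"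
    "- w + - w \<noteq> w" "- w + - w \<noteq> - u" "- w + - w \<noteq> u" "- w + - w \<noteq> - w"
    using types[OF com(1)] types[OF com(4)] types[OF com(5)] types[OF com(6)] w(2) u(2) ivs
    by (auto simp: minus_add)
  have word_w: "- u + (w + w) \<noteq> w" "- w + (- w + u) \<noteq> - w"
  proof -
    show "- u + (w + w) \<noteq> w"
    proof
      assume "- u + (w + w) = w"
      then have "u + (- u + (w + w)) = u + w" by simp
      then show False using wu(1) by simp
    qed
    show "- w + (- w + u) \<noteq> - w"
    proof
      assume "- w + (- w + u) = - w"
      then have "w + (- w + (- w + u)) = w + - w" by simp
      then have "w + (- w + u) = w + 0" by simp
      then show False using wu(1) by simp
    qed
  qed
  show ?thesis
  proof (rule that[OF fr b])
    show "0 < card (link X w \<inter> link X u)"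
      using is_gadget_card_pos[OF X, of w u] w u by simp
    show "card (link X w \<inter> link X (- u)) = 0" if u2: "u + u \<noteq> 0"
    proof (rule is_gadget_empty[OF X])
      have uu: "- u \<noteq> u" using u2 eq_neg_iff_add_eq_0[of u u] by auto
      have wu': "- u \<noteq> w" "- u \<noteq> - w" using wu by auto
      show False if d: "d \<in> ?A" "w \<in> colours_left ?D w ?A d" "- u \<in> colours_left ?D w ?A d" for d
      proof -
        have "w \<noteq> - u" using wu' by simp
        then show False
          using left[OF d(1,2)] left[OF d(1,3)] d(1) tw wu w0 uu wu' word_w by (auto split: if_splits)
      qed
      show False if d: "d \<in> ?A" "w \<in> colours_right ?D w ?A d" "- u \<in> colours_right ?D w ?A d" for d
      proof -
        have "- u = - w + (- w + u) \<Longrightarrow> w = - w \<Longrightarrow> False"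
          using uu add_minus_cancel[of w u] by simp
        moreover have "w = - w + (- w + u) \<Longrightarrow> - u \<noteq> - w + (- w + u)" using wu' by auto
        ultimately show False
          using right[OF d(1,2)] right[OF d(1,3)] d(1) tw wu w0 uu wu' by (auto split: if_splits)
      qed
    qed (use w u in auto)
    show "card (link X (- w) \<inter> link X u) = 0" if u2: "u + u \<noteq> 0" and w2: "w + w \<noteq> 0"
    proof (rule is_gadget_empty[OF X])
      have uu: "- u \<noteq> u" "- w \<noteq> w" using u2 w2 eq_neg_iff_add_eq_0[of u u] eq_neg_iff_add_eq_0[of w w] by auto
      have wu': "- u \<noteq> w" "- u \<noteq> - w" "- w \<noteq> u" using wu by auto
      show False if d: "d \<in> ?A" "- w \<in> colours_left ?D w ?A d" "u \<in> colours_left ?D w ?A d" for d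
      proof -
        have "- w = - u + (w + w) \<Longrightarrow> u \<noteq> - u + (w + w)" using wu' by auto
        then show False
          using left[OF d(1,2)] left[OF d(1,3)] d(1) tw wu w0 uu wu' word_w by (auto split: if_splits)
      qed
      show False if d: "d \<in> ?A" "- w \<in> colours_right ?D w ?A d" "u \<in> colours_right ?D w ?A d" for d
      proof -
        have "u \<noteq> - w + (- w + u)"
        proof
          assume "u = - w + (- w + u)"
          then have "w + u = w + (- w + (- w + u))" by (rule arg_cong)
          then show False using uu(2) by simp
        qed
        then show False
          using right[OF d(1,2)] right[OF d(1,3)] d(1) tw wu w0 uu wu' by (auto split: if_splits)
      qed
    qed (use w u in auto)
    show "k \<in> pm {w, u, w + w, - w + u, - u + (w + w)}" if k: "k \<in> pm S" "link X k \<noteq> {}" for k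
    proof (rule ccontr)
      assume neg: "k \<notin> pm {w, u, w + w, - w + u, - u + (w + w)}"
      have k0: "k \<noteq> 0" using k(1) by (rule pm_not_0)
      have "card (link X k \<inter> link X k) = 0"
      proof (rule is_gadget_empty[OF X])
        show False if "d \<in> ?A" "k \<in> colours_left ?D w ?A d" for d
          using left[OF that(1,2)] that(1) neg k0
          by (auto simp: in_pm group_word split: if_splits)
        show False if "d \<in> ?A" "k \<in> colours_right ?D w ?A d" for d
          using right[OF that(1,2)] that(1) neg k0
          by (auto simp: in_pm group_word split: if_splits)
      qed (use k in auto)
      then show False using finX k(2) by (simp add: finite_link)
    qed
    show "k \<in> {w, - w, u, w + w, - (w + w), - w + u}"
      if k: "k \<in> pm S" "0 < card (link X w \<inter> link X k)" for k
    proof (rule ccontr)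
      assume neg: "k \<notin> {w, - w, u, w + w, - (w + w), - w + u}"
      have k0: "k \<noteq> 0" using k(1) by (rule pm_not_0)
      have "card (link X w \<inter> link X k) = 0"
      proof (rule is_gadget_empty[OF X])
        have wu': "w \<noteq> - u" using wu by auto
        show False if "d \<in> ?A" "w \<in> colours_left ?D w ?A d" "k \<in> colours_left ?D w ?A d" for d
          using left[OF that(1,2)] left[OF that(1,3)] that(1) neg k0 tw wu' word_w w0
          by (auto split: if_splits)
        show False if "d \<in> ?A" "w \<in> colours_right ?D w ?A d" "k \<in> colours_right ?D w ?A d" for d
        proof -
          have "w = - w \<Longrightarrow> k \<noteq> - w + (- w + u)"
            using neg add_minus_cancel[of w u] by auto
          moreover have "w = - w + (- w + u) \<Longrightarrow> k \<noteq> - w + (- w + u)" using neg by auto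
          ultimately show False
            using right[OF that(1,2)] right[OF that(1,3)] that(1) neg k0 tw w0
            by (auto simp: minus_add split: if_splits)
        qed
      qed (use k w in auto)
      then show False using k(2) by simp
    qed
    show "w + w = 0" if "x \<in> X" "x + x = 0" for x
      using invol[OF that] ninv by auto
  qed
qed

end

context gadget_setting
begin

text \<open>As \<open>y\<close> is a power, it does not influence the tests for commuting and
  inverting, and only \<open>e = g\<close> can pass the inversion test. Most other coincidences
  would express \<open>y\<close> or \<open>y + y\<close> as a word of at most four letters. The
  hypothesis \<open>colours\<close> lists three reasons why the forced colours hit no earlier
  gadget: there is none, the words have just two letters, or the only remaining words are reserved
  in \<open>V\<close>.\<close>

lemma exists_hub:
  assumes S0: "S0 \<subseteq> S" and y: "y = c b0" "y \<in> S" "y \<notin> words S0" "y + y \<notin> words S0"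
    and g: "g \<in> pm S0" and w: "w \<in> pm0 S0"
    and D: "0 < D" "2 * int (D * L) < N" "M \<le> L"
    and res: "resolves D g" "twist_resolves D (w + - g)"
    and w_twist: "\<And>l. l \<in> {1..M} \<Longrightarrow> \<not> inverts (int (D * l)) w"
    and kind: "commutes (int D) w \<and> w + y = y + w \<or>
      \<not> commutes (int D) g \<and> \<not> inverts (int D) (w + - g)"
    and colours: "T = S \<or> w = 0 \<or>
      \<not> commutes (int D) g \<and> \<not> inverts (int D) (w + - g) \<and> - w + (y + w) \<in> V"
    and count: "3 * (card V + card (pm0 T) ^ 2)
      + (3 * card (pm0 T) + 3 * (3 * card (pm0 T))) * (L div M + 1) < L"
  obtains X b where "fresh S V T X" "X = gadget (c b + w) {0, g, y}"
    "0 < card (link X g \<inter> link X y)"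
    "\<And>k. k \<in> pm S0 \<Longrightarrow> card (link X k \<inter> link X y) \<le>
      (if k = g \<or> inverts (int D) (w + - g) \<and> k = w + (- g + w) then 1 else 0)"
    "\<And>k. k \<in> pm S0 \<Longrightarrow> card (link X k \<inter> link X (- y)) \<le>
      (if commutes (int D) g \<and> k = - w + (- g + w) then 1 else 0)"
    "\<And>k. k \<in> pm S \<Longrightarrow> link X k \<noteq> {} \<Longrightarrow> k \<in> words (insert y S0)"
    "\<And>k. k \<in> pm S0 \<Longrightarrow> link X k \<noteq> {} \<Longrightarrow>
      w = 0 \<or> \<not> commutes (int D) g \<and> \<not> inverts (int D) (w + - g) \<Longrightarrow>
      k = g \<or> k = - g \<or> inverts (int D) (w + - g) \<and> (k = g + g \<or> k = - (g + g))"
    "\<And>x. x \<in> X \<Longrightarrow> x + x = 0 \<Longrightarrow> inverts (int D) (w + - g) \<and> (w + - g) + (w + - g) = 0"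
proof -
  let ?A = "{0, g, y}" and ?D = "int D"
  have pmS0: "k \<in> pm S" if "k \<in> pm S0" for k using that pm_mono[OF S0] by blast
  have gS: "g \<in> pm S" using g by (rule pmS0)
  have yS: "y \<in> pm S" using y(2) by (simp add: in_pm)
  have g0: "g \<noteq> 0" "y \<noteq> 0" using pm_not_0 gS yS by blast+
  have p0: "k \<in> pm0 S0 \<and> - k \<in> pm0 S0" if "k \<in> pm S0" for k using that by (simp add: pm0_def)
  have gp: "g \<in> pm0 S0" "- g \<in> pm0 S0" "w \<in> pm0 S0" "- w \<in> pm0 S0" using p0[OF g] w by auto
  have pm0S: "k \<in> pm0 S" if "k \<in> pm0 S0" for k using that pm0_mono[OF S0] by blast
  have yp: "y \<in> pm0 S" "- y \<in> pm0 S" using yS by (auto simp: pm0_def)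
  note W = words_intros[where S = S0]
  have yW: "y \<noteq> x" "- y \<noteq> x" "y + y \<noteq> x" if "x \<in> words S0" for x
    using that y(3,4) words_uminus_iff[of y S0] by (metis (no_types))+
  have ng: "y \<noteq> g" "y \<noteq> - g" using yW W(4)[OF gp(1)] W(4)[OF gp(2)] by auto
  have y2: "y + y \<noteq> 0" using yW(3)[OF W(4)[of 0]] by simp
  have ivc: "inverts i (w + - y) \<longleftrightarrow> inverts i w" for i
    unfolding y(1) c_uminus[symmetric] by simp
  have cmc: "commutes i (g + - y) \<longleftrightarrow> commutes i g" for i
    unfolding y(1) c_uminus[symmetric] by simp
  have cy: "commutes i y" for i by (simp add: y(1))
  have w_ni: "\<not> inverts ?D w" using w_twist[of 1] M by simp
  have iv_g: "e = g" if "e \<in> ?A" "inverts ?D (w + - e)" for e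
    using that w_ni ivc[of ?D] by auto
  have niv: "\<not> inverts ?D (w + - y)" using w_ni ivc by simp
  have yg: "commutes ?D (y + - g) \<longleftrightarrow> commutes ?D g"
    using commutes_uminus[of ?D "g + - y"] cmc[of ?D] by (simp add: group_word)
  have "\<exists>X. is_gadget D w ?A X"
  proof (rule is_gadgetI[where Q = "{g, y, g + - y}" and \<delta> = g])
    show "d + - e \<in> pm {g, y, g + - y}" if "d \<in> ?A" "e \<in> ?A" "d \<noteq> e" for d e
      using that by (auto simp: in_pm minus_add)
    show "resolves D q" if "q \<in> {g, y, g + - y}" for q
      using that res(1) cy cmc by (auto simp: resolves_def)
    show "twist_resolves D (w + - e)" if "e \<in> ?A" for e
      using that res(2) w_twist ivc by (auto simp: twist_resolves_def)
    show "card ?A * (card V + card (pm0 T) ^ 2)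
      + (card {g, y, g + - y} * card (pm0 T) + card ?A * (card ?A * card (pm0 T))) * (L div M + 1) < L"
      by (rule count_mono[OF _ _ _ count]) (auto simp: card_insert_if)
    show "- w + (d + (- e + w)) \<in> pm S"
      if de: "d \<in> ?A" "e \<in> ?A" "d \<noteq> e" "commutes ?D (d + - e)" "- w + (d + (- e + w)) \<in> pm T" for d e
      using colours
    proof (elim disjE conjE)
      assume "T = S" then show ?thesis using de by simp
    next
      assume "w = 0"
      then show ?thesis using two_words_in_pm[of d "- e"] de gp[THEN pm0S] yp by auto
    next
      assume *: "\<not> commutes ?D g" "- w + (y + w) \<in> V"
      have "- (- w + (y + w)) \<in> V" using *(2) V_uminus by blast
      then have **: "- w + (- y + w) \<in> V" by (simp add: group_word)
      have "d = 0 \<and> e = y \<or> d = y \<and> e = 0"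
        using de(1-4) *(1) cmc[of ?D] yg by auto
      then have "- w + (d + (- e + w)) \<in> V" using *(2) ** by auto
      then show ?thesis using outside_V[OF de(5)] by blast
    qed
    show "- d + (w + (- e + w)) \<in> pm S"
      if de: "d \<in> ?A" "e \<in> ?A" "inverts ?D (w + - e)" "- d + (w + (- e + w)) \<in> pm T" for d e
      using colours
    proof (elim disjE conjE)
      assume "T = S" then show ?thesis using de by simp
    next
      assume "w = 0"
      then show ?thesis using two_words_in_pm[of "- d" "- e"] de gp[THEN pm0S] yp by auto
    next
      assume "\<not> inverts ?D (w + - g)"
      then show ?thesis using de(3) iv_g[OF de(2,3)] by simp
    qed
    show "e = g" if "e \<in> ?A" "inverts ?D (w + - e)" for e by (rule iv_g[OF that])
  qed (use gp[THEN pm0S] yp D in \<open>auto simp: card_insert_if\<close>)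
  then obtain X where X: "is_gadget D w ?A X" ..
  then obtain b where b: "X = gadget (c b + w) ?A" and fr: "fresh S V T X"
    and invol: "\<And>x. x \<in> X \<Longrightarrow> x + x = 0 \<Longrightarrow>
      \<exists>d\<in>?A. inverts (int D) (w + - d) \<and> (w + - d) + (w + - d) = 0"
    by (rule is_gadgetE) blast
  have finX: "finite X" using fr by (simp add: fresh_def)
  let ?i = "inverts ?D (w + - g)" and ?c = "commutes ?D g"
  have left: "d = 0 \<and> k \<in> {0, g, y} \<or> d = g \<and> k \<in> {- g, 0, - g + y} \<or> d = y \<and> k \<in> {- y, - y + g, 0}
      \<or> ?i \<and> k = - d + (w + (- g + w))"
    if "d \<in> ?A" "k \<in> colours_left ?D w ?A d" for d k
    using that w_ni niv by (auto simp: colours_left_def)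
  have right: "k = 0 \<or> d = 0 \<and> k = - w + (- y + w) \<or> d = y \<and> k = - w + (y + w)
      \<or> ?c \<and> (d = 0 \<and> k = - w + (- g + w) \<or> d = g \<and> (k = - w + (g + w) \<or> k = - w + (g + (- y + w)))
          \<or> d = y \<and> k = - w + (y + (- g + w)))
      \<or> ?i \<and> d = g \<and> (k = - w + (g + - w) \<or> k = - w + (g + (- w + g)) \<or> k = - w + (g + (- w + y)))"
    if "d \<in> ?A" "k \<in> colours_right ?D w ?A d" for d k
  proof -
    have A3: "e = 0 \<or> e = g \<or> e = y" if "e \<in> ?A" for e using that by blast
    from that(2) consider e where "e \<in> ?A" "k = - w + (d + (- e + w))" "commutes ?D (d + - e)"
      | e where "e \<in> ?A" "k = - w + (d + (- w + e))" "inverts ?D (w + - d)"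
      unfolding colours_right_def by blast
    then show ?thesis
    proof cases
      case 1
      then show ?thesis using A3[OF that(1)] A3[OF 1(1)] cmc[of ?D] yg by (elim disjE) simp_all
    next
      case 2
      have "d = g" by (rule iv_g[OF that(1) 2(3)])
      then show ?thesis using A3[OF 2(1)] 2(2,3) by (elim disjE) simp_all
    qed
  qed
  have k_left: "k = g \<and> d = 0 \<or> k = - g \<and> d = g \<or> ?i \<and> (d = 0 \<or> d = g) \<and> k = - d + (w + (- g + w))"
    if d: "d \<in> ?A" "k \<in> colours_left ?D w ?A d" and k: "k \<in> pm S0" for d k
  proof -
    have kp: "k \<in> pm0 S0" "- k \<in> pm0 S0" using p0[OF k] by auto
    have "k \<noteq> 0" "k \<noteq> y" "k \<noteq> - y" using k pm_not_0[OF pmS0[OF k]] yW(1)[OF W(4)[OF kp(1)]]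
        yW(2)[OF W(4)[OF kp(1)]] by auto
    moreover have "k \<noteq> - g + y"
    proof
      assume *: "k = - g + y"
      have "y = g + k" unfolding * by simp
      then show False using yW(1)[OF W(3)[OF gp(1) kp(1)]] by simp
    qed
    moreover have "k \<noteq> - y + g"
    proof
      assume *: "k = - y + g"
      have "y = g + - k" unfolding * by (simp add: group_word)
      then show False using yW(1)[OF W(3)[OF gp(1) kp(2)]] by simp
    qed
    moreover have "k \<noteq> - y + (w + (- g + w))"
    proof
      assume *: "k = - y + (w + (- g + w))"
      have "y = w + (- g + (w + - k))" unfolding * by (simp add: group_word)
      then show False using yW(1)[OF W(1)[OF gp(3,2,3) kp(2)]] by simp
    qed
    ultimately show ?thesis using left[OF d] d(1) by auto
  qed
  have gy: "y \<noteq> - g + y"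
  proof
    assume "y = - g + y"
    then have "0 + y = - g + y" by simp
    then have "- g = 0" by (simp only: add_right_cancel)
    then show False using g0 by simp
  qed
  have y_left: "d \<noteq> g" if "y \<in> colours_left ?D w ?A d" "d \<in> ?A" for d
    using gy left[OF that(2,1)] yW(1)[OF W(4)[OF gp(2)]] g0 ng(1) yW(1)[OF W(1)[OF gp(2,3,2,3)]] by auto
  have my_left: "d \<noteq> g \<and> d \<noteq> 0" if "- y \<in> colours_left ?D w ?A d" "d \<in> ?A" for d
  proof -
    have "- y \<noteq> - g + y"
    proof
      assume "- y = - g + y"
      then have "g + (- y + y) = g + ((- g + y) + y)" by simp
      then show False using yW(3)[OF W(4)[OF gp(1)]] by (simp add: add.assoc)
    qed
    moreover have "- y \<noteq> y" using y2 eq_neg_iff_add_eq_0[of y y] by auto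
    ultimately show ?thesis
      using left[OF that(2,1)] yW(2)[OF W(4)[OF gp(2)]] g0 ng yW(2)[OF W(1)[OF gp(2,3,2,3)]]
        yW(2)[OF W(4)[OF gp(1)]] yW(2)[OF W(2)[OF gp(3,2,3)]] by auto
  qed
  have k_right: "?c \<and> d = 0 \<and> k = - w + (- g + w) \<or>
      d = g \<and> (?c \<and> (k = - w + (g + w) \<or> w + y \<noteq> y + w)
        \<or> ?i \<and> (k = - w + (g + - w) \<or> k = - w + (g + (- w + g))))"
    if d: "d \<in> ?A" "k \<in> colours_right ?D w ?A d" and k: "k \<in> pm S0" for d k
  proof -
    have kp: "k \<in> pm0 S0" "- k \<in> pm0 S0" using p0[OF k] by auto
    have "k \<noteq> 0" using pm_not_0[OF pmS0[OF k]] .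
    moreover have "k \<noteq> - w + (- y + w)"
    proof
      assume *: "k = - w + (- y + w)"
      have "- y = w + (k + - w)" unfolding * by (simp add: group_word)
      then show False using yW(2)[OF W(2)[OF gp(3) kp(1) gp(4)]] by simp
    qed
    moreover have "k \<noteq> - w + (y + w)"
    proof
      assume *: "k = - w + (y + w)"
      have "y = w + (k + - w)" unfolding * by (simp add: group_word)
      then show False using yW(1)[OF W(2)[OF gp(3) kp(1) gp(4)]] by simp
    qed
    moreover have "k \<noteq> - w + (y + (- g + w))"
    proof
      assume *: "k = - w + (y + (- g + w))"
      have "y = w + (k + (- w + g))" unfolding * by (simp add: group_word)
      then show False using yW(1)[OF W(1)[OF gp(3) kp(1) gp(4,1)]] by simp
    qed
    moreover have "k \<noteq> - w + (g + (- w + y))"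
    proof
      assume *: "k = - w + (g + (- w + y))"
      have "y = w + (- g + (w + k))" unfolding * by (simp add: group_word)
      then show False using yW(1)[OF W(1)[OF gp(3,2,3) kp(1)]] by simp
    qed
    moreover have "w + y \<noteq> y + w" if *: "k = - w + (g + (- y + w))"
    proof
      assume "w + y = y + w"
      then have "- y + (w + y) + - y = - y + (y + w) + - y" by simp
      then have **: "- y + w = w + - y" by (simp add: add.assoc)
      have "k = - w + (g + (w + - y))" unfolding * ** ..
      then have "y = - k + (- w + (g + w))" by (simp add: group_word)
      then show False using yW(1)[OF W(1)[OF kp(2) gp(4,1,3)]] by simp
    qed
    ultimately show ?thesis using right[OF d] by blast
  qed
  have comm: "- w + (y + w) = y" "- w + (- y + w) = - y" "- y + w = w + - y" if "w + y = y + w"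
  proof -
    have "- w + (w + y) = - w + (y + w)" using that by simp
    then show 1: "- w + (y + w) = y" by simp
    have "- (- w + (y + w)) = - y" unfolding 1 ..
    then show 2: "- w + (- y + w) = - y" by (simp add: group_word)
    have "w + (- w + (- y + w)) = w + - y" unfolding 2 ..
    then show "- y + w = w + - y" by simp
  qed
  have y_right: False
    if d: "d \<in> ?A" "y \<in> colours_right ?D w ?A d" and k: "k \<in> pm S0" "k \<in> colours_right ?D w ?A d" for d k
  proof (cases "?c \<or> ?i")
    case True
    then have wy: "w + y = y + w" and cw: "commutes ?D w" using kind by auto
    have "y \<noteq> - y" using y2 eq_neg_iff_add_eq_0[of y y] by auto
    moreover have "y \<noteq> - w + (g + (- y + w))"
    proof
      assume "y = - w + (g + (- y + w))"
      then have "y + y = - w + (g + (w + - y)) + y" unfolding comm(3)[OF wy] by simp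
      then show False using yW(3)[OF W(2)[OF gp(4,1,3)]] by (simp add: add.assoc)
    qed
    moreover have "y \<noteq> - w + (g + (- w + y))" if ?i
    proof
      assume *: "y = - w + (g + (- w + y))"
      have "0 + y = (- w + (g + - w)) + y" using * by (simp add: add.assoc)
      then have "- w + (g + - w) = 0" by (simp only: add_right_cancel)
      then have "w + (- w + (g + - w)) + w = w + 0 + w" by simp
      then have "g = w + w" by (simp add: add.assoc)
      then have "inverts ?D (- w)" using that by (simp add: group_word)
      then show False using w_ni by simp
    qed
    ultimately show False
      using right[OF d] k_right[OF d(1) k(2,1)] comm[OF wy] g0 yW(1)[OF W(2)[OF gp(4,2,3)]]
        yW(1)[OF W(2)[OF gp(4,1,3)]] yW(1)[OF W(2)[OF gp(4,1,4)]] yW(1)[OF W(1)[OF gp(4,1,4,1)]]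
      by auto
  next
    case False
    then show False using k_right[OF d(1) k(2,1)] by blast
  qed
  have my_right: "?c \<and> d = 0 \<and> k = - w + (- g + w)"
    if d: "d \<in> ?A" "- y \<in> colours_right ?D w ?A d" and k: "k \<in> pm S0" "k \<in> colours_right ?D w ?A d" for d k
  proof (cases "?c \<or> ?i")
    case True
    then have wy: "w + y = y + w" using kind by auto
    have "- y \<noteq> - w + (g + (- y + w))"
    proof
      assume "- y = - w + (g + (- y + w))"
      then have "0 + - y = - w + (g + w) + - y" unfolding comm(3)[OF wy] by (simp add: add.assoc)
      then have "- w + (g + w) = 0" by (simp only: add_right_cancel)
      then have "w + (- w + (g + w)) + - w = w + 0 + - w" by simp
      then show False using g0 by (simp add: add.assoc)
    qed
    moreover have "- y \<noteq> - w + (g + (- w + y))"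
    proof
      assume "- y = - w + (g + (- w + y))"
      then have "w + (- g + (w + (- y + - y))) = w + (- g + (w + ((- w + (g + (- w + y))) + - y)))" by simp
      then have "w + (- g + w) + - (y + y) = 0" by (simp add: group_word)
      then have "w + (- g + w) + - (y + y) + (y + y) = y + y" by simp
      then have "y + y = w + (- g + w)" by (simp add: add.assoc)
      then show False using yW(3)[OF W(2)[OF gp(3,2,3)]] by simp
    qed
    ultimately have "d \<noteq> g"
      using right[OF d] g0 ng yW(2)[OF W(2)[OF gp(4,1,3)]] yW(2)[OF W(2)[OF gp(4,1,4)]]
        yW(2)[OF W(1)[OF gp(4,1,4,1)]] by auto
    then show ?thesis using k_right[OF d(1) k(2,1)] by blast
  next
    case False
    then show ?thesis using k_right[OF d(1) k(2,1)] by blast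
  qed
  show ?thesis
  proof (rule that[OF fr b])
    show "0 < card (link X g \<inter> link X y)"
      using is_gadget_card_pos[OF X, of g y] gS yS by simp
    show "card (link X k \<inter> link X y) \<le> (if k = g \<or> ?i \<and> k = w + (- g + w) then 1 else 0)"
      if k: "k \<in> pm S0" for k
    proof -
      let ?C = "k = g \<or> ?i \<and> k = w + (- g + w)"
      have "{d \<in> ?A. k \<in> colours_left ?D w ?A d \<and> y \<in> colours_left ?D w ?A d} \<subseteq> (if ?C then {0} else {})"
      proof
        fix d assume "d \<in> {d \<in> ?A. k \<in> colours_left ?D w ?A d \<and> y \<in> colours_left ?D w ?A d}"
        then have d: "d \<in> ?A" "k \<in> colours_left ?D w ?A d" "y \<in> colours_left ?D w ?A d" by blast+
        show "d \<in> (if ?C then {0} else {})"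
          using k_left[OF d(1,2) k] y_left[OF d(3,1)] by auto
      qed
      then have "card {d \<in> ?A. k \<in> colours_left ?D w ?A d \<and> y \<in> colours_left ?D w ?A d} \<le> card (if ?C then {0 :: 'g} else {})"
        by (rule card_mono[rotated]) simp
      also have "\<dots> = (if ?C then 1 else 0)" by simp
      finally have 1: "card {d \<in> ?A. k \<in> colours_left ?D w ?A d \<and> y \<in> colours_left ?D w ?A d} \<le> (if ?C then 1 else 0)" .
      have "{d \<in> ?A. k \<in> colours_right ?D w ?A d \<and> y \<in> colours_right ?D w ?A d} = {}"
        using y_right[OF _ _ k] by blast
      then have 2: "card {d \<in> ?A. k \<in> colours_right ?D w ?A d \<and> y \<in> colours_right ?D w ?A d} = 0"
        by (simp only: card.empty)
      have "card (link X k \<inter> link X y) \<le> card {d \<in> ?A. k \<in> colours_left ?D w ?A d \<and> y \<in> colours_left ?D w ?A d} + card {d \<in> ?A. k \<in> colours_right ?D w ?A d \<and> y \<in> colours_right ?D w ?A d}"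
        by (rule is_gadget_card_le[OF X _ pmS0[OF k] yS]) simp
      then show ?thesis using 1 unfolding 2 by linarith
    qed
    show "card (link X k \<inter> link X (- y)) \<le> (if ?c \<and> k = - w + (- g + w) then 1 else 0)"
      if k: "k \<in> pm S0" for k
    proof -
      let ?C = "?c \<and> k = - w + (- g + w)"
      have "{d \<in> ?A. k \<in> colours_right ?D w ?A d \<and> - y \<in> colours_right ?D w ?A d}
          \<subseteq> (if ?C then {0} else {})"
      proof
        fix d assume "d \<in> {d \<in> ?A. k \<in> colours_right ?D w ?A d \<and> - y \<in> colours_right ?D w ?A d}"
        then have d: "d \<in> ?A" "k \<in> colours_right ?D w ?A d" "- y \<in> colours_right ?D w ?A d" by blast+
        show "d \<in> (if ?C then {0} else {})"
          using my_right[OF d(1,3) k d(2)] by auto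
      qed
      then have "card {d \<in> ?A. k \<in> colours_right ?D w ?A d \<and> - y \<in> colours_right ?D w ?A d} \<le> card (if ?C then {0 :: 'g} else {})"
        by (rule card_mono[rotated]) simp
      also have "\<dots> = (if ?C then 1 else 0)" by simp
      finally have 1: "card {d \<in> ?A. k \<in> colours_right ?D w ?A d \<and> - y \<in> colours_right ?D w ?A d} \<le> (if ?C then 1 else 0)" .
      have "{d \<in> ?A. k \<in> colours_left ?D w ?A d \<and> - y \<in> colours_left ?D w ?A d} = {}"
        using k_left[OF _ _ k] my_left by blast
      then have 2: "card {d \<in> ?A. k \<in> colours_left ?D w ?A d \<and> - y \<in> colours_left ?D w ?A d} = 0"
        by (simp only: card.empty)
      have "card (link X k \<inter> link X (- y)) \<le> card {d \<in> ?A. k \<in> colours_left ?D w ?A d \<and> - y \<in> colours_left ?D w ?A d} + card {d \<in> ?A. k \<in> colours_right ?D w ?A d \<and> - y \<in> colours_right ?D w ?A d}"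
        by (rule is_gadget_card_le[OF X _ pmS0[OF k]]) (use yS in simp_all)
      then show ?thesis using 1 unfolding 2 by linarith
    qed
    let ?S = "insert y S0"
    have wp: "g \<in> pm0 ?S" "- g \<in> pm0 ?S" "w \<in> pm0 ?S" "- w \<in> pm0 ?S" "y \<in> pm0 ?S" "- y \<in> pm0 ?S"
      using gp pm0_mono[of S0 ?S] by (auto simp: pm0_def in_pm)
    show "k \<in> words ?S" if k: "k \<in> pm S" "link X k \<noteq> {}" for k
    proof (rule ccontr)
      assume neg: "k \<notin> words ?S"
      have "card (link X k \<inter> link X k) = 0"
      proof (rule is_gadget_empty[OF X])
        show False if "d \<in> ?A" "k \<in> colours_left ?D w ?A d" for d
          using left[OF that] neg wp that(1) words_intros[where S = ?S] by auto
        show False if "d \<in> ?A" "k \<in> colours_right ?D w ?A d" for d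
          using right[OF that] neg wp that(1) words_intros[where S = ?S] by auto
      qed (use k in auto)
      then show False using finX k(2) by (simp add: finite_link)
    qed
    show "k = g \<or> k = - g \<or> ?i \<and> (k = g + g \<or> k = - (g + g))"
      if k: "k \<in> pm S0" "link X k \<noteq> {}" and w0: "w = 0 \<or> \<not> ?c \<and> \<not> ?i" for k
    proof (rule ccontr)
      assume neg: "\<not> ?thesis"
      have "card (link X k \<inter> link X k) = 0"
      proof (rule is_gadget_empty[OF X])
        show False if "d \<in> ?A" "k \<in> colours_left ?D w ?A d" for d
          using k_left[OF that k(1)] neg w0 by (auto simp: minus_add)
        show False if "d \<in> ?A" "k \<in> colours_right ?D w ?A d" for d
          using k_right[OF that k(1)] neg w0 by (auto simp: minus_add)
      qed (use k pmS0 in auto)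
      then show False using finX k(2) by (simp add: finite_link)
    qed
    show "?i \<and> (w + - g) + (w + - g) = 0" if "x \<in> X" "x + x = 0" for x
      using invol[OF that] w_ni niv by auto
  qed
qed

end

section \<open>Separating colours by their degrees\<close>

lemma good_zero: "good S V Xs \<Longrightarrow> 0 \<notin> pm S \<Longrightarrow> 0 \<notin> pm (total S Xs)"
proof (induction rule: good.induct)
  case (good_Cons Xs X)
  then show ?case using freshD(3)[OF good_Cons.hyps(2), of 0] by (auto simp: total_Cons pm_Un)
qed simp

lemma card_total_Cons_le:
  "finite (total S Xs) \<Longrightarrow> card X \<le> n \<Longrightarrow> card (total S (X # Xs)) \<le> card (total S Xs) + n"
  unfolding total_Cons using card_Un_le[of X "total S Xs"] by linarith

text \<open>The limit \<open>n\<close> is checked before each addition, and the last gadget may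
  exceed it by its own three elements; hence \<open>n + 3\<close>.\<close>

lemma extend_family:
  assumes S: "finite S" and good: "good S V Xs"
    and step: "\<And>P Ys. P \<in> set Ps \<Longrightarrow> good S V Ys \<Longrightarrow> card (total S Ys) \<le> n \<Longrightarrow>
      \<exists>X. fresh S V (total S Ys) X \<and> card X \<le> 3 \<and> P X"
    and bound: "card (total S Xs) + 3 * length Ps \<le> n + 3"
  shows "\<exists>Ys. good S V (Ys @ Xs) \<and> list_all2 (\<lambda>P X. P X) Ps Ys \<and>
    card (total S (Ys @ Xs)) \<le> card (total S Xs) + 3 * length Ps"
  using step bound
proof (induction Ps)
  case Nil
  then show ?case using good by (intro exI[of _ "[]"]) simp
next
  case (Cons P Ps)
  have "\<exists>Ys. good S V (Ys @ Xs) \<and> list_all2 (\<lambda>P X. P X) Ps Ys \<and>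
      card (total S (Ys @ Xs)) \<le> card (total S Xs) + 3 * length Ps"
    by (rule Cons.IH) (use Cons.prems in auto)
  then obtain Ys where Ys: "good S V (Ys @ Xs)" "list_all2 (\<lambda>P X. P X) Ps Ys"
    "card (total S (Ys @ Xs)) \<le> card (total S Xs) + 3 * length Ps" by blast
  have "card (total S (Ys @ Xs)) \<le> n" using Ys(3) Cons.prems(2) by simp
  from Cons.prems(1)[OF _ Ys(1) this, of P] obtain X where X: "fresh S V (total S (Ys @ Xs)) X"
    "card X \<le> 3" "P X" by auto
  have "good S V ((X # Ys) @ Xs)" using good_Cons[OF Ys(1) X(1)] by simp
  moreover have "card (total S ((X # Ys) @ Xs)) \<le> card (total S Xs) + 3 * length (P # Ps)"
    using card_total_Cons_le[OF finite_total[OF Ys(1) S] X(2)] Ys(3) by simp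
  ultimately show ?case using Ys(2) X(3) by (intro exI[of _ "X # Ys"]) simp
qed

text \<open>\<open>Q s X\<close> stands for an increment \<open>X\<close> at \<open>s\<close>,
  \<open>a s\<close> is its guaranteed gain in degree, and \<open>r s\<close> increments gain at
  least 8. One triangle from elsewhere then passes the threshold.\<close>

locale separation =
  fixes S V :: "'g::group_add set" and Q :: "'g \<Rightarrow> 'g set \<Rightarrow> bool" and a r :: "'g \<Rightarrow> nat" and m :: nat
  assumes finS: "finite S"
    and step: "\<And>s Xs. s \<in> S \<Longrightarrow> good S V Xs \<Longrightarrow> card (total S Xs) + 2 \<le> m \<Longrightarrow>
      \<exists>X. fresh S V (total S Xs) X \<and> card X \<le> 2 \<and> Q s X"
    and gain: "\<And>s X. s \<in> S \<Longrightarrow> Q s X \<Longrightarrow> a s \<le> card (link X s)"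
    and a_pos: "\<And>s. s \<in> S \<Longrightarrow> 0 < a s"
    and rounds: "\<And>s. s \<in> S \<Longrightarrow> 8 \<le> r s * a s"
begin

abbreviation degree :: "'g set list \<Rightarrow> 'g \<Rightarrow> nat" where
  "degree Xs s \<equiv> card (link (total S Xs) s)"

lemma degree_append:
  assumes "good S V (Ys @ Xs)" "good S V Xs" "s \<in> S"
  shows "degree (Ys @ Xs) s = (\<Sum>Y\<leftarrow>Ys. card (link Y s)) + degree Xs s"
proof -
  have "s \<in> pm S" using assms(3) by (simp add: in_pm)
  then show ?thesis
    using link_total[OF assms(1) finS] link_total[OF assms(2) finS] by simp
qed

lemma repeat_step:
  assumes s: "s \<in> S" and Xs: "good S V Xs" and "card (total S Xs) + 2 * j \<le> m"
  shows "\<exists>Ys. good S V (Ys @ Xs) \<and> (\<forall>Y\<in>set Ys. Q s Y) \<and>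
    card (total S (Ys @ Xs)) \<le> card (total S Xs) + 2 * j \<and> degree Xs s + j * a s \<le> degree (Ys @ Xs) s"
  using assms(3)
proof (induction j)
  case 0
  then show ?case using Xs by (intro exI[of _ "[]"]) simp
next
  case (Suc j)
  then obtain Ys where Ys: "good S V (Ys @ Xs)" "\<forall>Y\<in>set Ys. Q s Y"
    "card (total S (Ys @ Xs)) \<le> card (total S Xs) + 2 * j" "degree Xs s + j * a s \<le> degree (Ys @ Xs) s"
    by auto
  obtain X where X: "fresh S V (total S (Ys @ Xs)) X" "card X \<le> 2" "Q s X"
    using step[OF s Ys(1)] Ys(3) Suc.prems by auto
  have g: "good S V ([X] @ (Ys @ Xs))" using good_Cons[OF Ys(1) X(1)] by simp
  have "card (total S ((X # Ys) @ Xs)) \<le> card (total S Xs) + 2 * Suc j"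
    using card_total_Cons_le[OF finite_total[OF Ys(1) finS] X(2)] Ys(3) by simp
  moreover have "degree Xs s + Suc j * a s \<le> degree ((X # Ys) @ Xs) s"
    using degree_append[OF g Ys(1) s] gain[OF s X(3)] Ys(4) by simp
  ultimately show ?case using g Ys(2) X(3) by (intro exI[of _ "X # Ys"]) simp
qed

text \<open>Each increment raises the degree strictly, so at most one is spent on each forbidden
  value. The induction is on the number of forbidden values not yet passed.\<close>

lemma avoid_degrees:
  assumes s: "s \<in> S" and Xs: "good S V Xs" and F: "finite F" and "card (total S Xs) + 2 * card F \<le> m"
  shows "\<exists>Ys. good S V (Ys @ Xs) \<and> (\<forall>Y\<in>set Ys. Q s Y) \<and>
    card (total S (Ys @ Xs)) \<le> card (total S Xs) + 2 * card F \<and>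
    degree Xs s \<le> degree (Ys @ Xs) s \<and> degree (Ys @ Xs) s \<notin> F"
proof -
  have "\<exists>Ys. good S V (Ys @ Xs) \<and> (\<forall>Y\<in>set Ys. Q s Y) \<and>
      card (total S (Ys @ Xs)) \<le> card (total S Xs) + 2 * n \<and>
      degree Xs s \<le> degree (Ys @ Xs) s \<and> degree (Ys @ Xs) s \<notin> F"
    if "n = card {f \<in> F. degree Xs s \<le> f}" "good S V Xs" "card (total S Xs) + 2 * n \<le> m" for n Xs
    using that
  proof (induction n arbitrary: Xs rule: less_induct)
    case (less n)
    show ?case
    proof (cases "degree Xs s \<in> F")
      case False
      then show ?thesis using less.prems by (intro exI[of _ "[]"]) simp
    next
      case True
      then have n: "0 < n" using less.prems(1) F by (auto simp: card_gt_0_iff)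
      obtain X where X: "fresh S V (total S Xs) X" "card X \<le> 2" "Q s X"
        using step[OF s less.prems(2)] less.prems(3) n by auto
      have g: "good S V ([X] @ Xs)" using good_Cons[OF less.prems(2) X(1)] by simp
      have d: "degree Xs s < degree ([X] @ Xs) s"
        using degree_append[OF g less.prems(2) s] gain[OF s X(3)] a_pos[OF s] by simp
      let ?n = "card {f \<in> F. degree ([X] @ Xs) s \<le> f}"
      have "?n < n" unfolding less.prems(1)
      proof (rule psubset_card_mono)
        have "degree Xs s \<in> {f \<in> F. degree Xs s \<le> f}" "degree Xs s \<notin> {f \<in> F. degree ([X] @ Xs) s \<le> f}"
          using True d by auto
        moreover have "{f \<in> F. degree ([X] @ Xs) s \<le> f} \<subseteq> {f \<in> F. degree Xs s \<le> f}"
          using d by auto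
        ultimately show "{f \<in> F. degree ([X] @ Xs) s \<le> f} \<subset> {f \<in> F. degree Xs s \<le> f}" by blast
      qed (use F in simp)
      moreover have c: "card (total S ([X] @ Xs)) \<le> card (total S Xs) + 2"
        using card_total_Cons_le[OF finite_total[OF less.prems(2) finS] X(2)] by simp
      ultimately obtain Ys where Ys: "good S V (Ys @ ([X] @ Xs))" "\<forall>Y\<in>set Ys. Q s Y"
        "card (total S (Ys @ ([X] @ Xs))) \<le> card (total S ([X] @ Xs)) + 2 * ?n"
        "degree ([X] @ Xs) s \<le> degree (Ys @ ([X] @ Xs)) s" "degree (Ys @ ([X] @ Xs)) s \<notin> F"
        using less.IH[of ?n "[X] @ Xs"] g less.prems(3) by auto
      then show ?thesis
        using d c X(3) \<open>?n < n\<close> by (intro exI[of _ "Ys @ [X]"]) auto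
    qed
  qed
  from this[of "card {f \<in> F. degree Xs s \<le> f}" Xs] obtain Ys where
    "good S V (Ys @ Xs)" "\<forall>Y\<in>set Ys. Q s Y"
    "card (total S (Ys @ Xs)) \<le> card (total S Xs) + 2 * card {f \<in> F. degree Xs s \<le> f}"
    "degree Xs s \<le> degree (Ys @ Xs) s" "degree (Ys @ Xs) s \<notin> F"
    using Xs assms(4) card_mono[of F "{f \<in> F. degree Xs s \<le> f}"] F by force
  then show ?thesis using card_mono[of F "{f \<in> F. degree Xs s \<le> f}"] F
    by (intro exI[of _ Ys]) auto
qed

text \<open>The elements are treated one after the other, and \<open>order\<close> says that
  increments for a later one leave the degrees of the earlier ones alone. The \<open>i\<close>-th
  element has to avoid \<open>i - 1\<close> degrees at a cost of two elements each, which adds up to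
  \<open>card S * (card S - 1)\<close>.\<close>

lemma separate:
  assumes Xs: "good S V Xs" and start: "\<And>s. s \<in> S \<Longrightarrow> 0 < degree Xs s"
    and ss: "distinct ss" "set ss = S"
    and order: "\<And>ps s qs t X. ss = ps @ s # qs \<Longrightarrow> t \<in> set ps \<Longrightarrow> Q s X \<Longrightarrow> link X t = {}"
    and bound: "card (total S Xs) + 2 * sum r S + card S * (card S - 1) \<le> m"
  shows "\<exists>Ys. good S V (Ys @ Xs) \<and> (\<forall>Y\<in>set Ys. \<exists>s\<in>S. Q s Y) \<and> card (total S (Ys @ Xs)) \<le> m \<and>
    (\<forall>s\<in>S. 8 < degree (Ys @ Xs) s) \<and> inj_on (degree (Ys @ Xs)) S"
proof -
  have len: "length ss = card S" using ss distinct_card by fastforce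
  have aux: "\<exists>Ys. good S V (Ys @ Xs) \<and> (\<forall>Y\<in>set Ys. \<exists>s\<in>S. Q s Y) \<and>
      card (total S (Ys @ Xs)) \<le> card (total S Xs) + 2 * sum r (set ps) + length ps * (length ps - 1) \<and>
      (\<forall>s\<in>set ps. 8 < degree (Ys @ Xs) s) \<and> inj_on (degree (Ys @ Xs)) (set ps)"
    if "\<exists>qs. ss = ps @ qs" for ps
    using that
  proof (induction ps rule: rev_induct)
    case Nil
    then show ?case using Xs by (intro exI[of _ "[]"]) simp
  next
    case (snoc s ps)
    then obtain qs where qs: "ss = ps @ s # qs" by auto
    then have s: "s \<in> S" "s \<notin> set ps" "set ps \<subseteq> S" using ss by auto
    from snoc.IH qs obtain Ys where Ys: "good S V (Ys @ Xs)" "\<forall>Y\<in>set Ys. \<exists>s\<in>S. Q s Y"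
      "card (total S (Ys @ Xs)) \<le> card (total S Xs) + 2 * sum r (set ps) + length ps * (length ps - 1)"
      "\<forall>s\<in>set ps. 8 < degree (Ys @ Xs) s" "inj_on (degree (Ys @ Xs)) (set ps)" by auto
    let ?n = "length ps" and ?F = "degree (Ys @ Xs) ` set ps"
    have n: "Suc ?n * (Suc ?n - 1) = ?n * (?n - 1) + 2 * ?n"
      by (cases ?n) (simp_all add: algebra_simps)
    have "Suc ?n \<le> card S" using len unfolding qs by simp
    then have "Suc ?n * (Suc ?n - 1) \<le> card S * (card S - 1)" by (intro mult_le_mono) auto
    moreover have "sum r (set (ps @ [s])) \<le> sum r S"
      using s finS by (intro sum_mono2) auto
    ultimately have room: "card (total S (Ys @ Xs)) + 2 * r s + 2 * ?n \<le> m"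
      using Ys(3) bound n s(2) by simp
    obtain Zs where Zs: "good S V (Zs @ (Ys @ Xs))" "\<forall>Z\<in>set Zs. Q s Z"
      "card (total S (Zs @ (Ys @ Xs))) \<le> card (total S (Ys @ Xs)) + 2 * r s"
      "degree (Ys @ Xs) s + r s * a s \<le> degree (Zs @ (Ys @ Xs)) s"
      using repeat_step[OF s(1) Ys(1), of "r s"] room by auto
    have F: "finite ?F" "card ?F \<le> ?n"
      using card_image_le[of "set ps" "degree (Ys @ Xs)"] card_length[of ps] by auto
    obtain Us where Us: "good S V (Us @ (Zs @ (Ys @ Xs)))" "\<forall>Y\<in>set Us. Q s Y"
      "card (total S (Us @ (Zs @ (Ys @ Xs)))) \<le> card (total S (Zs @ (Ys @ Xs))) + 2 * card ?F"
      "degree (Zs @ (Ys @ Xs)) s \<le> degree (Us @ (Zs @ (Ys @ Xs))) s"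
      "degree (Us @ (Zs @ (Ys @ Xs))) s \<notin> ?F"
      using avoid_degrees[OF s(1) Zs(1) F(1)] room Zs(3) F(2) by auto
    let ?Ws = "Us @ Zs @ Ys"
    have W: "?Ws @ Xs = (Us @ Zs) @ (Ys @ Xs)" by simp
    have good: "good S V ((Us @ Zs) @ (Ys @ Xs))" using Us(1) by simp
    have same: "degree (?Ws @ Xs) t = degree (Ys @ Xs) t" if t: "t \<in> set ps" for t
    proof -
      have "card (link Z t) = 0" if "Z \<in> set (Us @ Zs)" for Z
        using order[OF qs t, of Z] that Us(2) Zs(2) by auto
      then have "(\<Sum>Z\<leftarrow>Us @ Zs. card (link Z t)) = 0" by (simp add: sum_list_eq_0_iff)
      then show ?thesis
        unfolding W using degree_append[OF good Ys(1)] t s(3) by auto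
    qed
    have "0 < degree (Ys @ Xs) s" using degree_append[OF Ys(1) Xs s(1)] start[OF s(1)] by simp
    then have d: "8 < degree (?Ws @ Xs) s" using Us(4) Zs(4) rounds[OF s(1)] by simp
    show ?case
    proof (intro exI[of _ ?Ws] conjI)
      show "good S V (?Ws @ Xs)" using Us(1) by simp
      show "\<forall>Y\<in>set ?Ws. \<exists>s\<in>S. Q s Y" using Us(2) Zs(2) Ys(2) s(1) by auto
      show "card (total S (?Ws @ Xs)) \<le> card (total S Xs) + 2 * sum r (set (ps @ [s]))
          + length (ps @ [s]) * (length (ps @ [s]) - 1)"
        using Us(3) Zs(3) Ys(3) F(2) n s(2) by simp
      show "\<forall>t\<in>set (ps @ [s]). 8 < degree (?Ws @ Xs) t" using Ys(4) same d by auto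
      have "inj_on (degree (?Ws @ Xs)) (set ps)"
      proof (rule inj_onI)
        fix x y assume xy: "x \<in> set ps" "y \<in> set ps" "degree (?Ws @ Xs) x = degree (?Ws @ Xs) y"
        then have "degree (Ys @ Xs) x = degree (Ys @ Xs) y" by (simp only: same)
        then show "x = y" using Ys(5) xy(1,2) by (blast dest: inj_onD)
      qed
      moreover have "degree (?Ws @ Xs) s \<notin> degree (?Ws @ Xs) ` set ps"
        using Us(5) same by (metis (no_types, lifting) append.assoc image_cong)
      ultimately show "inj_on (degree (?Ws @ Xs)) (set (ps @ [s]))" using s(2) by simp
    qed
  qed
  obtain Ys where Ys: "good S V (Ys @ Xs)" "\<forall>Y\<in>set Ys. \<exists>s\<in>S. Q s Y"
    "card (total S (Ys @ Xs)) \<le> card (total S Xs) + 2 * sum r (set ss) + length ss * (length ss - 1)"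
    "\<forall>s\<in>set ss. 8 < degree (Ys @ Xs) s" "inj_on (degree (Ys @ Xs)) (set ss)"
    using aux[of ss] by auto
  then show ?thesis using bound ss(2) len by (intro exI[of _ Ys]) auto
qed

end

lemma common_count_less:
  assumes "\<And>X. X \<in> set Xs \<Longrightarrow> card (link X k \<inter> link X l) \<le> card (link X k' \<inter> link X l')"
    and "X \<in> set Xs" "card (link X k \<inter> link X l) < card (link X k' \<inter> link X l')"
  shows "common_count Xs k l < common_count Xs k' l'"
  using assms
proof (induction Xs)
  case (Cons Y Ys)
  have le: "common_count Ys k l \<le> common_count Ys k' l'"
    unfolding common_count_def by (rule sum_list_mono) (use Cons.prems(1) in auto)
  show ?case
  proof (cases "X = Y")
    case True
    then show ?thesis using le Cons.prems(3) by simp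
  next
    case False
    then have "common_count Ys k l < common_count Ys k' l'" using Cons by simp
    then show ?thesis using Cons.prems(1)[of Y] by simp
  qed
qed simp

section \<open>Inverted and central generators\<close>

declare add_uminus_conv_diff [simp]

text \<open>The bound \<open>5500000000 * k ^ 6\<close> stays below \<open>F (2 * k\<^sup>2 + 28 * k - 4)\<close>; this is tightest for
  \<open>k = 1\<close>. The set \<open>H\<close> is the image of the original group.\<close>

locale rigidity = cyclic_part c N for c :: "int \<Rightarrow> 'g::group_add" and N +
  fixes S :: "'g set" and H :: "'g set" and k :: nat
  assumes fin: "finite S" and zero: "0 \<notin> S"
    and reduced: "\<And>s. s \<in> S \<Longrightarrow> - s \<in> S \<Longrightarrow> - s = s"
    and k: "card S = k" "0 < k"
    and N_large: "5500000000 * int k ^ 6 \<le> N"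
    and single: "\<And>s. k = 1 \<Longrightarrow> s \<in> S \<Longrightarrow> commutes 1 s"
    and H_add: "\<And>x y. x \<in> H \<Longrightarrow> y \<in> H \<Longrightarrow> x + y \<in> H"
    and H_uminus: "\<And>x. x \<in> H \<Longrightarrow> - x \<in> H"
    and S_H: "S \<subseteq> H" and c_H: "\<And>i. c i \<in> H"
begin

text \<open>While hubs and ties are added, the set has at most \<open>8 * k\<close> elements and its
  \<open>pm0\<close> at most \<open>17 * k\<close>. The factor in front of
  \<open>L div M + 1\<close> is then \<open>12 * 17 * k\<close>. Taking \<open>M = bound\<close> as
  twice this factor makes the recurring exceptions fill about half of
  \<open>L = extent\<close>.\<close>

abbreviation bound :: nat where "bound \<equiv> 408 * k"
abbreviation extent :: nat where "extent \<equiv> 2200 * k ^ 2"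

text \<open>The two ranges of each notion are needed because products of two exponents, one for
  each of two generators, occur as exponents again. The ranges are small enough compared to \<open>N\<close> that no
  element is central and inverted at the same time.\<close>

definition inverted :: "'g \<Rightarrow> bool" where
  "inverted g \<longleftrightarrow> (\<exists>f\<in>{1..bound}. inverts (int f) g)"

definition central :: "'g \<Rightarrow> bool" where
  "central g \<longleftrightarrow> (\<exists>e\<in>{1..bound}. commutes (int e) g)"

definition weakly_central :: "'g \<Rightarrow> bool" where
  "weakly_central g \<longleftrightarrow> (\<exists>e\<in>{1..bound ^ 2}. commutes (int e) g)"

definition weakly_inverted :: "'g \<Rightarrow> bool" where
  "weakly_inverted g \<longleftrightarrow> (\<exists>f\<in>{1..1000 * k ^ 2}. inverts (int f) g)"

lemma less_N:
  assumes "x \<le> a * k ^ i" "a < 5500000000" "i \<le> 6"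
  shows "int x < N"
proof -
  have "a * k ^ i \<le> a * k ^ 6"
    using k(2) assms(3) by (intro mult_left_mono power_increasing) auto
  also have "\<dots> < 5500000000 * k ^ 6" using assms(2) k(2) by simp
  finally have "x < 5500000000 * k ^ 6" using assms(1) by linarith
  then have "int x < int (5500000000 * k ^ 6)" by (simp only: of_nat_less_iff)
  then show ?thesis using N_large by simp
qed

lemma double_less_N:
  assumes "d \<le> a * k ^ i" "l \<le> b * k ^ j" "2 * (a * b) < 5500000000" "i + j \<le> 6"
  shows "2 * int (d * l) < N"
proof -
  have "d * l \<le> (a * k ^ i) * (b * k ^ j)" using assms(1,2) by (rule mult_le_mono)
  then have "2 * (d * l) \<le> (2 * (a * b)) * k ^ (i + j)" by (simp add: power_add mult.assoc mult.left_commute)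
  from less_N[OF this assms(3,4)] show ?thesis by simp
qed

lemma bound_sq: "bound ^ 2 = 166464 * k ^ 2"
  by (simp add: power2_eq_square)

lemma k_sq: "k \<le> k ^ 2" "1 \<le> k ^ 2"
  using k(2) by (simp_all add: power2_eq_square)

lemma clash:
  assumes "commutes (int e) q" "inverts (int f) q" "0 < e" "0 < f"
    and "e \<le> a * k ^ i" "f \<le> b * k ^ j" "2 * (a * b) < 5500000000" "i + j \<le> 6"
  shows False
  by (rule not_commutes_inverts_mult[OF assms(1,2)])
    (use assms(3,4) double_less_N[OF assms(5-8)] in simp_all)

lemma central_weakly: "central g \<Longrightarrow> weakly_central g"
proof -
  have "bound \<le> bound ^ 2" by (simp add: power2_eq_square)
  then show "central g \<Longrightarrow> weakly_central g"
    unfolding central_def weakly_central_def by (meson atLeastAtMost_iff le_trans)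
qed

lemma inverted_weakly: "inverted g \<Longrightarrow> weakly_inverted g"
proof -
  have "bound \<le> 1000 * k ^ 2" using k_sq by simp
  then show "inverted g \<Longrightarrow> weakly_inverted g"
    unfolding inverted_def weakly_inverted_def by (meson atLeastAtMost_iff le_trans)
qed

lemma not_weakly_central_inverted:
  assumes "weakly_central g" "weakly_inverted g"
  shows False
proof -
  from assms obtain e f where "e \<in> {1..bound ^ 2}" "commutes (int e) g"
    "f \<in> {1..1000 * k ^ 2}" "inverts (int f) g"
    unfolding weakly_central_def weakly_inverted_def by blast
  then show False
    using clash[of e g f 166464 2 1000 2] by (simp add: bound_sq)
qed

lemma not_central_inverted: "central g \<Longrightarrow> inverted g \<Longrightarrow> False"
  using not_weakly_central_inverted central_weakly inverted_weakly by blast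

lemma inverted_uminus [simp]: "inverted (- g) \<longleftrightarrow> inverted g"
  by (simp add: inverted_def)

lemma central_uminus [simp]: "central (- g) \<longleftrightarrow> central g"
  by (simp add: central_def)

lemma weakly_central_uminus [simp]: "weakly_central (- g) \<longleftrightarrow> weakly_central g"
  by (simp add: weakly_central_def)

lemma weakly_inverted_uminus [simp]: "weakly_inverted (- g) \<longleftrightarrow> weakly_inverted g"
  by (simp add: weakly_inverted_def)

lemma weakly_inverted_double:
  assumes "weakly_inverted s"
  shows "weakly_central (s + s)"
proof -
  from assms obtain f where f: "f \<in> {1..1000 * k ^ 2}" "inverts (int f) s"
    unfolding weakly_inverted_def by blast
  have "1000 * k ^ 2 \<le> bound ^ 2" by (simp add: bound_sq)
  then show ?thesis
    using f commutes_add_inverts[OF f(2) f(2)] unfolding weakly_central_def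
    by (meson atLeastAtMost_iff le_trans)
qed

text \<open>Membership in \<open>H\<close> is needed to pull the set back to the original group. The
  second half is an implication so that one construction serves both claims of the theorem.\<close>

definition nice :: "'g set \<Rightarrow> bool" where
  "nice X \<longleftrightarrow> X \<subseteq> H \<and> ((\<forall>s\<in>S. s + s \<noteq> 0) \<longrightarrow> (\<forall>x\<in>X. x + x \<noteq> 0))"

lemma gadget_H: "w \<in> H \<Longrightarrow> A \<subseteq> H \<Longrightarrow> gadget (c b + w) A \<subseteq> H"
  using c_H H_add H_uminus by (auto simp: gadget_def)

lemma zero_H: "0 \<in> H"
  using c_H[of 0] by simp

lemma pm_H: "A \<subseteq> H \<Longrightarrow> g \<in> pm A \<Longrightarrow> g \<in> H"
  using H_uminus[of "- g"] by (auto simp: in_pm)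

lemma pm0_H: "A \<subseteq> H \<Longrightarrow> g \<in> pm0 A \<Longrightarrow> g \<in> H"
  using pm_H zero_H by (auto simp: pm0_def)

end

text \<open>\<open>S'\<close> contains the generators and the auxiliary elements: a generic power
  \<open>y\<close> and, in one case, an inverted element. These have to be separated by degree as
  well. \<open>double_words\<close> is there because increments at \<open>s\<close> may touch
  \<open>s + s\<close>, which must not be confused with \<open>y\<close>.\<close>

locale extended_rigidity = rigidity c N S H k for c :: "int \<Rightarrow> 'g::group_add" and N S H k +
  fixes S' V :: "'g set" and y :: 'g and b0 :: int
  assumes fin': "finite S'" and zero': "0 \<notin> pm S'" and SS': "insert y S \<subseteq> S'" and S'_H: "S' \<subseteq> H"
    and reduced': "\<And>s. s \<in> S' \<Longrightarrow> - s \<in> S' \<Longrightarrow> - s = s"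
    and V: "finite V" "\<And>v. - v \<in> V \<longleftrightarrow> v \<in> V" "card V \<le> 4 * k"
    and y: "y = c b0" "y \<notin> words S" "y + y \<notin> words S"
    and double': "\<And>s. s \<in> S' \<Longrightarrow> (\<forall>s\<in>S. s + s \<noteq> 0) \<Longrightarrow> s + s \<noteq> 0"
    and double_words: "\<And>s. s \<in> S' \<Longrightarrow> s \<noteq> y \<Longrightarrow> s + s \<in> words S"
begin

lemma setting:
  assumes "good S' V Xs" "0 < M"
  shows "gadget_setting c N S' (total S' Xs) V M"
proof unfold_locales
  show "finite (total S' Xs)" by (rule finite_total[OF assms(1) fin'])
  show "finite V" by (rule V)
  show "S' \<subseteq> total S' Xs" by (rule subset_total)
  show "0 \<notin> pm (total S' Xs)" by (rule good_zero[OF assms(1) zero'])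
  show "- v \<in> V \<longleftrightarrow> v \<in> V" for v by (rule V)
  show "t \<noteq> a + b" if "t \<in> pm (total S' Xs)" "t \<notin> pm S'" "a \<in> pm0 S'" "b \<in> pm0 S'" for t a b
    using good_outside[OF assms(1) that(1,2)] that(3,4) by blast
  show "t \<notin> V" if "t \<in> pm (total S' Xs)" "t \<notin> pm S'" for t
    using good_outside[OF assms(1) that] by blast
  show "0 < M" by (rule assms)
qed

lemma S_S': "S \<subseteq> S'" "y \<in> S'"
  using SS' by auto

lemma pm_S': "g \<in> pm S \<Longrightarrow> g \<in> pm S'"
  using pm_mono[OF S_S'(1)] by blast

lemma y_pm: "y \<in> pm S'" "- y \<in> pm S'"
  using S_S' by (auto simp: in_pm)

lemma hub_count:
  assumes "card (pm0 T) \<le> 17 * k"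
  shows "3 * (card V + card (pm0 T) ^ 2)
    + (3 * card (pm0 T) + 3 * (3 * card (pm0 T))) * (extent div bound + 1) < extent"
proof -
  define q where "q = extent div bound"
  have d: "q * 51 \<le> 275 * k"
  proof -
    have "q * bound \<le> extent" unfolding q_def by (rule div_times_less_eq_dividend)
    then have "(q * 51) * (8 * k) \<le> (275 * k) * (8 * k)"
      by (simp add: power2_eq_square ac_simps)
    then show ?thesis using k(2) by simp
  qed
  have t2: "card (pm0 T) ^ 2 \<le> 289 * k ^ 2"
    using power_mono[OF assms, of 2] by (simp add: power2_eq_square)
  have "(3 * card (pm0 T) + 3 * (3 * card (pm0 T))) * (q + 1)
      \<le> (204 * k) * (q + 1)"
    by (intro mult_right_mono) (use assms in auto)
  also have "\<dots> = 4 * k * (q * 51) + 204 * k" by simp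
  also have "\<dots> \<le> 4 * k * (275 * k) + 204 * k" using d by (intro add_right_mono mult_left_mono) auto
  finally have "(3 * card (pm0 T) + 3 * (3 * card (pm0 T))) * (q + 1)
      \<le> 1100 * k ^ 2 + 204 * k" by (simp add: power2_eq_square)
  moreover have "1100 * k ^ 2 + 204 * k + 3 * (4 * k + 289 * k ^ 2) < extent"
    using k_sq by simp
  moreover have "3 * (card V + card (pm0 T) ^ 2) \<le> 3 * (4 * k + 289 * k ^ 2)"
    using V(3) t2 by simp
  ultimately show ?thesis unfolding q_def[symmetric] by linarith
qed

text \<open>The flags \<open>i\<close> and \<open>z\<close> record whether \<open>w - g\<close> is inverted and \<open>g\<close> is central: then
  the hub of \<open>g\<close> unavoidably has one further common neighbour for the stated pairs.\<close>

definition hub_spec :: "bool \<Rightarrow> bool \<Rightarrow> 'g \<Rightarrow> 'g \<Rightarrow> 'g set \<Rightarrow> bool" where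
  "hub_spec i z w g X \<longleftrightarrow> nice X \<and> 0 < card (link X g \<inter> link X y) \<and>
    (\<forall>u\<in>pm S. card (link X u \<inter> link X y) \<le> (if u = g \<or> i \<and> u = w + (- g + w) then 1 else 0)) \<and>
    (\<forall>u\<in>pm S. card (link X u \<inter> link X (- y)) \<le> (if z \<and> u = - w + (- g + w) then 1 else 0)) \<and>
    (\<forall>u\<in>pm S'. link X u \<noteq> {} \<longrightarrow> u \<in> words (insert y S)) \<and>
    (\<forall>u\<in>pm S. link X u \<noteq> {} \<longrightarrow> w = 0 \<or> \<not> z \<and> \<not> i \<longrightarrow>
      u = g \<or> u = - g \<or> i \<and> (u = g + g \<or> u = - (g + g)))"

definition tie_spec :: "'g \<Rightarrow> 'g \<Rightarrow> 'g set \<Rightarrow> bool" where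
  "tie_spec w u X \<longleftrightarrow> nice X \<and> 0 < card (link X w \<inter> link X u) \<and>
    (u + u \<noteq> 0 \<longrightarrow> card (link X w \<inter> link X (- u)) = 0) \<and>
    (u + u \<noteq> 0 \<longrightarrow> w + w \<noteq> 0 \<longrightarrow> card (link X (- w) \<inter> link X u) = 0) \<and>
    (\<forall>v\<in>pm S'. link X v \<noteq> {} \<longrightarrow> v \<in> pm {w, u, w + w, - w + u, - u + (w + w)}) \<and>
    (\<forall>v\<in>pm S'. 0 < card (link X w \<inter> link X v) \<longrightarrow> v \<in> {w, - w, u, w + w, - (w + w), - w + u})"

definition increment_spec :: "'g \<Rightarrow> 'g set \<Rightarrow> bool" where
  "increment_spec s X \<longleftrightarrow> nice X \<and> 0 < card (link X s) \<and>
    (weakly_central s \<or> inverted s \<longrightarrow> 2 \<le> card (link X s)) \<and>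
    (\<forall>u\<in>pm S'. link X u \<noteq> {} \<longrightarrow> u = s \<or> u = - s \<or> weakly_inverted s \<and> (u = s + s \<or> u = - (s + s)))"

lemma card_pm0_total:
  assumes "good S' V Xs" "card (total S' Xs) \<le> n"
  shows "card (pm0 (total S' Xs)) \<le> 2 * n + 1"
  using card_pm0_le[OF finite_total[OF assms(1) fin']] assms(2) by (meson add_right_mono le_trans mult_le_mono2)

lemma card_three: "card {a, b, d} \<le> 3"
  by (simp add: card_insert_if)

lemma nice_gadget:
  assumes "X = gadget (c b + w) A" "w \<in> H" "A \<subseteq> H"
    and "\<And>x. x \<in> X \<Longrightarrow> x + x = 0 \<Longrightarrow> \<not> (\<forall>s\<in>S. s + s \<noteq> 0)"
  shows "nice X"
  using gadget_H[OF assms(2,3), of b] assms(1,4) by (auto simp: nice_def)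

lemma increment_step:
  assumes Xs: "good S' V Xs" and s: "s \<in> S'" and size: "card (total S' Xs) + 2 \<le> 2 * k ^ 2 + 28 * k"
  shows "\<exists>X. fresh S' V (total S' Xs) X \<and> card X \<le> 2 \<and> increment_spec s X"
proof -
  \<comment> \<open>Here \<open>pm0\<close> of the set has at most \<open>61 * k ^ 2\<close>
    elements and the factor in front of \<open>L div M + 1\<close> is five times that;
    \<open>M\<close> is again twice the factor. The resulting bound
    \<open>2 * 166464 * 15600 * k ^ 6\<close> for \<open>2 * D * L\<close> is the requirement that
    comes closest to the constant in \<open>N_large\<close>.\<close>
  let ?T = "total S' Xs" and ?M = "610 * k ^ 2" and ?L = "15600 * k ^ 4"
  interpret gadget_setting c N S' ?T V ?L ?M
    by (rule setting[OF Xs]) (use k in simp)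
  have spm: "s \<in> pm S'" using s by (simp add: in_pm)
  have k42: "k ^ 2 \<le> k ^ 4" "k \<le> k ^ 4" "1 \<le> k ^ 4" using k(2) by (auto intro: power_increasing self_le_power)
  have le: "?M \<le> ?L" using k42 by simp
  have "card ?T + 2 \<le> 30 * k ^ 2" using size k_sq by linarith
  then have small: "card (pm0 ?T) \<le> 61 * k ^ 2"
    using card_pm0_le[OF finT] k_sq by linarith
  have count: "2 * (card V + card (pm0 ?T) ^ 2)
      + (1 * card (pm0 ?T) + 2 * (2 * card (pm0 ?T))) * (?L div ?M + 1) < ?L"
  proof -
    define q where "q = ?L div ?M"
    have d: "q * 61 \<le> 1560 * k ^ 2"
    proof -
      have "q * ?M \<le> ?L" unfolding q_def by (rule div_times_less_eq_dividend)
      then have "(q * 61) * (10 * k ^ 2) \<le> (1560 * k ^ 2) * (10 * k ^ 2)"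
        by (simp add: power_add[symmetric] ac_simps)
      moreover have "0 < 10 * k ^ 2" using k(2) by simp
      ultimately show ?thesis by (simp only: mult_le_cancel2 simp_thms)
    qed
    have t2: "card (pm0 ?T) ^ 2 \<le> 3721 * k ^ 4"
      using power_mono[OF small, of 2] by (simp add: power_mult_distrib power_mult[symmetric])
    have "(1 * card (pm0 ?T) + 2 * (2 * card (pm0 ?T))) * (q + 1)
        \<le> (305 * k ^ 2) * (q + 1)"
      by (intro mult_right_mono) (use small in auto)
    also have "\<dots> = 5 * k ^ 2 * (q * 61) + 305 * k ^ 2" by simp
    also have "\<dots> \<le> 5 * k ^ 2 * (1560 * k ^ 2) + 305 * k ^ 2"
      using d by (intro add_right_mono mult_left_mono) auto
    also have "\<dots> = 7800 * k ^ 4 + 305 * k ^ 2" by (simp add: power_add[symmetric])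
    finally have "(1 * card (pm0 ?T) + 2 * (2 * card (pm0 ?T))) * (q + 1) \<le> 7800 * k ^ 4 + 305 * k ^ 2" .
    moreover have "7800 * k ^ 4 + 305 * k ^ 2 + 2 * (4 * k + 3721 * k ^ 4) < ?L"
      using k42 by simp
    moreover have "2 * (card V + card (pm0 ?T) ^ 2) \<le> 2 * (4 * k + 3721 * k ^ 4)"
      using V(3) t2 by simp
    ultimately show ?thesis unfolding q_def[symmetric] by linarith
  qed
  \<comment> \<open>An exponent from the definitions resolves \<open>s\<close> in both senses, since
    commuting and inverting exclude each other in this range. If there is none, \<open>1\<close>
    resolves \<open>s\<close>, because both weak ranges exceed \<open>M\<close>.\<close>
  have "\<exists>D. 0 < D \<and> D \<le> bound ^ 2 \<and> resolves D s \<and> twist_resolves D s \<and>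
    (inverts (int D) s \<longrightarrow> weakly_inverted s) \<and>
    (weakly_central s \<or> inverted s \<longrightarrow> commutes (int D) s \<or> inverts (int D) s)"
  proof (cases "weakly_inverted s")
    case True
    then obtain f where f: "f \<in> {1..1000 * k ^ 2}" "inverts (int f) s" unfolding weakly_inverted_def by blast
    have "2 * int (f * ?L) < N" by (rule double_less_N[of f 1000 2 _ 15600 4]) (use f in auto)
    then have "resolves f s" "twist_resolves f s"
      using resolves_inverts[OF f(2)] f le by (auto simp: twist_resolves_def)
    moreover have "f \<le> bound ^ 2" using f by (simp add: bound_sq)
    ultimately show ?thesis using f True by (intro exI[of _ f]) auto
  next
    case ni: False
    show ?thesis
    proof (cases "weakly_central s")
      case True
      then obtain e where e: "e \<in> {1..bound ^ 2}" "commutes (int e) s" unfolding weakly_central_def by blast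
      have DL: "2 * int (e * ?L) < N"
        by (rule double_less_N[of e 166464 2 _ 15600 4]) (use e in \<open>auto simp: bound_sq\<close>)
      then have "resolves e s" "twist_resolves e s" "\<not> inverts (int e) s"
        using twist_resolves_commutes[OF e(2) _ DL le] not_inverts_commutes[OF e(2) _ DL le] e
        by (auto simp: resolves_def)
      then show ?thesis using e by (intro exI[of _ e]) auto
    next
      case False
      have "\<not> commutes (int l) s" "\<not> inverts (int l) s" if "l \<in> {1..?M}" for l
      proof -
        have "l \<in> {1..bound ^ 2}" "l \<in> {1..1000 * k ^ 2}" using that by (auto simp: bound_sq)
        then show "\<not> commutes (int l) s" "\<not> inverts (int l) s"
          using False ni unfolding weakly_central_def weakly_inverted_def by blast+
      qed
      moreover from this[of 1] have "\<not> inverts (int 1) s" using k(2) by simp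
      moreover have "1 \<le> bound ^ 2" using k(2) by simp
      ultimately show ?thesis
        using False ni inverted_weakly by (intro exI[of _ 1]) (auto simp: resolves_def twist_resolves_def)
    qed
  qed
  then obtain D where D: "0 < D" "D \<le> bound ^ 2" "resolves D s" "twist_resolves D s"
    "inverts (int D) s \<longrightarrow> weakly_inverted s"
    "weakly_central s \<or> inverted s \<longrightarrow> commutes (int D) s \<or> inverts (int D) s" by blast
  have DL: "2 * int (D * ?L) < N"
    by (rule double_less_N[of D 166464 2 _ 15600 4]) (use D in \<open>auto simp: bound_sq\<close>)
  obtain X b where X: "fresh S' V ?T X" "X = gadget (c b + 0) {0, s}" "0 < card (link X s)"
    "commutes (int D) s \<or> inverts (int D) s \<Longrightarrow> 2 \<le> card (link X s)"
    "\<And>u. u \<in> pm S' \<Longrightarrow> u \<noteq> s \<Longrightarrow> u \<noteq> - s \<Longrightarrow>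
      (inverts (int D) s \<Longrightarrow> u \<noteq> s + s \<and> u \<noteq> - (s + s)) \<Longrightarrow> link X u = {}"
    "\<And>x. x \<in> X \<Longrightarrow> x + x = 0 \<Longrightarrow> s + s = 0"
    by (rule exists_increment[OF spm D(1) DL le D(3,4) count]) (rule that; (assumption | blast))
  have "nice X"
    by (rule nice_gadget[OF X(2)]) (use X(6) double'[OF s] zero_H S'_H s in auto)
  moreover have "card X \<le> 2"
    unfolding X(2) by (rule order_trans[OF card_gadget_le]) (auto simp: card_insert_if)
  moreover have "u = s \<or> u = - s \<or> weakly_inverted s \<and> (u = s + s \<or> u = - (s + s))"
    if "u \<in> pm S'" "link X u \<noteq> {}" for u
    using X(5)[OF that(1)] that(2) D(5) by blast
  ultimately show ?thesis
    using X(1,3,4) D(6) unfolding increment_spec_def by (intro exI[of _ X]) blast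
qed

lemma tie_step:
  assumes Xs: "good S' V Xs" and size: "card (total S' Xs) \<le> 8 * k"
    and w: "w \<in> pm S'" "inverts (int D) w" and u: "u \<in> pm S'" "inverts (int D) u"
    and wu: "u \<noteq> w" "u \<noteq> - w" and D: "0 < D" "D \<le> bound ^ 2" and wV: "- u + (w + w) \<in> V"
  shows "\<exists>X. fresh S' V (total S' Xs) X \<and> card X \<le> 3 \<and> tie_spec w u X"
proof -
  let ?T = "total S' Xs"
  interpret gadget_setting c N S' ?T V extent bound
    by (rule setting[OF Xs]) (use k in simp)
  have le: "bound \<le> extent" using k_sq by simp
  have "card (pm0 ?T) \<le> 17 * k" using card_pm0_total[OF Xs size] k(2) by simp
  note count = hub_count[OF this]
  have DL: "2 * int (D * extent) < N"
    by (rule double_less_N[of D 166464 2 _ 2200 2]) (use D in \<open>auto simp: bound_sq\<close>)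
  obtain X b where X: "fresh S' V ?T X" "X = gadget (c b + w) {0, w, u}"
    "0 < card (link X w \<inter> link X u)"
    "u + u \<noteq> 0 \<Longrightarrow> card (link X w \<inter> link X (- u)) = 0"
    "u + u \<noteq> 0 \<Longrightarrow> w + w \<noteq> 0 \<Longrightarrow> card (link X (- w) \<inter> link X u) = 0"
    "\<And>v. v \<in> pm S' \<Longrightarrow> link X v \<noteq> {} \<Longrightarrow>
      v \<in> pm {w, u, w + w, - w + u, - u + (w + w)}"
    "\<And>v. v \<in> pm S' \<Longrightarrow> 0 < card (link X w \<inter> link X v) \<Longrightarrow> v \<in> {w, - w, u, w + w, - (w + w), - w + u}"
    "\<And>x. x \<in> X \<Longrightarrow> x + x = 0 \<Longrightarrow> w + w = 0"
    by (rule exists_tie[OF w u wu D(1) DL le wV count]) (rule that; (assumption | blast))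
  have "\<not> (\<forall>s\<in>S. s + s \<noteq> 0)" if "w + w = 0"
  proof -
    have "- w + - w = - (w + w)" by (simp add: minus_add)
    then have "- w + - w = 0" using that by simp
    then show ?thesis using w(1) that double' by (auto simp: in_pm)
  qed
  then have "nice X"
    by (intro nice_gadget[OF X(2)]) (use X(8) zero_H pm_H[OF S'_H] w u in auto)
  moreover have "card X \<le> 3"
    unfolding X(2) by (rule order_trans[OF card_gadget_le]) (auto simp: card_three)
  ultimately show ?thesis
    using X(1,3-7) unfolding tie_spec_def by (intro exI[of _ X]) blast
qed

end

context extended_rigidity
begin

lemma hub_step:
  assumes set: "gadget_setting c N S' T V M" and u: "u \<in> pm S" and w: "w \<in> pm0 S"
    and D: "0 < D" "2 * int (D * L) < N" "M \<le> L"
    and res: "gadget_setting.resolves c M D u" "gadget_setting.twist_resolves c M D (w + - u)"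
    and w_twist: "\<And>l. l \<in> {1..M} \<Longrightarrow> \<not> inverts (int (D * l)) w"
    and kind: "commutes (int D) w \<and> w + y = y + w \<or>
      \<not> commutes (int D) u \<and> \<not> inverts (int D) (w + - u)"
    and colours: "T = S' \<or> w = 0 \<or>
      \<not> commutes (int D) u \<and> \<not> inverts (int D) (w + - u) \<and> - w + (y + w) \<in> V"
    and count: "3 * (card V + card (pm0 T) ^ 2)
      + (3 * card (pm0 T) + 3 * (3 * card (pm0 T))) * (L div M + 1) < L"
    and noinv: "inverts (int D) (w + - u) \<Longrightarrow> (w + - u) + (w + - u) = 0 \<Longrightarrow> \<not> (\<forall>s\<in>S. s + s \<noteq> 0)"
  shows "\<exists>X. fresh S' V T X \<and> card X \<le> 3 \<and>
    hub_spec (inverts (int D) (w + - u)) (commutes (int D) u) w u X"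
proof -
  interpret gadget_setting c N S' T V L M by (rule set)
  have H: "u \<in> H" "w \<in> H" "y \<in> H"
    using pm_H[OF S_H u] pm0_H[OF S_H w] S'_H S_S'(2) by auto
  show ?thesis
  proof (rule exists_hub[OF S_S'(1) y(1) S_S'(2) y(2,3) u w D res w_twist kind colours count])
    fix X b
    assume X: "fresh S' V T X" "X = gadget (c b + w) {0, u, y}"
      "0 < card (link X u \<inter> link X y)"
      "\<And>k. k \<in> pm S \<Longrightarrow> card (link X k \<inter> link X y) \<le>
        (if k = u \<or> inverts (int D) (w + - u) \<and> k = w + (- u + w) then 1 else 0)"
      "\<And>k. k \<in> pm S \<Longrightarrow> card (link X k \<inter> link X (- y)) \<le>
        (if commutes (int D) u \<and> k = - w + (- u + w) then 1 else 0)"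
      "\<And>k. k \<in> pm S' \<Longrightarrow> link X k \<noteq> {} \<Longrightarrow> k \<in> words (insert y S)"
      "\<And>k. k \<in> pm S \<Longrightarrow> link X k \<noteq> {} \<Longrightarrow>
        w = 0 \<or> \<not> commutes (int D) u \<and> \<not> inverts (int D) (w + - u) \<Longrightarrow>
        k = u \<or> k = - u \<or> inverts (int D) (w + - u) \<and> (k = u + u \<or> k = - (u + u))"
      "\<And>x. x \<in> X \<Longrightarrow> x + x = 0 \<Longrightarrow> inverts (int D) (w + - u) \<and> (w + - u) + (w + - u) = 0"
    have "nice X"
      by (rule nice_gadget[OF X(2)]) (use X(8) noinv H zero_H in auto)
    moreover have "card X \<le> 3"
      unfolding X(2) by (rule order_trans[OF card_gadget_le]) (auto simp: card_three)
    ultimately show ?thesis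
      using X(1,3-7) unfolding hub_spec_def by (intro exI[of _ X]) blast
  qed
qed

text \<open>For shift \<open>0\<close> the words \<open>w - u + w\<close> and
  \<open>- w - u + w\<close> are both \<open>- u\<close>, so the only possible extra common
  neighbours belong to the pairs of \<open>- u\<close> with \<open>y\<close> and with
  \<open>- y\<close>.\<close>

lemma plain_hub_step:
  assumes Xs: "good S' V Xs" and size: "card (total S' Xs) \<le> 8 * k" and u: "u \<in> pm S"
  shows "\<exists>X. fresh S' V (total S' Xs) X \<and> card X \<le> 3 \<and>
    (\<exists>i z. (i \<longrightarrow> inverted u) \<and> (z \<longrightarrow> central u) \<and> hub_spec i z 0 u X)"
proof -
  let ?T = "total S' Xs"
  have set: "gadget_setting c N S' ?T V bound"
    by (rule setting[OF Xs]) (use k in simp)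
  interpret gadget_setting c N S' ?T V extent bound by (rule set)
  have le: "bound \<le> extent" using k_sq by simp
  have "card (pm0 ?T) \<le> 17 * k" using card_pm0_total[OF Xs size] k(2) by simp
  note count = hub_count[OF this]
  have DL: "2 * int (D * extent) < N" if "D \<le> bound" for D
    by (rule double_less_N[of D 408 1 _ 2200 2]) (use that in auto)
  have "\<exists>D. 0 < D \<and> D \<le> bound \<and> resolves D u \<and> twist_resolves D u \<and>
    (inverts (int D) u \<longrightarrow> inverted u) \<and> (commutes (int D) u \<longrightarrow> central u)"
  proof (cases "inverted u")
    case True
    then obtain f where f: "f \<in> {1..bound}" "inverts (int f) u" unfolding inverted_def by blast
    then have "resolves f u" "twist_resolves f u" "\<not> commutes (int f) u"
      using resolves_inverts[OF f(2) _ DL le] not_inverts_commutes[of f u, OF _ _ DL le]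
      by (auto simp: twist_resolves_def)
    then show ?thesis using f True by (intro exI[of _ f]) auto
  next
    case ni: False
    show ?thesis
    proof (cases "central u")
      case True
      then obtain e where e: "e \<in> {1..bound}" "commutes (int e) u" unfolding central_def by blast
      then have "resolves e u" "twist_resolves e u" "\<not> inverts (int e) u"
        using twist_resolves_commutes[OF e(2) _ DL le] not_inverts_commutes[OF e(2) _ DL le]
        by (auto simp: resolves_def)
      then show ?thesis using e True by (intro exI[of _ e]) auto
    next
      case False
      have *: "\<not> commutes (int l) u" "\<not> inverts (int l) u" if "l \<in> {1..bound}" for l
        using False ni that unfolding central_def inverted_def by blast+
      moreover from *[of 1] have "\<not> inverts (int 1) u" "\<not> commutes (int 1) u" using k(2) by simp_all
      ultimately show ?thesis
        using k(2) by (intro exI[of _ 1]) (auto simp: resolves_def twist_resolves_def)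
    qed
  qed
  then obtain D where D: "0 < D" "D \<le> bound" "resolves D u" "twist_resolves D u"
    "inverts (int D) u \<longrightarrow> inverted u" "commutes (int D) u \<longrightarrow> central u" by blast
  have tr: "twist_resolves D (0 + - u)" using D(4) by (simp add: twist_resolves_def)
  have "\<exists>X. fresh S' V ?T X \<and> card X \<le> 3 \<and>
    hub_spec (inverts (int D) (0 + - u)) (commutes (int D) u) 0 u X"
  proof (rule hub_step[OF set u _ D(1) DL[OF D(2)] le D(3) tr _ _ _ count])
    show "\<not> inverts (int (D * l)) 0" if "l \<in> {1..bound}" for l
      by (rule not_inverts_mult[OF _ D(1) DL[OF D(2)]]) (use that le in auto)
    show "\<not> (\<forall>s\<in>S. s + s \<noteq> 0)" if "(0 + - u) + (0 + - u) = 0"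
    proof -
      have m: "- u + - u = 0" using that by (simp only: add_0_left)
      then have "- (u + u) = 0" by (simp only: minus_add)
      then have "u + u = 0" by (simp only: neg_equal_0_iff_equal)
      note * = this m
      show ?thesis
      proof (cases "u \<in> S")
        case False
        then have "- u \<in> S" using u by (simp add: in_pm)
        then show ?thesis using *(2) by blast
      qed (use *(1) in blast)
    qed
  qed simp_all
  then obtain X where X: "fresh S' V ?T X" "card X \<le> 3"
    "hub_spec (inverts (int D) (0 + - u)) (commutes (int D) u) 0 u X" by blast
  moreover have "inverts (int D) (0 + - u) \<longrightarrow> inverted u" using D(5) by simp
  ultimately show ?thesis using D(6) by blast
qed

text \<open>If \<open>u\<close> and \<open>w - u\<close> both inverted \<open>c (f * l)\<close>,
  then \<open>w\<close> would commute with it, and \<open>f * l\<close> is small enough to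
  contradict that \<open>w\<close> is not weakly central. So both flags are off and the hub has no
  extra common neighbours.\<close>

lemma shifted_hub_step:
  assumes Xs: "good S' V Xs" and size: "card (total S' Xs) \<le> 8 * k" and u: "u \<in> pm S"
    and w: "w \<in> pm S" "\<not> weakly_central w" and f: "f \<in> {1..bound}" "inverts (int f) u"
    and wf: "\<And>l. l \<in> {1..bound} \<Longrightarrow> \<not> inverts (int (f * l)) w" and wV: "- w + (y + w) \<in> V"
  shows "\<exists>X. fresh S' V (total S' Xs) X \<and> card X \<le> 3 \<and> hub_spec False False w u X"
proof -
  let ?T = "total S' Xs"
  have set: "gadget_setting c N S' ?T V bound"
    by (rule setting[OF Xs]) (use k in simp)
  interpret gadget_setting c N S' ?T V extent bound by (rule set)
  have le: "bound \<le> extent" using k_sq by simp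
  have "card (pm0 ?T) \<le> 17 * k" using card_pm0_total[OF Xs size] k(2) by simp
  note count = hub_count[OF this]
  have DL: "2 * int (f * extent) < N"
    by (rule double_less_N[of f 408 1 _ 2200 2]) (use f in auto)
  have f0: "0 < f" using f by simp
  have tw: "\<not> inverts (int (f * l)) (w + - u)" if l: "l \<in> {1..bound}" for l
  proof
    assume i: "inverts (int (f * l)) (w + - u)"
    have "inverts (int (f * l)) u" using inverts_dvd[OF f(2)] by simp
    from commutes_add_inverts[OF i this] have "commutes (int (f * l)) w"
      by (simp add: group_word del: add_uminus_conv_diff)
    moreover have "f * l \<le> bound ^ 2" "1 \<le> f * l"
      using f l mult_le_mono[of f bound l bound] by (auto simp: power2_eq_square)
    ultimately show False using w(2) unfolding weakly_central_def by (meson atLeastAtMost_iff)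
  qed
  have tw1: "\<not> inverts (int f) (w + - u)" using tw[of 1] k(2) by simp
  have nc: "\<not> commutes (int f) u"
    using not_inverts_commutes[OF _ f0 DL le] f(2) by blast
  have "\<exists>X. fresh S' V ?T X \<and> card X \<le> 3 \<and>
    hub_spec (inverts (int f) (w + - u)) (commutes (int f) u) w u X"
  proof (rule hub_step[OF set u _ f0 DL le _ _ wf _ _ count])
    show "w \<in> pm0 S" using w by (simp add: pm0_def)
    show "resolves f u" by (rule resolves_inverts[OF f(2) f0 DL le])
    show "twist_resolves f (w + - u)" using tw by (simp add: twist_resolves_def)
  qed (use tw1 nc wV in blast)+
  then show ?thesis using tw1 nc by simp
qed

text \<open>Here \<open>D\<close> may be as large as \<open>bound ^ 2 * (110 * k)\<close>. This is
  affordable because the hub is the first gadget: the set \<open>S'\<close> has at most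
  \<open>k + 2\<close> elements, which permits the much smaller parameters \<open>110 * k\<close>
  and \<open>200 * k ^ 2\<close>.\<close>

lemma special_hub_step:
  assumes u: "u \<in> pm S" and w: "w \<in> pm S" and e: "e \<in> {1..bound ^ 2}" "commutes (int e) w"
    and wy: "w + y = y + w" and size: "card S' \<le> k + 2" "2 \<le> k"
    and noinv: "\<not> central u \<Longrightarrow> (w + - u) + (w + - u) = 0 \<Longrightarrow> \<not> (\<forall>s\<in>S. s + s \<noteq> 0)"
  shows "\<exists>X. fresh S' V S' X \<and> card X \<le> 3 \<and> (\<exists>i z. hub_spec i z w u X)"
proof -
  let ?M = "110 * k" and ?L = "200 * k ^ 2"
  have set: "gadget_setting c N S' S' V ?M"
    using setting[OF good_Nil, of ?M] k(2) by simp
  interpret gadget_setting c N S' S' V ?L ?M by (rule set)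
  have kk: "2 * k \<le> k ^ 2" using size(2) by (simp add: power2_eq_square)
  have le: "?M \<le> ?L" using k_sq by simp
  have card: "2 * card (pm0 S') \<le> 9 * k"
    using card_pm0_le[OF fin'] size by simp
  have count: "3 * (card V + card (pm0 S') ^ 2)
      + (3 * card (pm0 S') + 3 * (3 * card (pm0 S'))) * (?L div ?M + 1) < ?L"
  proof -
    define q where "q = ?L div ?M"
    have d: "q * 11 \<le> 20 * k"
    proof -
      have "q * ?M \<le> ?L" unfolding q_def by (rule div_times_less_eq_dividend)
      then have "(q * 11) * (10 * k) \<le> (20 * k) * (10 * k)"
        by (simp add: power2_eq_square ac_simps)
      then show ?thesis using k(2) by simp
    qed
    have t2: "4 * card (pm0 S') ^ 2 \<le> 81 * k ^ 2"
      using power_mono[OF card, of 2] by (simp add: power_mult_distrib)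
    have "(3 * card (pm0 S') + 3 * (3 * card (pm0 S'))) * (q + 1) \<le> (54 * k) * (q + 1)"
      by (intro mult_right_mono) (use card in auto)
    moreover have "11 * ((54 * k) * (q + 1)) = 54 * k * (q * 11) + 594 * k" by (simp add: algebra_simps)
    moreover have "54 * k * (q * 11) \<le> 54 * k * (20 * k)" using d by (intro mult_left_mono) auto
    moreover have "54 * k * (20 * k) = 1080 * k ^ 2" by (simp add: power2_eq_square)
    ultimately have "11 * ((3 * card (pm0 S') + 3 * (3 * card (pm0 S'))) * (q + 1)) \<le> 1080 * k ^ 2 + 594 * k"
      by linarith
    moreover have "44 * (3 * (card V + card (pm0 S') ^ 2)) \<le> 33 * (16 * k + 81 * k ^ 2)"
      using V(3) t2 by simp
    moreover have "4 * (1080 * k ^ 2 + 594 * k) + 33 * (16 * k + 81 * k ^ 2) < 44 * ?L"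
      using kk k_sq by simp
    moreover have "44 * (a + b) < R" if "11 * b \<le> B" "44 * a \<le> A" "4 * B + A < R" for a b A B R :: nat
      using that by simp
    ultimately have "44 * (3 * (card V + card (pm0 S') ^ 2)
        + (3 * card (pm0 S') + 3 * (3 * card (pm0 S'))) * (q + 1)) < 44 * ?L" by blast
    then show ?thesis unfolding q_def[symmetric] by (simp only: mult_less_cancel1)
  qed
  have D_le: "2 * int (D * ?L) < N" if "D \<le> bound ^ 2 * ?M" for D
  proof -
    have "D * ?L \<le> (bound ^ 2 * ?M) * ?L" using that by (rule mult_right_mono) simp
    also have "\<dots> = 3662208000 * k ^ 5"
      by (simp add: bound_sq power_add[symmetric] power2_eq_square) (simp add: eval_nat_numeral)
    finally have "2 * (D * ?L) \<le> 3662208000 * (2 * k ^ 5)" by simp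
    also have "2 * k ^ 5 \<le> k * k ^ 5" using size(2) by (intro mult_right_mono) auto
    also have "k * k ^ 5 = k ^ 6" by (simp add: power_Suc[symmetric])
    finally have "2 * (D * ?L) \<le> 3662208000 * k ^ 6" by simp
    from less_N[OF this] show ?thesis by simp
  qed
  have e0: "0 < e" using e by simp
  \<comment> \<open>\<open>e\<close> is enlarged to \<open>e * l\<close> if some such multiple lets
    \<open>u\<close> commute or lets \<open>w - u\<close> invert; \<open>w\<close> keeps commuting.
    Otherwise \<open>e\<close> itself resolves both.\<close>
  have "\<exists>D. 0 < D \<and> D \<le> bound ^ 2 * ?M \<and> commutes (int D) w \<and> resolves D u \<and> twist_resolves D (w + - u)"
  proof (cases "\<exists>l\<in>{1..?M}. commutes (int (e * l)) u")
    case True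
    then obtain l where l: "l \<in> {1..?M}" "commutes (int (e * l)) u" by blast
    have D: "e * l \<le> bound ^ 2 * ?M" "0 < e * l"
      using mult_le_mono[of e "bound ^ 2" l ?M] e l by (simp_all only: atLeastAtMost_iff) simp_all
    have "commutes (int (e * l)) w" using commutes_dvd[OF e(2)] by simp
    moreover from commutes_add[OF this, of "- u"] have "twist_resolves (e * l) (w + - u)"
      using l(2) by (intro twist_resolves_commutes[OF _ D(2) D_le[OF D(1)] le]) simp
    ultimately show ?thesis using D l(2) by (intro exI[of _ "e * l"]) (auto simp: resolves_def)
  next
    case nc: False
    show ?thesis
    proof (cases "\<exists>l\<in>{1..?M}. inverts (int (e * l)) (w + - u)")
      case True
      then obtain l where l: "l \<in> {1..?M}" "inverts (int (e * l)) (w + - u)" by blast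
      have D: "e * l \<le> bound ^ 2 * ?M" "0 < e * l"
      using mult_le_mono[of e "bound ^ 2" l ?M] e l by (simp_all only: atLeastAtMost_iff) simp_all
      have cw: "commutes (int (e * l)) w" using commutes_dvd[OF e(2)] by simp
      then have "commutes (int (e * l)) (- w)" by simp
      from inverts_add2[OF this l(2)] have "inverts (int (e * l)) u"
        by (simp add: group_word del: add_uminus_conv_diff)
      from resolves_inverts[OF this D(2) D_le[OF D(1)] le] show ?thesis
        using D l(2) cw by (intro exI[of _ "e * l"]) (auto simp: twist_resolves_def)
    next
      case False
      then have "resolves e u" "twist_resolves e (w + - u)"
        using nc unfolding resolves_def twist_resolves_def by blast+
      moreover have "e * 1 \<le> bound ^ 2 * ?M" using e k(2) by (intro mult_le_mono) auto
      ultimately show ?thesis using e(2) e0 by (intro exI[of _ e]) auto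
    qed
  qed
  then obtain D where D: "0 < D" "D \<le> bound ^ 2 * ?M" "commutes (int D) w" "resolves D u"
    "twist_resolves D (w + - u)" by blast
  have "\<exists>X. fresh S' V S' X \<and> card X \<le> 3 \<and>
    hub_spec (inverts (int D) (w + - u)) (commutes (int D) u) w u X"
  proof (rule hub_step[OF set u _ D(1) D_le[OF D(2)] le D(4,5) _ _ _ count])
    show "w \<in> pm0 S" using w by (simp add: pm0_def)
    show "\<not> inverts (int (D * l)) w" if "l \<in> {1..?M}" for l
      by (rule not_inverts_mult[OF D(3,1) D_le[OF D(2)]]) (use that le in auto)
    show "\<not> (\<forall>s\<in>S. s + s \<noteq> 0)" if i: "inverts (int D) (w + - u)" "(w + - u) + (w + - u) = 0"
    proof (rule noinv[OF _ i(2)])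
      have "inverts (int D) (- w + (w + - u))"
        using inverts_add2[OF _ i(1), of "- w"] D(3) by simp
      then have iu: "inverts (int D) u" by (simp del: add_uminus_conv_diff)
      show "\<not> central u"
      proof
        assume "central u"
        then obtain e where e: "e \<in> {1..bound}" "commutes (int e) u" unfolding central_def by blast
        have "e * D \<le> bound * (bound ^ 2 * ?M)" using e(1) D(2) by (intro mult_le_mono) auto
        also have "\<dots> = 7470904320 * k ^ 4"
          by (simp add: bound_sq power_add[symmetric] power2_eq_square) (simp add: eval_nat_numeral)
        finally have "2 * (e * D) \<le> 3735452160 * (4 * k ^ 4)" by (simp add: mult.commute)
        also have "4 * k ^ 4 \<le> k ^ 2 * k ^ 4"
          using power_mono[OF size(2), of 2] by (intro mult_right_mono) auto
        also have "k ^ 2 * k ^ 4 = k ^ 6" by (simp add: power_add[symmetric])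
        finally have "2 * (e * D) \<le> 3735452160 * k ^ 6" by simp
        from less_N[OF this] have "2 * (int e * int D) < N" by simp
        then show False using not_commutes_inverts_mult[OF e(2) iu] e(1) D(1) by simp
      qed
    qed
  qed (use D(3) wy in auto)
  then show ?thesis by blast
qed

end

section \<open>Recovering signs from common neighbours\<close>

lemma (in separated_automorphism) map_fixed:
  assumes "u \<in> pm S" "l \<in> pm S" "\<phi> l = l" "common_count Xs (- u) l < common_count Xs u l"
  shows "\<phi> u = u"
  using map_pm[OF assms(1)] common_count_map[OF assms(1,2)] assms(3,4) by auto

text \<open>If \<open>l\<close> were negated, the pair of \<open>u\<close> and \<open>l\<close>
  would go to the pair of \<open>u\<close> or \<open>- u\<close> with \<open>- l\<close>, and both
  have fewer common neighbours.\<close>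

lemma (in separated_automorphism) map_not_flipped:
  assumes "u \<in> pm S" "l \<in> pm S" "common_count Xs u (- l) < common_count Xs u l"
    "common_count Xs (- u) (- l) < common_count Xs u l"
  shows "\<phi> l = l"
  using map_pm[OF assms(1)] map_pm[OF assms(2)] common_count_map[OF assms(1,2)] assms(3,4) by auto

context rigidity
begin

definition colour_map :: "('g \<Rightarrow> 'g) \<Rightarrow> bool" where
  "colour_map \<phi> \<longleftrightarrow> (\<forall>g\<in>pm S. \<phi> g = g \<or> \<phi> g = - g) \<and>
    (\<forall>g\<in>pm S. \<forall>h\<in>pm S. - g + h \<in> pm S \<longrightarrow>
      - \<phi> g + \<phi> h = - g + h \<or> - \<phi> g + \<phi> h = - (- g + h))"

definition rigid :: "'g set \<Rightarrow> bool" where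
  "rigid T \<longleftrightarrow> S \<subseteq> T \<and> finite T \<and> 0 \<notin> T \<and> card T \<le> 2 * k ^ 2 + 28 * k \<and> nice T \<and>
    (\<forall>\<phi>. link_automorphism T \<phi> \<longrightarrow> colour_map \<phi>)"

text \<open>Increments at weakly central or inverted elements gain two triangles, so four of them do
  the work of eight.\<close>

definition rounds :: "'g \<Rightarrow> nat" where
  "rounds s = (if weakly_central s \<or> inverted s then 4 else 8)"

end

context extended_rigidity
begin

text \<open>The common end of all cases: hubs and ties are given, increments separate the degrees,
  and \<open>maps\<close> is the argument about signs that differs from case to case. One triangle
  from \<open>start\<close> and eight from increments lift every degree above 8.\<close>

lemma exists_rigid:
  assumes hubs: "good S' V Hs" "\<And>X. X \<in> set Hs \<Longrightarrow> nice X"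
    and start: "\<And>s. s \<in> S' \<Longrightarrow> \<exists>X\<in>set Hs. link X s \<noteq> {}"
    and bound: "card (total S' Hs) + 2 * sum rounds S' + card S' * (card S' - 1) \<le> 2 * k ^ 2 + 28 * k"
    and maps: "\<And>Is \<phi>. (\<And>X. X \<in> set Is \<Longrightarrow> \<exists>s\<in>S'. increment_spec s X) \<Longrightarrow>
      separated_automorphism S' V (Is @ Hs) \<phi> \<Longrightarrow> colour_map \<phi>"
  shows "\<exists>T. rigid T"
proof -
  let ?a = "\<lambda>s. if weakly_central s \<or> inverted s then 2 else 1 :: nat"
  interpret separation S' V increment_spec ?a rounds "2 * k ^ 2 + 28 * k"
  proof unfold_locales
    show "finite S'" by (rule fin')
    show "\<exists>X. fresh S' V (total S' Xs) X \<and> card X \<le> 2 \<and> increment_spec s X"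
      if "s \<in> S'" "good S' V Xs" "card (total S' Xs) + 2 \<le> 2 * k ^ 2 + 28 * k" for s Xs
      by (rule increment_step[OF that(2,1,3)])
    show "?a s \<le> card (link X s)" if "increment_spec s X" for s X
      using that by (auto simp: increment_spec_def)
    show "0 < ?a s" "8 \<le> rounds s * ?a s" for s by (simp_all add: rounds_def)
  qed
  \<comment> \<open>Weakly inverted elements come first: an increment at such an \<open>s\<close>
    may disturb \<open>s + s\<close>, which is weakly central and therefore treated later.\<close>
  obtain ps where ps: "set ps = {s \<in> S'. weakly_inverted s}" "distinct ps"
    using finite_distinct_list[of "{s \<in> S'. weakly_inverted s}"] fin' by auto
  obtain qs where qs: "set qs = {s \<in> S'. \<not> weakly_inverted s}" "distinct qs"
    using finite_distinct_list[of "{s \<in> S'. \<not> weakly_inverted s}"] fin' by auto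
  have "\<exists>Is. good S' V (Is @ Hs) \<and> (\<forall>Y\<in>set Is. \<exists>s\<in>S'. increment_spec s Y) \<and>
    card (total S' (Is @ Hs)) \<le> 2 * k ^ 2 + 28 * k \<and>
    (\<forall>s\<in>S'. 8 < degree (Is @ Hs) s) \<and> inj_on (degree (Is @ Hs)) S'"
  proof (rule separate[OF hubs(1)])
    show "0 < degree Hs s" if s: "s \<in> S'" for s
    proof -
      obtain X where X: "X \<in> set Hs" "link X s \<noteq> {}" using start[OF s] by blast
      have "pm X \<subseteq> pm (total S' Hs)" using X(1) by (intro pm_mono) (auto simp: total_def)
      then have "link X s \<subseteq> link (total S' Hs) s" by (auto simp: link_def)
      then have "link (total S' Hs) s \<noteq> {}" using X(2) by blast
      then show ?thesis
        using finite_link[OF finite_total[OF hubs(1) fin']] by (simp add: card_gt_0_iff)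
    qed
    show "distinct (ps @ qs)" "set (ps @ qs) = S'" using ps qs by auto
    show "link X t = {}"
      if l: "ps @ qs = as @ s # bs" and t: "t \<in> set as" and X: "increment_spec s X" for as s bs t X
    proof (rule ccontr)
      assume ne: "link X t \<noteq> {}"
      have "distinct (as @ s # bs)" "set (as @ s # bs) = S'"
        unfolding l[symmetric] using ps qs by auto
      then have st: "t \<noteq> s" "t \<in> S'" "s \<in> S'" using t by auto
      have "t \<noteq> - s" using reduced'[OF st(3)] st(1,2) by auto
      with X ne st have w: "weakly_inverted s" "t = s + s \<or> t = - (s + s)"
        by (auto simp: increment_spec_def in_pm)
      have "s \<notin> set qs" using w(1) qs by auto
      from l[unfolded append_eq_append_conv2] obtain us
        where "ps = as @ us \<or> as = ps @ us \<and> us @ s # bs = qs" by blast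
      then have "t \<in> set ps" using t \<open>s \<notin> set qs\<close> by auto
      then have "weakly_inverted t" using ps by simp
      moreover have "weakly_central t" using w(2) weakly_inverted_double[OF w(1)] by auto
      ultimately show False using not_weakly_central_inverted by blast
    qed
  qed (use bound in simp)
  then obtain Is where Is: "good S' V (Is @ Hs)" "\<forall>Y\<in>set Is. \<exists>s\<in>S'. increment_spec s Y"
    "card (total S' (Is @ Hs)) \<le> 2 * k ^ 2 + 28 * k"
    "\<forall>s\<in>S'. 8 < degree (Is @ Hs) s" "inj_on (degree (Is @ Hs)) S'" by blast
  let ?T = "total S' (Is @ Hs)"
  have "rigid ?T"
    unfolding rigid_def
  proof (intro conjI allI impI)
    show "S \<subseteq> ?T" using S_S' by (auto simp: total_def)
    show "finite ?T" by (rule finite_total[OF Is(1) fin'])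
    show "0 \<notin> ?T" using good_zero[OF Is(1) zero'] by (simp add: in_pm)
    show "card ?T \<le> 2 * k ^ 2 + 28 * k" by (rule Is)
    have nice: "nice X" if "X \<in> set (Is @ Hs)" for X
      using that Is(2) hubs(2) unfolding increment_spec_def by auto
    have "x \<in> H \<and> ((\<forall>s\<in>S. s + s \<noteq> 0) \<longrightarrow> x + x \<noteq> 0)" if x: "x \<in> ?T" for x
    proof (cases "x \<in> S'")
      case True
      then show ?thesis using S'_H double'[OF True] by blast
    next
      case False
      then obtain X where "X \<in> set (Is @ Hs)" "x \<in> X" using x by (auto simp: total_def)
      then show ?thesis using nice[of X] by (auto simp: nice_def)
    qed
    then show "nice ?T" by (auto simp: nice_def)
    show "colour_map \<phi>" if "link_automorphism ?T \<phi>" for \<phi>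
    proof (rule maps[of Is])
      show "separated_automorphism S' V (Is @ Hs) \<phi>"
      proof (intro separated_automorphism.intro separated_family.intro that fin' Is(1))
        show "8 < degree (Is @ Hs) s" if "s \<in> S'" for s using Is(4) that by blast
        show "s = t \<or> s = - t" if "s \<in> S'" "t \<in> S'" "degree (Is @ Hs) s = degree (Is @ Hs) t" for s t
          using inj_onD[OF Is(5) that(3,1,2)] by simp
      qed
    qed (use Is(2) in blast)
  qed
  then show ?thesis ..
qed

section \<open>Counts of common neighbours with \<open>y\<close>\<close>

abbreviation row :: "'g set \<Rightarrow> 'g \<Rightarrow> 'g \<Rightarrow> nat" where
  "row X u l \<equiv> card (link X u \<inter> link X l)"

definition plain :: "'g \<Rightarrow> 'g set \<Rightarrow> bool" where
  "plain u X \<longleftrightarrow> (\<exists>i z. (i \<longrightarrow> inverted u) \<and> (z \<longrightarrow> central u) \<and> hub_spec i z 0 u X)"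

definition neutral :: "'g set \<Rightarrow> bool" where
  "neutral X \<longleftrightarrow> (\<forall>u\<in>pm S. row X u y = 0 \<and> row X u (- y) = 0)"

definition orientation :: "'g set \<Rightarrow> bool" where
  "orientation R \<longleftrightarrow> R \<subseteq> pm S \<and> (\<forall>s\<in>S. s \<in> R \<or> - s \<in> R) \<and> (\<forall>u\<in>R. - u \<in> R \<longrightarrow> - u = u)"

lemma central_y: "weakly_central y" "\<not> weakly_inverted y"
proof -
  show "weakly_central y"
    unfolding weakly_central_def y(1) using k(2) by (intro bexI[of _ 1]) auto
  then show "\<not> weakly_inverted y" using not_weakly_central_inverted by blast
qed

lemma y_words: "x \<in> words S \<Longrightarrow> y \<noteq> x \<and> - y \<noteq> x \<and> y + y \<noteq> x \<and> - (y + y) \<noteq> x"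
  using y(2,3) words_uminus_iff[of y S] words_uminus_iff[of "y + y" S] by blast

lemma pm_words: "u \<in> pm S \<Longrightarrow> u \<in> words S"
  by (simp add: wordsI1 pm0_def)

text \<open>An increment at \<open>s\<close> touches \<open>s\<close>, possibly
  \<open>s + s\<close>, and their negatives. A generator and \<open>y\<close> cannot both be among
  these: \<open>y\<close> is not a word in the generators, and being weakly central it is not weakly
  inverted.\<close>

lemma increment_neutral:
  assumes "s \<in> S'" "increment_spec s X"
  shows "neutral X"
proof -
  have "link X u = {} \<or> link X l = {}" if u: "u \<in> pm S" and l: "l = y \<or> l = - y" for u l
  proof (rule ccontr)
    assume "\<not> ?thesis"
    then have ne: "link X u \<noteq> {}" "link X l \<noteq> {}" by auto
    have sp: "v = s \<or> v = - s \<or> weakly_inverted s \<and> (v = s + s \<or> v = - (s + s))"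
      if "v \<in> pm S'" "link X v \<noteq> {}" for v
      using assms(2) that unfolding increment_spec_def by blast
    have uw: "u \<in> words S" by (rule pm_words[OF u])
    have "l \<in> pm S'" using l y_pm by blast
    note sl = sp[OF this ne(2)] and su = sp[OF pm_S'[OF u] ne(1)]
    show False
    proof (cases "s = y \<or> s = - y")
      case True
      then have "\<not> weakly_inverted s" using central_y(2) by auto
      with su have "u = s \<or> u = - s" by blast
      then have "u = y \<or> u = - y" using True by auto
      then show False using y_words[OF uw] by blast
    next
      case False
      have "l \<noteq> s" "l \<noteq> - s" using l False by auto
      with sl have *: "l = s + s \<or> l = - (s + s)" by blast
      have "s + s \<in> words S" using double_words[OF assms(1)] False by blast
      then have "l \<in> words S" using * by auto
      then show False using y_words l by blast
    qed
  qed
  then have "link X u \<inter> link X y = {} \<and> link X u \<inter> link X (- y) = {}" if "u \<in> pm S" for u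
    using that by blast
  then show ?thesis unfolding neutral_def by simp
qed

text \<open>With \<open>y\<close>, a hub of \<open>v\<close> counts \<open>v\<close>, and
  \<open>- v\<close> only if \<open>v\<close> is inverted; with \<open>- y\<close> it counts at most
  \<open>- v\<close>, and only if \<open>v\<close> is central. As \<open>u\<close> and
  \<open>v\<close> come from one orientation, \<open>- u = v\<close> is impossible unless
  \<open>u + u = 0\<close>.\<close>

lemma plain_rows:
  assumes R: "orientation R" and u: "u \<in> R" and v: "v \<in> R" and X: "plain v X"
  shows "\<not> central u \<Longrightarrow> row X u (- y) = 0" "\<not> central u \<Longrightarrow> row X (- u) (- y) = 0"
    and "u + u \<noteq> 0 \<Longrightarrow> row X u (- y) = 0" "u + u \<noteq> 0 \<Longrightarrow> row X (- u) (- y) \<le> row X u y"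
    and "u + u \<noteq> 0 \<Longrightarrow> row X (- u) y \<le> row X u y"
    and "u + u \<noteq> 0 \<Longrightarrow> \<not> inverted u \<Longrightarrow> row X (- u) y = 0"
proof -
  obtain i z where iz: "i \<longrightarrow> inverted v" "z \<longrightarrow> central v" and h: "hub_spec i z 0 v X"
    using X unfolding plain_def by blast
  have upm: "u \<in> pm S" "- u \<in> pm S" using R u by (auto simp: orientation_def)
  have le: "row X t y \<le> (if t = v \<or> i \<and> t = - v then 1 else 0)"
    "row X t (- y) \<le> (if z \<and> t = - v then 1 else 0)" if "t \<in> pm S" for t
    using h that by (simp_all add: hub_spec_def)
  have pos: "0 < row X v y" using h by (simp add: hub_spec_def)
  have eq': "u = v" if "u = - v" using R u v that unfolding orientation_def by auto
  have nn: "- u \<noteq> u" if "u + u \<noteq> 0" using that eq_neg_iff_add_eq_0[of u u] by auto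
  show "row X u (- y) = 0" if "\<not> central u"
    using le(2)[OF upm(1)] iz that eq' by (auto split: if_splits)
  show "row X (- u) (- y) = 0" if "\<not> central u"
    using le(2)[OF upm(2)] iz that by (auto split: if_splits)
  show "row X u (- y) = 0" if "u + u \<noteq> 0"
    using le(2)[OF upm(1)] nn[OF that] eq' by (auto split: if_splits)
  show "row X (- u) (- y) \<le> row X u y" if "u + u \<noteq> 0"
  proof (cases "u = v")
    case True
    then show ?thesis using le(2)[OF upm(2)] pos by (auto split: if_splits)
  qed (use le(2)[OF upm(2)] in \<open>auto split: if_splits\<close>)
  have ne: "- u \<noteq> v" if "u + u \<noteq> 0"
  proof
    assume "- u = v"
    moreover from this have "u = - v" by auto
    ultimately show False using eq' nn[OF that] by auto
  qed
  show "row X (- u) y \<le> row X u y" if "u + u \<noteq> 0"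
  proof (cases "u = v")
    case True
    then show ?thesis using le(1)[OF upm(2)] pos by (auto split: if_splits)
  qed (use le(1)[OF upm(2)] ne[OF that] in \<open>auto split: if_splits\<close>)
  show "row X (- u) y = 0" if "u + u \<noteq> 0" "\<not> inverted u"
    using le(1)[OF upm(2)] iz that ne[OF that(1)] by (auto split: if_splits)
qed

lemma plain_row_pos: "plain u X \<Longrightarrow> 0 < row X u y"
  by (auto simp: plain_def hub_spec_def)

lemma neutral_rows: "neutral X \<Longrightarrow> u \<in> pm S \<Longrightarrow> row X u y = 0 \<and> row X u (- y) = 0"
  by (simp add: neutral_def)

text \<open>In the next three lemmas the family consists of gadgets attached to the elements of \<open>R\<close>,
  gadgets that do not see \<open>y\<close>, and gadgets that satisfy the required inequality themselves.\<close>

lemma fixed_y_fixes: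
  assumes "separated_automorphism S' V Xs \<phi>" and R: "orientation R" "u \<in> R"
    and X0: "X0 \<in> set Xs" "plain u X0" and u: "u + u \<noteq> 0" "\<not> inverted u" and y: "\<phi> y = y"
    and Xs: "\<And>X. X \<in> set Xs \<Longrightarrow> neutral X \<or> (\<exists>v\<in>R. plain v X) \<or> row X (- u) y \<le> row X u y"
  shows "\<phi> u = u"
proof -
  interpret separated_automorphism S' V Xs \<phi> by fact
  have upm: "u \<in> pm S" using R by (auto simp: orientation_def)
  show ?thesis
  proof (rule map_fixed[OF pm_S'[OF upm] y_pm(1) y])
    show "common_count Xs (- u) y < common_count Xs u y"
    proof (rule common_count_less[OF _ X0(1)])
      show "row X (- u) y \<le> row X u y" if "X \<in> set Xs" for X
        using Xs[OF that] plain_rows(5)[OF R _ _ u(1)] neutral_rows[of X "- u"] upm by auto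
      show "row X0 (- u) y < row X0 u y"
        using plain_rows(6)[OF R R(2) X0(2) u] plain_row_pos[OF X0(2)] by simp
    qed
  qed
qed

lemma y_not_flipped:
  assumes "separated_automorphism S' V Xs \<phi>" and R: "orientation R" "u \<in> R"
    and X0: "X0 \<in> set Xs" "plain u X0" and u: "\<not> central u"
    and Xs: "\<And>X. X \<in> set Xs \<Longrightarrow> neutral X \<or> (\<exists>v\<in>R. plain v X) \<or>
      row X u (- y) \<le> row X u y \<and> row X (- u) (- y) \<le> row X u y"
  shows "\<phi> y = y"
proof -
  interpret separated_automorphism S' V Xs \<phi> by fact
  have upm: "u \<in> pm S" using R by (auto simp: orientation_def)
  have le: "row X u (- y) \<le> row X u y \<and> row X (- u) (- y) \<le> row X u y" if "X \<in> set Xs" for X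
    using Xs[OF that] plain_rows(1,2)[OF R _ _ u] neutral_rows[of X u] neutral_rows[of X "- u"] upm
    by auto
  have lt: "row X0 u (- y) < row X0 u y" "row X0 (- u) (- y) < row X0 u y"
    using plain_rows(1,2)[OF R R(2) X0(2) u] plain_row_pos[OF X0(2)] by simp_all
  show ?thesis
    by (rule map_not_flipped[OF pm_S'[OF upm] y_pm(1)])
      (auto intro!: common_count_less[OF _ X0(1)] lt simp: le)
qed

lemma flipped_y_flips:
  assumes "separated_automorphism S' V Xs \<phi>" and R: "orientation R" "u \<in> R"
    and X0: "X0 \<in> set Xs" "plain u X0" and u: "u + u \<noteq> 0" and y: "\<phi> y = - y"
    and Xs: "\<And>X. X \<in> set Xs \<Longrightarrow> neutral X \<or> (\<exists>v\<in>R. plain v X)"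
  shows "\<phi> u = - u"
proof -
  interpret separated_automorphism S' V Xs \<phi> by fact
  have upm: "u \<in> pm S" using R by (auto simp: orientation_def)
  have "common_count Xs u (- y) < common_count Xs u y"
  proof (rule common_count_less[OF _ X0(1)])
    show "row X u (- y) \<le> row X u y" if "X \<in> set Xs" for X
      using Xs[OF that] plain_rows(3)[OF R _ _ u(1)] neutral_rows[of X u] upm by auto
    show "row X0 u (- y) < row X0 u y"
      using plain_rows(3)[OF R R(2) X0(2) u] plain_row_pos[OF X0(2)] by simp
  qed
  then show ?thesis
    using map_pm[OF pm_S'[OF upm]] common_count_map[OF pm_S'[OF upm] y_pm(1)] y by auto
qed

end

lemma commute_uminus: "p + q = q + p \<Longrightarrow> - p + q = q + - p" for p q :: "'g::group_add"
proof -
  assume "p + q = q + p"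
  then have "- p + (p + q) + - p = - p + (q + p) + - p" by (simp only:)
  then show "- p + q = q + - p" by (simp add: group_word del: add_uminus_conv_diff)
qed

lemma commute_pm:
  fixes a b :: "'g::group_add"
  assumes "a + b = b + a" and "x = a \<or> x = - a" "y = b \<or> y = - b"
  shows "x + y = y + x"
proof -
  note 1 = commute_uminus[OF assms(1)]
  note 2 = commute_uminus[OF assms(1)[symmetric]]
  note 3 = commute_uminus[OF 2[symmetric]]
  show ?thesis using assms(2,3)
    by (elim disjE; hypsubst) (rule assms(1) 1 2[symmetric] 3)+
qed

lemma restrict_Int: "{j \<in> A. P j} \<inter> A = {j \<in> A. P j}"
  by auto

context rigidity
begin

section \<open>Choosing the auxiliary elements\<close>

lemma card_pm0_S: "card (pm0 S) \<le> 3 * k"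
  using card_pm0_le[OF fin] k by simp

lemma choose_y:
  assumes e: "e \<in> {1..bound ^ 2}"
  shows "\<exists>b. int e dvd b \<and> c b \<notin> words S \<and> c b + c b \<notin> words S"
proof -
  \<comment> \<open>There are at most \<open>(3 * k) ^ 4 = 81 * k ^ 4\<close> words, and each
    excludes at most one \<open>j\<close> through \<open>c b\<close> and one through
    \<open>c b + c b\<close>; \<open>163\<close> is one more than twice \<open>81\<close>.\<close>
  let ?L = "163 * k ^ 4" and ?h = "\<lambda>j. c (int (e * j))"
  have W: "finite (words S)" "card (words S) \<le> 81 * k ^ 4"
  proof -
    show "finite (words S)" by (rule finite_words[OF fin])
    have "card (words S) \<le> card (pm0 S) ^ 4" by (rule card_words_le[OF fin])
    also have "\<dots> \<le> (3 * k) ^ 4" by (rule power_mono[OF card_pm0_S]) simp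
    finally show "card (words S) \<le> 81 * k ^ 4" by (simp add: power_mult_distrib)
  qed
  have small: "2 * int (e * ?L) < N"
    by (rule double_less_N[of e 166464 2 _ 163 4]) (use e in \<open>auto simp: bound_sq\<close>)
  have ne: "c (int (e * i)) \<noteq> c (int (e * j))" "c (2 * int (e * i)) \<noteq> c (2 * int (e * j))"
    if "1 \<le> i" "i < j" "j \<le> ?L" for i j
  proof -
    have "e * i < e * j" "e * j \<le> e * ?L" using that e by (auto intro: mult_le_mono)
    then have "int (e * i) < int (e * j)" "int (e * j) \<le> int (e * ?L)" "0 \<le> int (e * i)"
      by (simp_all only: of_nat_less_iff of_nat_le_iff of_nat_0_le_iff)
    then show "c (int (e * i)) \<noteq> c (int (e * j))" "c (2 * int (e * i)) \<noteq> c (2 * int (e * j))"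
      using c_inj[of "int (e * i)" "int (e * j)"] c_inj[of "2 * int (e * i)" "2 * int (e * j)"] small
      by linarith+
  qed
  have 1: "card {j \<in> {1..?L}. c (int (e * j)) \<in> words S} \<le> 81 * k ^ 4"
    by (rule order_trans[OF card_preimage_le[OF W(1)] W(2)]) (rule ne(1))
  have 2: "card {j \<in> {1..?L}. c (2 * int (e * j)) \<in> words S} \<le> 81 * k ^ 4"
    by (rule order_trans[OF card_preimage_le[OF W(1)] W(2)]) (rule ne(2))
  have "\<exists>j\<in>{1..?L}. \<forall>B\<in>{{j \<in> {1..?L}. c (int (e * j)) \<in> words S},
      {j \<in> {1..?L}. c (2 * int (e * j)) \<in> words S}}. j \<notin> B"
  proof (rule exists_avoiding)
    have "card ({j \<in> {1..?L}. c (int (e * j)) \<in> words S} \<inter> {1..?L} \<union>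
        {j \<in> {1..?L}. c (2 * int (e * j)) \<in> words S} \<inter> {1..?L}) \<le> 81 * k ^ 4 + 81 * k ^ 4"
      by (rule order_trans[OF card_Un_le add_mono]) (unfold restrict_Int, rule 1, rule 2)
    also have "\<dots> < ?L" using k(2) by simp
    finally show "card (\<Union>B\<in>{{j \<in> {1..?L}. c (int (e * j)) \<in> words S},
      {j \<in> {1..?L}. c (2 * int (e * j)) \<in> words S}}. B \<inter> {1..?L}) < ?L"
      by (simp only: UN_insert UN_empty Un_empty_right)
  qed
  then obtain j where "c (int (e * j)) \<notin> words S" "c (2 * int (e * j)) \<notin> words S" by auto
  moreover have "c (2 * int (e * j)) = c (int (e * j)) + c (int (e * j))"
    by (simp add: c_add[symmetric])
  ultimately show ?thesis by (intro exI[of _ "int (e * j)"]) auto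
qed

lemma choose_z:
  assumes f: "f \<in> {1..bound}"
  shows "\<exists>b. int f dvd b \<and> c b + g \<notin> words (insert y S)"
proof -
  \<comment> \<open>\<open>626\<close> is one more than \<open>5 ^ 4\<close>, as
    \<open>pm0 (insert y S)\<close> has at most \<open>5 * k\<close> elements.\<close>
  let ?L = "626 * k ^ 4" and ?S = "insert y S"
  have W: "finite (words ?S)" "card (words ?S) \<le> 625 * k ^ 4"
  proof -
    show "finite (words ?S)" using fin by (simp add: finite_words)
    have "card (pm0 ?S) \<le> 2 * card ?S + 1" using fin by (intro card_pm0_le) simp
    also have "\<dots> \<le> 5 * k" using k fin by (simp add: card_insert_if)
    finally have "card (pm0 ?S) \<le> 5 * k" .
    then have "card (pm0 ?S) ^ 4 \<le> (5 * k) ^ 4" by (rule power_mono) simp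
    then show "card (words ?S) \<le> 625 * k ^ 4"
      using card_words_le[of ?S] fin by (simp add: power_mult_distrib)
  qed
  have small: "2 * int (f * ?L) < N"
    by (rule double_less_N[of f 408 1 _ 626 4]) (use f in auto)
  have ne: "c (int (f * i)) + g \<noteq> c (int (f * j)) + g"
    if "1 \<le> i" "i < j" "j \<le> ?L" for i j
  proof -
    have "f * i < f * j" "f * j \<le> f * ?L" using that f by (auto intro: mult_le_mono)
    then have "int (f * i) < int (f * j)" "int (f * j) \<le> int (f * ?L)" "0 \<le> int (f * i)"
      by (simp_all only: of_nat_less_iff of_nat_le_iff of_nat_0_le_iff)
    then have "c (int (f * i)) \<noteq> c (int (f * j))"
      using c_inj[of "int (f * i)" "int (f * j)"] small by linarith
    then show ?thesis by (simp del: of_nat_mult)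
  qed
  have 1: "card {j \<in> {1..?L}. c (int (f * j)) + g \<in> words ?S} \<le> 625 * k ^ 4"
    by (rule order_trans[OF card_preimage_le[OF W(1)] W(2)]) (rule ne)
  have "\<exists>j\<in>{1..?L}. \<forall>B\<in>{{j \<in> {1..?L}. c (int (f * j)) + g \<in> words ?S}}. j \<notin> B"
  proof (rule exists_avoiding)
    show "card (\<Union>B\<in>{{j \<in> {1..?L}. c (int (f * j)) + g \<in> words ?S}}. B \<inter> {1..?L}) < ?L"
      unfolding UN_insert UN_empty Un_empty_right restrict_Int
      by (rule le_less_trans[OF 1]) (use k(2) in simp)
  qed
  then obtain j where "c (int (f * j)) + g \<notin> words ?S" by auto
  then show ?thesis by (intro exI[of _ "int (f * j)"]) auto
qed

lemma extended_insert_y: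
  assumes y: "y = c b" "y \<notin> words S" "y + y \<notin> words S"
    and V: "finite V" "\<And>v. - v \<in> V \<longleftrightarrow> v \<in> V" "card V \<le> 4 * k"
  shows "extended_rigidity c N S H k (insert y S) V y b"
proof unfold_locales
  have w: "x \<in> words S" if "x \<in> pm0 S" for x using that by (rule wordsI1)
  have y0: "y \<noteq> 0" "y + y \<noteq> 0" using y w[of 0] by auto
  show "finite (insert y S)" using fin by simp
  show "0 \<notin> pm (insert y S)" using y0 zero by (auto simp: in_pm)
  show "insert y S \<subseteq> H" using S_H c_H y(1) by auto
  show "- s = s" if "s \<in> insert y S" "- s \<in> insert y S" for s
  proof -
    have nS: "- y \<notin> S"
    proof
      assume "- y \<in> S"
      then have "y \<in> words S" using w[of y] by (auto simp: pm0_def in_pm)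
      then show False using y by simp
    qed
    show ?thesis
    proof (cases "s = y")
      case True
      then show ?thesis using that(2) nS by auto
    next
      case False
      then have "s \<in> S" using that by simp
      moreover have "- s \<noteq> y" using nS \<open>s \<in> S\<close> by auto
      ultimately show ?thesis using that(2) reduced by blast
    qed
  qed
  show "s + s \<noteq> 0" if "s \<in> insert y S" "\<forall>s\<in>S. s + s \<noteq> 0" for s
    using that y0 by auto
  show "s + s \<in> words S" if "s \<in> insert y S" "s \<noteq> y" for s
    using that by (intro wordsI2) (auto simp: pm0_def in_pm)
qed (use assms in auto)

lemma sum_rounds_le: "sum rounds S \<le> 8 * k"
proof -
  have "sum rounds S \<le> of_nat (card S) * 8" by (rule sum_bounded_above) (simp add: rounds_def)
  then show ?thesis using k(1) by simp
qed

lemma rounds_c: "rounds (c i) = 4"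
proof -
  have "weakly_central (c i)"
    unfolding weakly_central_def using k(2) by (intro bexI[of _ 1]) auto
  then show ?thesis by (simp add: rounds_def)
qed

lemma colour_map_id: "(\<And>u. u \<in> pm S \<Longrightarrow> \<phi> u = u) \<Longrightarrow> colour_map \<phi>"
  by (simp add: colour_map_def)

end

context extended_rigidity
begin

text \<open>The last conclusion, that no gadgets of other kinds are added, matters as much as the
  existence: common neighbours are summed over the whole family.\<close>

lemma exists_hubs:
  fixes E :: "'g set" and P :: "'g \<Rightarrow> 'g set \<Rightarrow> bool"
  assumes Zs: "good S' V Zs" and R: "finite R" "R \<subseteq> pm S" and E: "finite E"
    and step: "\<And>e Ys. e \<in> E \<Longrightarrow> good S' V Ys \<Longrightarrow> card (total S' Ys) \<le> 8 * k \<Longrightarrow>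
      \<exists>X. fresh S' V (total S' Ys) X \<and> card X \<le> 3 \<and> P e X"
    and bound: "card (total S' Zs) + 3 * (card R + card E) \<le> 8 * k + 3"
  obtains Ys where "good S' V (Ys @ Zs)"
    "card (total S' (Ys @ Zs)) \<le> card (total S' Zs) + 3 * (card R + card E)"
    "\<And>u. u \<in> R \<Longrightarrow> \<exists>X\<in>set Ys. plain u X" "\<And>e. e \<in> E \<Longrightarrow> \<exists>X\<in>set Ys. P e X"
    "\<And>X. X \<in> set Ys \<Longrightarrow> (\<exists>u\<in>R. plain u X) \<or> (\<exists>e\<in>E. P e X)"
proof -
  obtain us where us: "set us = R" "distinct us" using finite_distinct_list[OF R(1)] by blast
  obtain es where es: "set es = E" "distinct es" using finite_distinct_list[OF E] by blast
  have len: "length us = card R" "length es = card E"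
    using us es distinct_card by fastforce+
  let ?Ps = "map plain us @ map P es"
  have st: "\<exists>X. fresh S' V (total S' Ys) X \<and> card X \<le> 3 \<and> Q X"
    if "Q \<in> set ?Ps" "good S' V Ys" "card (total S' Ys) \<le> 8 * k" for Q Ys
  proof -
    from that(1) consider u where "u \<in> R" "Q = plain u" | e where "e \<in> E" "Q = P e"
      using us es by auto
    then show ?thesis
    proof cases
      case 1
      then have "u \<in> pm S" using R by auto
      from plain_hub_step[OF that(2,3) this] show ?thesis unfolding 1 plain_def .
    next
      case 2
      then show ?thesis using step[OF 2(1) that(2,3)] by simp
    qed
  qed
  have "\<exists>Ys. good S' V (Ys @ Zs) \<and> list_all2 (\<lambda>P X. P X) ?Ps Ys \<and>
    card (total S' (Ys @ Zs)) \<le> card (total S' Zs) + 3 * length ?Ps"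
    by (rule extend_family[OF fin' Zs st]) (use bound len in simp_all)
  then obtain Ys where Ys: "good S' V (Ys @ Zs)" "list_all2 (\<lambda>P X. P X) ?Ps Ys"
    "card (total S' (Ys @ Zs)) \<le> card (total S' Zs) + 3 * length ?Ps" by blast
  have fwd: "\<exists>X\<in>set Xs. Q X" if "list_all2 (\<lambda>P X. P X) Ps Xs" "Q \<in> set Ps" for Ps Q and Xs :: "'g set list"
    using that by (induction rule: list_all2_induct) auto
  have bwd: "\<exists>Q\<in>set Ps. Q X" if "list_all2 (\<lambda>P X. P X) Ps Xs" "X \<in> set Xs" for Ps X and Xs :: "'g set list"
    using that by (induction rule: list_all2_induct) auto
  note fwd = fwd[OF Ys(2)] and bwd = bwd[OF Ys(2)]
  show ?thesis
  proof (rule that[OF Ys(1)])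
    show "card (total S' (Ys @ Zs)) \<le> card (total S' Zs) + 3 * (card R + card E)"
      using Ys(3) len by simp
    show "\<exists>X\<in>set Ys. plain u X" if "u \<in> R" for u
      by (rule fwd) (use that us in simp)
    show "\<exists>X\<in>set Ys. P e X" if "e \<in> E" for e
      by (rule fwd) (use that es in simp)
    show "(\<exists>u\<in>R. plain u X) \<or> (\<exists>e\<in>E. P e X)" if "X \<in> set Ys" for X
      using bwd[OF that] unfolding set_append set_map us(1) es(1) by blast
  qed
qed

lemma nice_specs:
  "plain u X \<Longrightarrow> nice X" "hub_spec i z w u X \<Longrightarrow> nice X" "tie_spec w u X \<Longrightarrow> nice X"
  by (auto simp: plain_def hub_spec_def tie_spec_def)

lemma plain_links:
  assumes "plain u X"
  shows "link X u \<noteq> {}" "link X (- u) \<noteq> {}" "link X y \<noteq> {}"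
proof -
  have "0 < row X u y" by (rule plain_row_pos[OF assms])
  then have "link X u \<inter> link X y \<noteq> {}" by (simp add: card_gt_0_iff)
  then show u: "link X u \<noteq> {}" "link X y \<noteq> {}" by blast+
  from u(1) obtain v where "v \<in> link X u" by blast
  then have "- u + v \<in> link X (- u)" by (auto simp: link_def)
  then show "link X (- u) \<noteq> {}" by blast
qed

lemma y_cases:
  assumes "separated_automorphism S' V Xs \<phi>"
  shows "\<phi> y = y \<or> \<phi> y = - y"
proof -
  interpret separated_automorphism S' V Xs \<phi> by fact
  show ?thesis by (rule map_pm[OF y_pm(1)])
qed

text \<open>Involutions are fixed in any case and the value at a negative is determined, so one
  representative per generator is enough.\<close>

lemma colour_map_fixed:
  assumes "separated_automorphism S' V Xs \<phi>" and R: "orientation R"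
    and fixed: "\<And>u. u \<in> R \<Longrightarrow> u + u \<noteq> 0 \<Longrightarrow> \<phi> u = u"
  shows "colour_map \<phi>"
proof (rule colour_map_id)
  interpret separated_automorphism S' V Xs \<phi> by fact
  fix u assume u: "u \<in> pm S"
  show "\<phi> u = u"
  proof (cases "u + u = 0")
    case True
    then have "- u = u" by (rule minus_unique)
    then show ?thesis using map_pm[OF pm_S'[OF u]] by metis
  next
    case False
    have neg: "- u + - u = - (u + u)" by (simp only: minus_add)
    have "u \<in> S \<or> - u \<in> S" using u by (simp only: in_pm)
    then have "u \<in> R \<or> - u \<in> R"
    proof
      assume "- u \<in> S"
      then have "- u \<in> R \<or> - (- u) \<in> R" using R unfolding orientation_def by blast
      then show ?thesis by auto
    qed (use R[unfolded orientation_def] in blast)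
    then show ?thesis
    proof
      assume "- u \<in> R"
      then have "\<phi> (- u) = - u" by (rule fixed) (simp only: neg, simp add: False)
      then show ?thesis using map_uminus[OF pm_S'[OF u]] by simp
    qed (use fixed False in blast)
  qed
qed

end

section \<open>No inverted generators\<close>

context rigidity
begin

text \<open>Negating everything replaces the colour \<open>- g + h\<close> by \<open>g - h\<close>.
  This is its negative if \<open>g\<close> and \<open>h\<close> commute, and the same colour if both
  are their own negatives.\<close>

lemma colour_map_uminus:
  assumes "\<And>u. u \<in> pm S \<Longrightarrow> \<phi> u = - u"
    and comm: "\<And>w g. w \<in> S \<Longrightarrow> g \<in> S \<Longrightarrow> g + g \<noteq> 0 \<Longrightarrow> w + g = g + w"
  shows "colour_map \<phi>"
  unfolding colour_map_def
proof (intro conjI ballI impI)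
  show "\<phi> g = g \<or> \<phi> g = - g" if "g \<in> pm S" for g using assms(1)[OF that] by simp
  fix g h assume gh: "g \<in> pm S" "h \<in> pm S"
  obtain g' where g': "g' \<in> S" "g = g' \<or> g = - g'"
    using gh(1) unfolding in_pm by (metis minus_minus)
  obtain h' where h': "h' \<in> S" "h = h' \<or> h = - h'"
    using gh(2) unfolding in_pm by (metis minus_minus)
  have eq: "- \<phi> g + \<phi> h = g + - h" using assms(1)[OF gh(1)] assms(1)[OF gh(2)] by simp
  show "- \<phi> g + \<phi> h = - g + h \<or> - \<phi> g + \<phi> h = - (- g + h)"
  proof (cases "g' + g' = 0 \<and> h' + h' = 0")
    case True
    then have "- g' = g'" "- h' = h'" by (simp_all add: minus_unique)
    then have "- g = g" "- h = h" using g'(2) h'(2) by auto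
    then show ?thesis unfolding eq by (simp del: add_uminus_conv_diff)
  next
    case False
    then have "g' + h' = h' + g'" using comm[OF g'(1) h'(1)] comm[OF h'(1) g'(1)] by auto
    then have "g + - h = - h + g" by (rule commute_pm) (use g'(2) h'(2) in auto)
    then show ?thesis unfolding eq by (simp add: minus_add)
  qed
qed

text \<open>For a single generator the estimate \<open>8 * k\<close> would give a total of 31 in the
  plain case, where only 30 is allowed. The generator then commutes with \<open>c 1\<close>, so four
  increments suffice.\<close>

lemma sum_rounds_1:
  assumes "k = 1"
  shows "sum rounds S = 4 * k"
proof -
  have "rounds s = 4" if "s \<in> S" for s
  proof -
    have "weakly_central s"
      unfolding weakly_central_def using single[OF assms that] k(2) by (intro bexI[of _ 1]) auto
    then show ?thesis by (simp add: rounds_def)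
  qed
  then have "sum rounds S = sum (\<lambda>_. 4) S" by (rule sum.cong[OF refl])
  then show ?thesis using k(1) by simp
qed

lemma sum_rounds_4:
  assumes "\<And>s. s \<in> S \<Longrightarrow> weakly_central s \<or> inverted s"
  shows "sum rounds S = 4 * k"
proof -
  have "sum rounds S = sum (\<lambda>_. 4) S" by (rule sum.cong[OF refl]) (use assms in \<open>auto simp: rounds_def\<close>)
  then show ?thesis using k(1) by simp
qed

lemma central_not_inverted: "central s \<Longrightarrow> \<not> inverted s"
  using not_central_inverted by blast

end

context extended_rigidity
begin

lemma y_not_S: "y \<notin> S" "- y \<notin> S" "y \<noteq> 0" "y + y \<noteq> 0" "- y \<noteq> y"
proof -
  have w: "x \<in> words S" if "x \<in> pm0 S" for x using that by (rule wordsI1)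
  show "y \<notin> S" "- y \<notin> S"
    using y(2) w[of y] by (auto simp: pm0_def in_pm)
  show "y \<noteq> 0" using y(2) w[of 0] by auto
  show yy: "y + y \<noteq> 0" using y(3) w[of 0] by auto
  show "- y \<noteq> y" using yy eq_neg_iff_add_eq_0[of y y] by metis
qed

lemma orientation_S: "orientation S"
  unfolding orientation_def using reduced by (auto intro: subsetD[OF subset_pm])

text \<open>The hub of \<open>g\<close> with shift \<open>w\<close> may also count the pair of
  \<kappa> and \<open>y\<close>, where \<kappa> is \<open>w - g + w\<close>. A representative
  \<open>u\<close> with \<open>- u\<close> equal to \<kappa> would spoil the comparison of
  \<open>- u\<close> with \<open>u\<close>, so such a generator is replaced by its negative.\<close>

lemma exists_orientation:
  assumes g: "g \<in> S"
  obtains R where "orientation R" "g \<in> R" "finite R" "card R \<le> k"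
    "\<And>u. u \<in> R \<Longrightarrow> - u = \<kappa> \<Longrightarrow> u = g \<or> - u = u"
proof -
  define r where "r s = (if s \<noteq> g \<and> s = - \<kappa> then - s else s)" for s
  have r: "r s = s \<or> r s = - s" for s by (simp add: r_def)
  show ?thesis
  proof (rule that[of "r ` S"])
    show "finite (r ` S)" using fin by simp
    show "card (r ` S) \<le> k" using card_image_le[OF fin] k(1) by simp
    show "g \<in> r ` S" using g by (intro image_eqI[of _ _ g]) (simp add: r_def)
    show "u = g \<or> - u = u" if "u \<in> r ` S" "- u = \<kappa>" for u
    proof -
      from that(1) obtain s where s: "s \<in> S" "u = r s" by blast
      show ?thesis
      proof (cases "s \<noteq> g \<and> s = - \<kappa>")
        case True
        have "r s = - s" unfolding r_def using True by (rule if_P)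
        then have "u = \<kappa>" using s(2) True by simp
        then show ?thesis using that(2) by simp
      next
        case False
        have "r s = s" unfolding r_def using False by (rule if_not_P)
        then have "u = s" using s(2) by simp
        then show ?thesis using that(2) False by auto
      qed
    qed
    show "orientation (r ` S)"
      unfolding orientation_def
    proof (intro conjI ballI impI)
      show "r ` S \<subseteq> pm S"
      proof
        fix u assume "u \<in> r ` S"
        then obtain s where "s \<in> S" "u = r s" by blast
        then show "u \<in> pm S" using r[of s] by (auto simp: in_pm)
      qed
      show "s \<in> r ` S \<or> - s \<in> r ` S" if "s \<in> S" for s
      proof -
        have "r s \<in> r ` S" using that by (rule imageI)
        then show ?thesis using r[of s] by auto
      qed
      fix u assume u: "u \<in> r ` S" "- u \<in> r ` S"
      then obtain s t where st: "s \<in> S" "u = r s" "t \<in> S" "- u = r t" by blast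
      have "t = s \<or> t = - s" using st r[of s] r[of t] by (metis minus_minus)
      then have "t = s" using reduced[OF st(1)] st(3) by auto
      then show "- u = u" using st by simp
    qed
  qed
qed

lemma rounds_y: "rounds y = 4"
  unfolding y(1) by (rule rounds_c)

end

text \<open>One hub per generator. If \<open>y\<close> keeps its sign, all generators do; if it is negated, then all
  generators are central and negated, which preserves colours if they commute.\<close>

theorem (in rigidity) plain_case:
  assumes J: "\<And>s. s \<in> S \<Longrightarrow> s + s \<noteq> 0 \<Longrightarrow> \<not> inverted s"
    and comm: "(\<exists>s\<in>S. \<not> central s) \<or> (\<forall>w\<in>S. \<forall>g\<in>S. g + g \<noteq> 0 \<longrightarrow> w + g = g + w)"
  shows "\<exists>T. rigid T"
proof -
  have "\<exists>b. int 1 dvd b \<and> c b \<notin> words S \<and> c b + c b \<notin> words S"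
    by (rule choose_y) (use k(2) in simp)
  then obtain b where b: "c b \<notin> words S" "c b + c b \<notin> words S" by blast
  define y where "y = c b"
  interpret E: extended_rigidity c N S H k "insert y S" "{}" y b
    by (rule extended_insert_y) (use b y_def in auto)
  have cS': "card (insert y S) = k + 1" using E.y_not_S(1) fin k(1) by simp
  have RpS: "S \<subseteq> pm S" by (rule subset_pm)
  obtain Ys where Ys: "good (insert y S) {} (Ys @ [])"
    "card (total (insert y S) (Ys @ [])) \<le> card (total (insert y S) []) + 3 * (card S + card ({} :: 'g set))"
    "\<And>u. u \<in> S \<Longrightarrow> \<exists>X\<in>set Ys. E.plain u X"
    "\<And>X. X \<in> set Ys \<Longrightarrow> (\<exists>u\<in>S. E.plain u X) \<or> (\<exists>e\<in>{} :: 'g set. False)"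
    by (rule E.exists_hubs[of "[]" S "{} :: 'g set" "\<lambda>_ _. False"])
      (use fin RpS cS' k in \<open>auto intro: good_Nil\<close>)
  have plain: "\<exists>u\<in>S. E.plain u X" if "X \<in> set Ys" for X using Ys(4)[OF that] by simp
  show ?thesis
  proof (rule E.exists_rigid[OF Ys(1)])
    show "nice X" if X: "X \<in> set (Ys @ [])" for X
      using plain[of X] X E.nice_specs(1) by auto
    show "\<exists>X\<in>set (Ys @ []). link X s \<noteq> {}" if "s \<in> insert y S" for s
    proof -
      obtain s0 where "s0 \<in> S" using k card_eq_0_iff[of S] by auto
      then obtain u where u: "u \<in> S" "s = u \<or> s = y" using \<open>s \<in> insert y S\<close> by auto
      from Ys(3)[OF u(1)] obtain X where X: "X \<in> set Ys" "E.plain u X" by blast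
      then show ?thesis using E.plain_links[OF X(2)] u(2) by auto
    qed
    have sum: "sum rounds (insert y S) = 4 + sum rounds S"
      using E.y_not_S(1) fin E.rounds_y by simp
    have "card (total (insert y S) (Ys @ [])) \<le> 4 * k + 1" using Ys(2) cS' k(1) by simp
    moreover have "4 * k + 1 + 2 * (4 + sum rounds S) + (k + 1) * k \<le> 2 * k ^ 2 + 28 * k"
    proof (cases "k = 1")
      case True
      then show ?thesis using sum_rounds_1 by simp
    next
      case False
      then have "2 * k \<le> k * k" using k(2) by (intro mult_right_mono) auto
      then show ?thesis using sum_rounds_le False k(2) by (simp add: power2_eq_square)
    qed
    ultimately show "card (total (insert y S) (Ys @ [])) + 2 * sum rounds (insert y S) +
        card (insert y S) * (card (insert y S) - 1) \<le> 2 * k ^ 2 + 28 * k"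
      unfolding sum cS' by simp
    fix Is \<phi>
    assume Is: "\<And>X. X \<in> set Is \<Longrightarrow> \<exists>s\<in>insert y S. E.increment_spec s X"
      and \<phi>: "separated_automorphism (insert y S) {} (Is @ Ys @ []) \<phi>"
    have Xs: "E.neutral X \<or> (\<exists>v\<in>S. E.plain v X)" if "X \<in> set (Is @ Ys @ [])" for X
      using that Is[of X] plain[of X] E.increment_neutral by auto
    note oS = E.orientation_S
    have gad: "\<exists>X\<in>set (Is @ Ys @ []). E.plain u X" if "u \<in> S" for u
      using Ys(3)[OF that] by auto
    show "colour_map \<phi>"
    proof (cases "\<phi> y = y")
      case True
      show ?thesis
      proof (rule E.colour_map_fixed[OF \<phi> oS])
        fix u assume u: "u \<in> S" "u + u \<noteq> 0"
        from gad[OF u(1)] obtain X0 where X0: "X0 \<in> set (Is @ Ys @ [])" "E.plain u X0" by blast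
        show "\<phi> u = u"
          by (rule E.fixed_y_fixes[OF \<phi> oS u(1) X0 u(2) J[OF u] True]) (use Xs in blast)
      qed
    next
      case False
      then have flip: "\<phi> y = - y" using E.y_cases[OF \<phi>] by blast
      have "central s" if s: "s \<in> S" for s
      proof (rule ccontr)
        assume "\<not> central s"
        from gad[OF s] obtain X0 where X0: "X0 \<in> set (Is @ Ys @ [])" "E.plain s X0" by blast
        have "\<phi> y = y"
          by (rule E.y_not_flipped[OF \<phi> oS s X0 \<open>\<not> central s\<close>]) (use Xs in blast)
        then show False using False by blast
      qed
      then have comm: "w + g = g + w" if "w \<in> S" "g \<in> S" "g + g \<noteq> 0" for w g
        using comm that by blast
      have neg: "\<phi> s = - s" if s: "s \<in> S" for s
      proof (cases "s + s = 0")
        case True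
        interpret separated_automorphism "insert y S" "{}" "Is @ Ys @ []" \<phi> by (rule \<phi>)
        have "- s = s" using True by (rule minus_unique)
        moreover have "s \<in> pm (insert y S)" using s by (simp add: in_pm)
        ultimately show ?thesis using map_pm by metis
      next
        case nz: False
        from gad[OF s] obtain X0 where X0: "X0 \<in> set (Is @ Ys @ [])" "E.plain s X0" by blast
        show ?thesis
          by (rule E.flipped_y_flips[OF \<phi> oS s X0 nz flip]) (use Xs in blast)
      qed
      show ?thesis
      proof (rule colour_map_uminus[OF _ comm])
        interpret separated_automorphism "insert y S" "{}" "Is @ Ys @ []" \<phi> by (rule \<phi>)
        fix u assume u: "u \<in> pm S"
        then consider "u \<in> S" | "- u \<in> S" by (auto simp: in_pm)
        then show "\<phi> u = - u"
        proof cases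
          case 2
          then have "\<phi> (- u) = u" using neg by fastforce
          then show ?thesis using map_uminus[OF E.pm_S'[OF u]] by (metis minus_minus)
        qed (rule neg)
      qed
    qed
  qed
qed

text \<open>A hub of \<open>g\<close> with shift \<open>w\<close> prevents that \<open>y\<close> and all generators are negated.\<close>

theorem (in rigidity) noncommuting_case:
  assumes cent: "\<And>s. s \<in> S \<Longrightarrow> central s"
    and wg: "w \<in> S" "g \<in> S" "g + g \<noteq> 0" "w + g \<noteq> g + w"
  shows "\<exists>T. rigid T"
proof -
  have k2: "2 \<le> k"
  proof -
    have "w \<noteq> g" using wg(4) by auto
    moreover have "card {w, g} \<le> card S" by (rule card_mono[OF fin]) (use wg in auto)
    ultimately show ?thesis using k(1) by simp
  qed
  \<comment> \<open>\<open>y\<close> will be a power whose exponent is a multiple of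
    \<open>e\<close>; this makes \<open>w\<close> and \<open>y\<close> commute, as the special hub
    requires.\<close>
  obtain e where e: "e \<in> {1..bound ^ 2}" "commutes (int e) w"
    using central_weakly[OF cent[OF wg(1)]] unfolding weakly_central_def by blast
  obtain b where b: "int e dvd b" "c b \<notin> words S" "c b + c b \<notin> words S"
    using choose_y[OF e(1)] by blast
  define y where "y = c b"
  interpret E: extended_rigidity c N S H k "insert y S" "{}" y b
    by (rule extended_insert_y) (use b y_def in auto)
  have "commutes b w" by (rule commutes_dvd[OF e(2) b(1)])
  then have wy: "w + y = y + w" by (simp add: slides_def y_def)
  have cS': "card (insert y S) = k + 1" using E.y_not_S(1) fin k(1) by simp
  have pm: "w \<in> pm S" "g \<in> pm S" using wg by (auto simp: in_pm)
  obtain X0 i z where X0: "fresh (insert y S) {} (insert y S) X0" "card X0 \<le> 3"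
    "E.hub_spec i z w g X0"
    using E.special_hub_step[OF pm(2,1) e wy _ k2] cS' cent[OF wg(2)] by auto
  have good: "good (insert y S) {} [X0]"
    using good_Cons[OF good_Nil, of "insert y S" "{}" X0] X0(1) by simp
  have tot: "card (total (insert y S) [X0]) \<le> k + 4"
    using card_Un_le[of X0 "insert y S"] X0(2) cS' by (simp add: total_Cons)
  define \<kappa> where "\<kappa> = w + (- g + w)"
  obtain R where R: "E.orientation R" "g \<in> R" "finite R" "card R \<le> k"
    and \<kappa>: "\<And>u. u \<in> R \<Longrightarrow> - u = \<kappa> \<Longrightarrow> u = g \<or> - u = u"
    by (rule E.exists_orientation[OF wg(2), of \<kappa>]) (rule that; assumption)
  have RpS: "R \<subseteq> pm S" using R(1) unfolding E.orientation_def by blast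
  obtain Ys where Ys: "good (insert y S) {} (Ys @ [X0])"
    "card (total (insert y S) (Ys @ [X0])) \<le>
      card (total (insert y S) [X0]) + 3 * (card R + card ({} :: 'g set))"
    "\<And>u. u \<in> R \<Longrightarrow> \<exists>X\<in>set Ys. E.plain u X"
    "\<And>X. X \<in> set Ys \<Longrightarrow> (\<exists>u\<in>R. E.plain u X) \<or> (\<exists>e\<in>{} :: 'g set. False)"
    by (rule E.exists_hubs[OF good R(3) RpS, of "{} :: 'g set" "\<lambda>_ _. False"])
      (use tot R(4) k2 in auto)
  have plain: "\<exists>u\<in>R. E.plain u X" if "X \<in> set Ys" for X using Ys(4)[OF that] by simp
  have cent_R: "central u" if "u \<in> R" for u
  proof -
    have "u \<in> S \<or> - u \<in> S" using that RpS by (auto simp: in_pm)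
    then show ?thesis using cent[of u] cent[of "- u"] by auto
  qed
  show ?thesis
  proof (rule E.exists_rigid[OF Ys(1)])
    show "nice X" if X: "X \<in> set (Ys @ [X0])" for X
      using plain[of X] X E.nice_specs(1) E.nice_specs(2)[OF X0(3)] by auto
    show "\<exists>X\<in>set (Ys @ [X0]). link X s \<noteq> {}" if "s \<in> insert y S" for s
    proof -
      have "\<exists>u\<in>R. s = u \<or> s = - u \<or> s = y"
      proof (cases "s = y")
        case False
        then have "s \<in> R \<or> - s \<in> R" using that R(1) unfolding E.orientation_def by blast
        then show ?thesis by (metis minus_minus)
      qed (use R(2) in blast)
      then obtain u where u: "u \<in> R" "s = u \<or> s = - u \<or> s = y" by blast
      from Ys(3)[OF u(1)] obtain X where X: "X \<in> set Ys" "E.plain u X" by blast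
      then show ?thesis using E.plain_links[OF X(2)] u(2) by auto
    qed
    have sum: "sum rounds (insert y S) = 4 + 4 * k"
      using E.y_not_S(1) fin E.rounds_y sum_rounds_4 cent central_weakly by simp
    have "card (total (insert y S) (Ys @ [X0])) \<le> 4 * k + 4" using Ys(2) tot R(4) by simp
    moreover have "4 * k + 4 + 2 * (4 + 4 * k) + (k + 1) * k \<le> 2 * k ^ 2 + 28 * k"
      using k2 by (simp add: power2_eq_square)
    ultimately show "card (total (insert y S) (Ys @ [X0])) + 2 * sum rounds (insert y S) +
        card (insert y S) * (card (insert y S) - 1) \<le> 2 * k ^ 2 + 28 * k"
      unfolding sum cS' by simp
    fix Is \<phi>
    assume Is: "\<And>X. X \<in> set Is \<Longrightarrow> \<exists>s\<in>insert y S. E.increment_spec s X"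
      and \<phi>: "separated_automorphism (insert y S) {} (Is @ Ys @ [X0]) \<phi>"
    have Xs: "E.neutral X \<or> (\<exists>v\<in>R. E.plain v X) \<or> X = X0" if "X \<in> set (Is @ Ys @ [X0])" for X
      using that Is[of X] plain[of X] E.increment_neutral by auto
    have gad: "\<exists>X\<in>set (Is @ Ys @ [X0]). E.plain u X" if "u \<in> R" for u
      using Ys(3)[OF that] by auto
    have rows: "E.row X0 u y \<le> (if u = g \<or> i \<and> u = \<kappa> then 1 else 0)"
      "E.row X0 u (- y) \<le> (if z \<and> u = - w + (- g + w) then 1 else 0)" "0 < E.row X0 g y"
      if "u \<in> pm S" for u
      using X0(3) that unfolding E.hub_spec_def \<kappa>_def by blast+
    have pos: "0 < E.row X0 g y" by (rule rows(3)[OF pm(2)])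
    have y: "\<phi> y = y"
    proof -
      interpret separated_automorphism "insert y S" "{}" "Is @ Ys @ [X0]" \<phi> by (rule \<phi>)
      \<comment> \<open>The only element that the special hub may count with \<open>- y\<close> is
        \<open>- w - g + w\<close>, which differs from \<open>- g\<close> since \<open>w\<close> and
        \<open>g\<close> do not commute. So this hub tells the pair \<open>g\<close>,
        \<open>y\<close> from the pair \<open>- g\<close>, \<open>- y\<close>, which a plain hub of
        a central element need not do.\<close>
      have "- g \<noteq> - w + (- g + w)"
      proof
        assume "- g = - w + (- g + w)"
        then have "w + - g = w + (- w + (- g + w))" by (rule arg_cong)
        then have "w + - g = - g + w" by (simp del: add_uminus_conv_diff)
        from commute_pm[OF this, of w g] show False using wg(4) by simp
      qed
      then have r0: "E.row X0 (- g) (- y) = 0"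
        using rows(2)[of "- g"] pm(2) by simp
      have r1: "E.row X0 g (- y) \<le> E.row X0 g y"
        using rows(2)[OF pm(2)] pos by (auto split: if_splits)
      obtain X1 where X1: "X1 \<in> set (Is @ Ys @ [X0])" "E.plain g X1" using gad[OF R(2)] by blast
      have le: "E.row X g (- y) \<le> E.row X g y \<and> E.row X (- g) (- y) \<le> E.row X g y"
        if "X \<in> set (Is @ Ys @ [X0])" for X
        using Xs[OF that] E.plain_rows(3,4)[OF R(1,2) _ _ wg(3), of _ X] r0 r1
          E.neutral_rows[of X g] E.neutral_rows[of X "- g"] pm(2) by auto
      show ?thesis
      proof (rule map_not_flipped[OF E.pm_S'[OF pm(2)] E.y_pm(1)])
        show "common_count (Is @ Ys @ [X0]) g (- y) < common_count (Is @ Ys @ [X0]) g y"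
        proof (rule common_count_less[OF _ X1(1)])
          show "E.row X1 g (- y) < E.row X1 g y"
            using E.plain_rows(3)[OF R(1,2,2) X1(2) wg(3)] E.plain_row_pos[OF X1(2)] by simp
        qed (rule conjunct1[OF le])
        show "common_count (Is @ Ys @ [X0]) (- g) (- y) < common_count (Is @ Ys @ [X0]) g y"
        proof (rule common_count_less[of _ _ _ _ _ X0])
          show "E.row X0 (- g) (- y) < E.row X0 g y" using r0 pos by simp
        qed (use le in simp_all)
      qed
    qed
    show "colour_map \<phi>"
    proof (rule E.colour_map_fixed[OF \<phi> R(1)])
      fix u assume u: "u \<in> R" "u + u \<noteq> 0"
      from gad[OF u(1)] obtain X1 where X1: "X1 \<in> set (Is @ Ys @ [X0])" "E.plain u X1" by blast
      have nu: "- u \<noteq> u" using u(2) eq_neg_iff_add_eq_0[of u u] by metis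
      have "- u \<in> pm S" using RpS u(1) by auto
      have "- u \<noteq> g"
      proof
        assume ug: "- u = g"
        have "- u = u" using R(1) u(1) R(2)[folded ug] unfolding E.orientation_def by blast
        then show False using nu by blast
      qed
      then have le: "E.row X0 (- u) y \<le> E.row X0 u y"
        using rows(1)[OF \<open>- u \<in> pm S\<close>] \<kappa>[OF u(1)] nu pos by (cases "- u = \<kappa>") (auto split: if_splits)
      show "\<phi> u = u"
        by (rule E.fixed_y_fixes[OF \<phi> R(1) u(1) X1 u(2) central_not_inverted[OF cent_R[OF u(1)]] y])
          (use Xs le in blast)
    qed
  qed
qed

section \<open>A generator that is neither central nor inverted\<close>

context rigidity
begin

text \<open>The last two hypotheses describe what an increment or a plain hub at \<open>t\<close>
  can touch. Doubles of weakly inverted elements are weakly central, so \<open>a\<close> and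
  \<open>b\<close> would both be \<open>t\<close> up to sign, and \<open>a\<close> would be
  inverted.\<close>

lemma pair_clash:
  assumes a: "\<not> weakly_central a" "\<not> inverted a" and b: "inverted b"
    and at: "a = t \<or> a = - t \<or> weakly_inverted t \<and> (a = t + t \<or> a = - (t + t))"
    and bt: "b = t \<or> b = - t \<or> weakly_inverted t \<and> (b = t + t \<or> b = - (t + t))"
  shows False
proof -
  have wc: "weakly_central x" if "weakly_inverted t" "x = t + t \<or> x = - (t + t)" for x
    using that weakly_inverted_double[OF that(1)] by (elim disjE) (simp_all only: weakly_central_uminus)
  have "\<not> weakly_central b" using b not_weakly_central_inverted inverted_weakly by blast
  then have bt': "b = t \<or> b = - t" using bt wc by blast
  have at': "a = t \<or> a = - t" using at wc a(1) by blast
  have "inverted t" using bt' b by auto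
  then have "inverted a" using at' by auto
  then show False using a(2) by blast
qed

abbreviation flippable :: "'g set" where
  "flippable \<equiv> {s \<in> S. inverted s \<and> s + s \<noteq> 0}"

end

context extended_rigidity
begin

lemma plain_links_sub:
  assumes "plain v X" "u \<in> pm S" "link X u \<noteq> {}"
  shows "u = v \<or> u = - v \<or> weakly_inverted v \<and> (u = v + v \<or> u = - (v + v))"
proof -
  obtain i z where iz: "i \<longrightarrow> inverted v" and h: "hub_spec i z 0 v X"
    using assms(1) unfolding plain_def by blast
  have "u = v \<or> u = - v \<or> i \<and> (u = v + v \<or> u = - (v + v))"
    using h assms(2,3) unfolding hub_spec_def by blast
  then show ?thesis using iz inverted_weakly by blast
qed

lemma increment_links_sub:
  assumes "increment_spec s X" "u \<in> pm S" "link X u \<noteq> {}"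
  shows "u = s \<or> u = - s \<or> weakly_inverted s \<and> (u = s + s \<or> u = - (s + s))"
  using assms pm_S' unfolding increment_spec_def by blast

lemma row_posD: "0 < row X u l \<Longrightarrow> link X u \<noteq> {} \<and> link X l \<noteq> {}"
  by (metis Int_empty_left Int_empty_right card.empty less_irrefl)

text \<open>Up to sign, a tie touches only words in the generators, and \<open>y\<close> is not
  one.\<close>

lemma tie_neutral:
  assumes "tie_spec w u X" "w \<in> pm S" "u \<in> pm S"
  shows "neutral X"
proof -
  have w: "x \<in> words S" if "x \<in> {w, u, w + w, - w + u, - u + (w + w)}" for x
  proof -
    have p: "w \<in> pm0 S" "u \<in> pm0 S" "- w \<in> pm0 S" "- u \<in> pm0 S" using assms(2,3) by (simp_all add: pm0I)
    show ?thesis using that wordsI1[OF p(1)] wordsI1[OF p(2)] wordsI2[OF p(1,1)] wordsI2[OF p(3,2)]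
        wordsI3[OF p(4,1,1)] by blast
  qed
  have "link X l = {}" if l: "l = y \<or> l = - y" for l
  proof (rule ccontr)
    assume ne: "link X l \<noteq> {}"
    have "l \<in> pm S'" using l y_pm by blast
    then have "l \<in> pm {w, u, w + w, - w + u, - u + (w + w)}"
      using assms(1) ne unfolding tie_spec_def by blast
    then have "l \<in> words S \<or> - l \<in> words S" unfolding in_pm using w by blast
    then show False using l y(2) by auto
  qed
  then show ?thesis by (simp add: neutral_def)
qed

end

text \<open>The sign of an inverted generator \<open>g\<close> is not determined by its hub, because \<open>g\<close> and \<open>- g\<close> share
  as many neighbours with \<open>y\<close>. It is recovered from \<open>w\<close>, which has no sign ambiguity: by a hub
  with shift \<open>w\<close>, or by a tie between \<open>w\<close> and \<open>g\<close>.\<close>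

theorem (in rigidity) shifted_case:
  assumes J: "flippable \<noteq> {}" and w0: "w \<in> S" "\<not> weakly_central w" "\<not> inverted w"
  shows "\<exists>T. rigid T"
proof -
  obtain g0 where g0: "g0 \<in> flippable" using J by blast
  have k2: "2 \<le> k"
  proof -
    have "w \<noteq> g0" using w0(3) g0 by blast
    moreover have "card {w, g0} \<le> card S" by (rule card_mono[OF fin]) (use w0 g0 in auto)
    ultimately show ?thesis using k(1) by simp
  qed
  have finJ: "finite flippable" "card flippable \<le> k"
    using fin k(1) card_mono[OF fin, of flippable] by auto
  have "\<exists>b. int 1 dvd b \<and> c b \<notin> words S \<and> c b + c b \<notin> words S"
    by (rule choose_y) (use k(2) in simp)
  then obtain b where b: "c b \<notin> words S" "c b + c b \<notin> words S" by blast
  define y where "y = c b"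
  \<comment> \<open>These are the forced colours that are not sums of two elements: the conjugate of
    \<open>y\<close> in shifted hubs and \<open>- g + (w + w)\<close> in ties.\<close>
  define V where "V = pm (insert (- w + (y + w)) ((\<lambda>g. - g + (w + w)) ` flippable))"
  have finV: "finite V" unfolding V_def using finJ(1) by (intro finite_pm) blast
  have cardV: "card V \<le> 4 * k"
  proof -
    have "card ((\<lambda>g. - g + (w + w)) ` flippable) \<le> k"
      using card_image_le[OF finJ(1), of "\<lambda>g. - g + (w + w)"] finJ(2) by (rule order_trans)
    then have "card (insert (- w + (y + w)) ((\<lambda>g. - g + (w + w)) ` flippable)) \<le> k + 1"
      using finJ(1) by (simp only: card_insert_if finite_imageI split: if_split) simp
    moreover have "card V \<le> 2 * card (insert (- w + (y + w)) ((\<lambda>g. - g + (w + w)) ` flippable))"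
      unfolding V_def by (rule card_pm_le) (use finJ(1) in simp)
    ultimately show ?thesis using k2 by linarith
  qed
  have symV: "- v \<in> V \<longleftrightarrow> v \<in> V" for v unfolding V_def by (rule pm_uminus)
  interpret E: extended_rigidity c N S H k "insert y S" V y b
    by (rule extended_insert_y) (fact y_def symV finV cardV b[folded y_def])+
  have wV: "- w + (y + w) \<in> V" "\<And>g. g \<in> flippable \<Longrightarrow> - g + (w + w) \<in> V"
    unfolding V_def by (rule subsetD[OF subset_pm]; blast)+
  have cS': "card (insert y S) = k + 1" using E.y_not_S(1) fin k(1) by simp
  have RpS: "S \<subseteq> pm S" by (rule subset_pm)
  have wpm: "w \<in> pm S" using w0(1) RpS by blast
  define P where "P g X \<longleftrightarrow> E.hub_spec False False w g X \<or>
    (E.tie_spec w g X \<and> (\<exists>D\<in>{1..bound ^ 2}. inverts (int D) w \<and> inverts (int D) g))" for g X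
  have step: "\<exists>X. fresh (insert y S) V (total (insert y S) Ys) X \<and> card X \<le> 3 \<and> P g X"
    if g: "g \<in> flippable" and Ys: "good (insert y S) V Ys" "card (total (insert y S) Ys) \<le> 8 * k" for g Ys
  proof -
    have gS: "g \<in> S" "inverted g" using g by auto
    have gpm: "g \<in> pm S" using gS(1) RpS by blast
    obtain f where f: "f \<in> {1..bound}" "inverts (int f) g" using gS(2) unfolding inverted_def by blast
    show ?thesis
    proof (cases "\<exists>l\<in>{1..bound}. inverts (int (f * l)) w")
      case True
      then obtain l where l: "l \<in> {1..bound}" "inverts (int (f * l)) w" by blast
      have D: "0 < f * l" "f * l \<le> bound ^ 2"
        using f(1) l(1) mult_le_mono[of f bound l bound] by (auto simp: power2_eq_square)
      have "inverts (int (f * l)) g" by (rule inverts_dvd[OF f(2)]) simp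
      moreover have "g \<noteq> w" "g \<noteq> - w" using gS(2) w0(3) by auto
      ultimately have "\<exists>X. fresh (insert y S) V (total (insert y S) Ys) X \<and> card X \<le> 3 \<and> E.tie_spec w g X"
        by (intro E.tie_step[OF Ys E.pm_S'[OF wpm] l(2) E.pm_S'[OF gpm] _ _ _ D wV(2)[OF g]])
      moreover have "f * l \<in> {1..bound ^ 2}" using D by simp
      ultimately show ?thesis
        using l(2) \<open>inverts (int (f * l)) g\<close> unfolding P_def by blast
    next
      case False
      have "\<exists>X. fresh (insert y S) V (total (insert y S) Ys) X \<and> card X \<le> 3 \<and> E.hub_spec False False w g X"
        by (rule E.shifted_hub_step[OF Ys gpm wpm w0(2) f _ wV(1)]) (use False in blast)
      then show ?thesis unfolding P_def by blast
    qed
  qed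
  obtain Ys where Ys: "good (insert y S) V (Ys @ [])"
    "card (total (insert y S) (Ys @ [])) \<le> card (total (insert y S) []) + 3 * (card S + card flippable)"
    "\<And>u. u \<in> S \<Longrightarrow> \<exists>X\<in>set Ys. E.plain u X" "\<And>g. g \<in> flippable \<Longrightarrow> \<exists>X\<in>set Ys. P g X"
    "\<And>X. X \<in> set Ys \<Longrightarrow> (\<exists>u\<in>S. E.plain u X) \<or> (\<exists>g\<in>flippable. P g X)"
    by (rule E.exists_hubs[OF good_Nil fin RpS finJ(1), where P = P])
      ((rule step; assumption), (use cS' k finJ(2) in simp), (rule that; assumption))
  show ?thesis
  proof (rule E.exists_rigid[OF Ys(1)])
    show "nice X" if X: "X \<in> set (Ys @ [])" for X
      using Ys(5)[of X] X E.nice_specs unfolding P_def by auto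
    show "\<exists>X\<in>set (Ys @ []). link X s \<noteq> {}" if "s \<in> insert y S" for s
    proof -
      obtain u where u: "u \<in> S" "s = u \<or> s = y" using \<open>s \<in> insert y S\<close> w0(1) by auto
      from Ys(3)[OF u(1)] obtain X where X: "X \<in> set Ys" "E.plain u X" by blast
      then show ?thesis using E.plain_links[OF X(2)] u(2) by auto
    qed
    have sum: "sum rounds (insert y S) = 4 + sum rounds S"
      using E.y_not_S(1) fin E.rounds_y by simp
    have "card (total (insert y S) (Ys @ [])) \<le> 7 * k + 1" using Ys(2) cS' k(1) finJ(2) by simp
    moreover have "7 * k + 1 + 2 * (4 + 8 * k) + (k + 1) * k \<le> 2 * k ^ 2 + 28 * k"
    proof -
      have "2 * k \<le> k ^ 2" "(k + 1) * k = k ^ 2 + k" using k2 by (simp_all add: power2_eq_square)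
      then show ?thesis unfolding \<open>(k + 1) * k = k ^ 2 + k\<close> using k2 by simp
    qed
    ultimately show "card (total (insert y S) (Ys @ [])) + 2 * sum rounds (insert y S) +
        card (insert y S) * (card (insert y S) - 1) \<le> 2 * k ^ 2 + 28 * k"
      unfolding sum cS' using sum_rounds_le by simp
    fix Is \<phi>
    assume Is: "\<And>X. X \<in> set Is \<Longrightarrow> \<exists>s\<in>insert y S. E.increment_spec s X"
      and \<phi>: "separated_automorphism (insert y S) V (Is @ Ys @ []) \<phi>"
    let ?Xs = "Is @ Ys @ []"
    interpret separated_automorphism "insert y S" V ?Xs \<phi> by (rule \<phi>)
    note oS = E.orientation_S
    have kinds: "(\<exists>s\<in>insert y S. E.increment_spec s X) \<or> (\<exists>v\<in>S. E.plain v X) \<or>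
        (\<exists>g\<in>flippable. E.hub_spec False False w g X) \<or>
        (\<exists>g\<in>flippable. E.tie_spec w g X \<and> (\<exists>D\<in>{1..bound ^ 2}. inverts (int D) w \<and> inverts (int D) g))"
      if "X \<in> set ?Xs" for X
    proof -
      from that have "X \<in> set Is \<or> X \<in> set Ys" by auto
      then show ?thesis
      proof
        assume "X \<in> set Is"
        then show ?thesis using Is by blast
      next
        assume "X \<in> set Ys"
        then show ?thesis using Ys(5)[of X] unfolding P_def by blast
      qed
    qed
    have Xs: "E.neutral X \<or> (\<exists>v\<in>S. E.plain v X) \<or> (\<exists>g\<in>flippable. E.hub_spec False False w g X)"
      if "X \<in> set ?Xs" for X
      using kinds[OF that] E.increment_neutral E.tie_neutral wpm RpS by blast
    have gad: "\<exists>X\<in>set ?Xs. E.plain u X" if "u \<in> S" for u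
      using Ys(3)[OF that] by auto
    have hub: "E.row X u y \<le> (if u = g then 1 else 0)" "E.row X u (- y) = 0" "0 < E.row X g y"
      if "E.hub_spec False False w g X" "u \<in> pm S" for g X u
      using that unfolding E.hub_spec_def by auto
    have y: "\<phi> y = y"
    proof -
      have g0': "g0 \<in> S" "\<not> central g0" using g0 not_central_inverted by auto
      from gad[OF g0'(1)] obtain X0 where X0: "X0 \<in> set ?Xs" "E.plain g0 X0" by blast
      have pm: "g0 \<in> pm S" "- g0 \<in> pm S" using g0'(1) by (auto simp: in_pm)
      show ?thesis
      proof (rule E.y_not_flipped[OF \<phi> oS g0'(1) X0 g0'(2)])
        fix X assume "X \<in> set ?Xs"
        from Xs[OF this] show "E.neutral X \<or> (\<exists>v\<in>S. E.plain v X) \<or>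
            E.row X g0 (- y) \<le> E.row X g0 y \<and> E.row X (- g0) (- y) \<le> E.row X g0 y"
          using hub(2)[OF _ pm(1)] hub(2)[OF _ pm(2)] by fastforce
      qed
    qed
    have hub_le: "E.row X (- u) y \<le> E.row X u y"
      if "E.hub_spec False False w g X" "g \<in> S" "u \<in> S" "u + u \<noteq> 0" for g X u
    proof -
      have "- u \<noteq> u" using that(4) eq_neg_iff_add_eq_0[of u u] by metis
      then have "- u \<noteq> g" using reduced[OF that(3)] that(2) by blast
      then show ?thesis using hub(1)[OF that(1), of "- u"] that(3) by (simp add: in_pm)
    qed
    have plain_le: "E.row X (- u) y \<le> E.row X u y" if "X \<in> set ?Xs" "u \<in> S" "u + u \<noteq> 0" for X u
    proof -
      have pm: "u \<in> pm S" "- u \<in> pm S" using that(2) by (auto simp: in_pm)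
      from Xs[OF that(1)] consider "E.neutral X" | v where "v \<in> S" "E.plain v X"
        | g where "g \<in> flippable" "E.hub_spec False False w g X" by blast
      then show ?thesis
      proof cases
        case 1
        then show ?thesis using E.neutral_rows[OF _ pm(2)] by simp
      next
        case 2
        show ?thesis by (rule E.plain_rows(5)[OF oS that(2) 2 that(3)])
      next
        case 3
        then show ?thesis using hub_le[OF 3(2) _ that(2,3)] by blast
      qed
    qed
    have fix1: "\<phi> u = u" if u: "u \<in> S" "u + u \<noteq> 0" "\<not> inverted u" for u
    proof -
      from gad[OF u(1)] obtain X0 where X0: "X0 \<in> set ?Xs" "E.plain u X0" by blast
      show ?thesis
        by (rule E.fixed_y_fixes[OF \<phi> oS u(1) X0 u(2,3) y]) (use plain_le u in blast)
    qed
    have fw: "\<phi> w = w"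
    proof (cases "w + w = 0")
      case True
      then have "- w = w" by (rule minus_unique)
      then show ?thesis using map_pm[OF E.pm_S'[OF wpm]] by metis
    qed (rule fix1[OF w0(1) _ w0(3)])
    show "colour_map \<phi>"
    proof (rule E.colour_map_fixed[OF \<phi> oS])
      fix g assume g: "g \<in> S" "g + g \<noteq> 0"
      show "\<phi> g = g"
      proof (cases "inverted g")
        case False
        then show ?thesis by (rule fix1[OF g])
      next
        case inv: True
        have pm: "g \<in> pm S" "- g \<in> pm S" using g(1) by (auto simp: in_pm)
        have ng: "- g \<noteq> g" using g(2) eq_neg_iff_add_eq_0[of g g] by metis
        have "g \<in> flippable" using g inv by blast
        from Ys(4)[OF this] obtain X1 where X1: "X1 \<in> set Ys" "P g X1" by blast
        then have X1Xs: "X1 \<in> set ?Xs" by simp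
        from X1(2) consider "E.hub_spec False False w g X1" | "E.tie_spec w g X1" unfolding P_def by blast
        then show ?thesis
        proof cases
          case 1
          have lt: "E.row X1 (- g) y < E.row X1 g y"
            using hub(1)[OF 1 pm(2)] hub(3)[OF 1 pm(1)] ng by simp
          have "common_count ?Xs (- g) y < common_count ?Xs g y"
            by (rule common_count_less[OF plain_le[OF _ g] X1Xs lt])
          then show ?thesis by (rule map_fixed[OF E.pm_S'[OF pm(1)] E.y_pm(1) y])
        next
          case 2
          \<comment> \<open>No gadget gives \<open>- g\<close> and \<open>w\<close> a common
            neighbour, whereas the tie gives one to \<open>g\<close> and \<open>w\<close>; as
            \<open>w\<close> is fixed, so is \<open>g\<close>.\<close>
          have le: "E.row X (- g) w = 0" if X: "X \<in> set ?Xs" for X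
          proof (rule ccontr)
            assume "E.row X (- g) w \<noteq> 0"
            then have pos: "0 < E.row X (- g) w" by simp
            note ne = E.row_posD[OF pos]
            have ginv: "inverted (- g)" using inv by simp
            have nw: "- g \<noteq> w" "- g \<noteq> - w" using inv ginv w0(3) by auto
            from kinds[OF X] consider s where "E.increment_spec s X"
              | v where "E.plain v X" | h where "h \<in> flippable" "E.hub_spec False False w h X"
              | h D where "h \<in> flippable" "E.tie_spec w h X" "D \<in> {1..bound ^ 2}"
                "inverts (int D) w" "inverts (int D) h" by blast
            then show False
            proof cases
              case 1
              show False
                by (rule pair_clash[OF w0(2,3) ginv E.increment_links_sub[OF 1 wpm] E.increment_links_sub[OF 1 pm(2)]])
                  (use ne in auto)
            next
              case 2
              show False
                by (rule pair_clash[OF w0(2,3) ginv E.plain_links_sub[OF 2 wpm] E.plain_links_sub[OF 2 pm(2)]])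
                  (use ne in auto)
            next
              case 3
              then have "w = h \<or> w = - h"
                using wpm ne unfolding E.hub_spec_def by blast
              then show False using 3(1) w0(3) by auto
            next
              case 4
              have "0 < E.row X w (- g)" using pos by (simp only: Int_commute)
              then have "- g \<in> {w, - w, h, w + w, - (w + w), - w + h}"
                using 4(2) E.pm_S'[OF pm(2)] unfolding E.tie_spec_def by blast
              moreover have "- g \<noteq> h" using reduced[OF g(1)] ng 4(1) by auto
              \<comment> \<open>The remaining candidates for \<open>- g\<close> are words of even
                length in \<open>w\<close> and \<open>h\<close>, which commute with
                \<open>c D\<close>; an inverted element cannot do so in this range.\<close>
              moreover have "\<not> commutes (int D) (- g)"
              proof
                assume com: "commutes (int D) (- g)"
                obtain f where f: "f \<in> {1..bound}" "inverts (int f) (- g)"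
                  using ginv unfolding inverted_def by blast
                show False
                  by (rule clash[OF com f(2), of 166464 2 408 1]) (use f(1) 4(3) in \<open>auto simp: bound_sq\<close>)
              qed
              moreover have "commutes (int D) (w + w)" "commutes (int D) (- (w + w))" "commutes (int D) (- w + h)"
                using commutes_add_inverts[OF 4(4,4)] commutes_add_inverts[of "int D" "- w" h] 4(4,5)
                by (simp_all only: commutes_uminus inverts_uminus)
              ultimately show False using nw unfolding insert_iff empty_iff by metis
            qed
          qed
          have r: "0 < E.row X1 g w"
            using 2 unfolding E.tie_spec_def by (simp only: Int_commute)
          then have lt: "E.row X1 (- g) w < E.row X1 g w" using le[OF X1Xs] by simp
          have "common_count ?Xs (- g) w < common_count ?Xs g w"
            by (rule common_count_less[OF _ X1Xs lt]) (simp add: le)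
          then show ?thesis by (rule map_fixed[OF E.pm_S'[OF pm(1)] E.pm_S'[OF wpm] fw])
        qed
      qed
    qed
  qed
qed

section \<open>Only central and inverted generators\<close>

context rigidity
begin

text \<open>A pair that prevents the map that negates the inverted elements and fixes the others from
  preserving colours, and that can be detected by a hub without involutions.\<close>

definition obstruction :: "'g \<Rightarrow> 'g \<Rightarrow> bool" where
  "obstruction g w \<longleftrightarrow> weakly_central w \<and> w + (g + w) \<noteq> g \<and>
    ((\<forall>s\<in>S. s + s \<noteq> 0) \<longrightarrow> (w + - g) + (w + - g) \<noteq> 0)"

lemma conj_double: "(a + b) + (a + b) = 0 \<Longrightarrow> (b + a) + (b + a) = (0 :: 'g)"
proof -
  assume "(a + b) + (a + b) = 0"
  then have "- a + ((a + b) + (a + b)) + a = - a + 0 + a" by simp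
  then show ?thesis by (simp add: add.assoc)
qed

lemma obstruction_uminus: "obstruction (- g) (- w) \<Longrightarrow> obstruction g w"
proof -
  assume o: "obstruction (- g) (- w)"
  have 1: "- w + (- g + - w) = - g" if "w + (g + w) = g"
  proof -
    have "- (w + (g + w)) = - g" using that by simp
    then show ?thesis by (simp only: minus_add add.assoc)
  qed
  have 2: "(- w + - (- g)) + (- w + - (- g)) = 0" if "(w + - g) + (w + - g) = 0"
  proof -
    have "(- g + w) + (- g + w) = 0" by (rule conj_double[OF that])
    then have "- ((- g + w) + (- g + w)) = 0" by simp
    then show ?thesis by (simp only: minus_add minus_minus)
  qed
  show ?thesis using o 1 2 unfolding obstruction_def weakly_central_uminus by blast
qed

lemma double_pm: "(\<forall>s\<in>S. s + s \<noteq> 0) \<Longrightarrow> h \<in> pm S \<Longrightarrow> h + h \<noteq> 0"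
proof
  assume a: "\<forall>s\<in>S. s + s \<noteq> 0" "h \<in> pm S" "h + h = 0"
  have "- h + - h = - (h + h)" by (simp only: minus_add)
  also have "\<dots> = 0" using a(3) by simp
  finally show False using a by (auto simp: in_pm simp del: add_uminus_conv_diff)
qed

text \<open>On an edge between an inverted \<open>g\<close> and a fixed \<open>h\<close>, the colour
  \<open>- g + h\<close> becomes \<open>g + h\<close>, which is its negative if
  \<open>h + g + h = g\<close>. If both ends are inverted, \<open>- h + g\<close> is weakly central
  and takes the role of \<open>w\<close>. If an obstruction is missing only because of its clause on
  involutions, an involution would lie in \<open>pm S\<close> although \<open>S\<close> has
  none.\<close>

lemma colour_map_flip:
  assumes all: "\<And>s. s \<in> S \<Longrightarrow> weakly_central s \<or> inverted s"
    and unobstructed: "\<And>g w. g \<in> flippable \<Longrightarrow> w \<in> pm S \<Longrightarrow> \<not> obstruction g w"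
    and flip: "\<And>u. u \<in> pm S \<Longrightarrow> inverted u \<Longrightarrow> \<phi> u = - u"
    and fixed: "\<And>u. u \<in> pm S \<Longrightarrow> \<not> inverted u \<Longrightarrow> \<phi> u = u"
  shows "colour_map \<phi>"
proof -
  have no: "\<not> obstruction g w" if g: "g \<in> pm S" "inverted g" "g + g \<noteq> 0" and w: "w \<in> pm S" for g w
  proof (cases "g \<in> S")
    case True
    then show ?thesis using unobstructed g w by blast
  next
    case False
    have "- g + - g = - (g + g)" by (simp only: minus_add)
    then have "- g \<in> flippable" using g False by (auto simp: in_pm simp del: add_uminus_conv_diff)
    moreover have "- w \<in> pm S" using w by simp
    ultimately have "\<not> obstruction (- g) (- w)" by (rule unobstructed)
    then show ?thesis using obstruction_uminus[of "- g" "- w"] by auto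
  qed
  have all_pm: "weakly_central s \<or> inverted s" if "s \<in> pm S" for s
    using that all[of s] all[of "- s"] by (auto simp: in_pm)
  have wc: "weakly_central (- g + h)" if "inverted g" "inverted h" for g h
  proof -
    from that(1) obtain e where e: "e \<in> {1..bound}" "inverts (int e) g" unfolding inverted_def by blast
    from that(2) obtain f where f: "f \<in> {1..bound}" "inverts (int f) h" unfolding inverted_def by blast
    have "inverts (int (e * f)) (- g)" "inverts (int (e * f)) h"
      using inverts_dvd[OF e(2), of "int (e * f)"] inverts_dvd[OF f(2), of "int (e * f)"] by simp_all
    then have "commutes (int (e * f)) (- g + h)" by (rule commutes_add_inverts)
    moreover have "1 \<le> e * f" "e * f \<le> bound ^ 2"
      using e(1) f(1) mult_le_mono[of e bound f bound] by (auto simp: power2_eq_square)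
    ultimately show ?thesis unfolding weakly_central_def by (meson atLeastAtMost_iff)
  qed
  have both: "g + - h = - g + h"
    if g: "g \<in> pm S" "inverted g" "g + g \<noteq> 0" and h: "h \<in> pm S" "inverted h" and s: "- g + h \<in> pm S" for g h
  proof -
    have "- (- g + h) = - h + g" by (simp only: minus_add minus_minus)
    then have w: "- h + g \<in> pm S" "weakly_central (- h + g)"
      using s wc[OF h(2) g(2)] pm_uminus[of "- g + h"] by simp_all
    have "(- h + g) + (g + (- h + g)) = g \<or> (\<forall>s\<in>S. s + s \<noteq> 0) \<and> ((- h + g) + - g) + ((- h + g) + - g) = 0"
      using no[OF g w(1)] w(2) unfolding obstruction_def by blast
    then show ?thesis
    proof
      assume "(- h + g) + (g + (- h + g)) = g"
      then have "- g + (h + ((- h + g) + (g + (- h + g)))) + - g = - g + (h + g) + - g" by simp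
      then show ?thesis by (simp add: group_word del: add_uminus_conv_diff)
    next
      assume a: "(\<forall>s\<in>S. s + s \<noteq> 0) \<and> ((- h + g) + - g) + ((- h + g) + - g) = 0"
      have "(- h + g) + - g = - h" by (simp add: group_word del: add_uminus_conv_diff)
      then have "- h + - h = 0" using a by (simp only:)
      moreover have "- h \<in> pm S" using h(1) by simp
      ultimately show ?thesis using double_pm[of "- h"] a by blast
    qed
  qed
  have one: "g + h = - g + h \<or> g + h = - (- g + h)"
    if g: "g \<in> pm S" "inverted g" and h: "h \<in> pm S" "\<not> inverted h" and s: "- g + h \<in> pm S" for g h
  proof (cases "g + g = 0")
    case True
    then have "- g = g" by (rule minus_unique)
    then show ?thesis by simp
  next
    case False
    have "h + (g + h) = g \<or> (\<forall>s\<in>S. s + s \<noteq> 0) \<and> (h + - g) + (h + - g) = 0"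
      using no[OF g False h(1)] all_pm[OF h(1)] h(2) unfolding obstruction_def by blast
    then show ?thesis
    proof
      assume "h + (g + h) = g"
      then have "- h + (h + (g + h)) = - h + g" by simp
      then have "g + h = - h + g" by (simp add: group_word del: add_uminus_conv_diff)
      then show ?thesis by (simp only: minus_add minus_minus simp_thms)
    next
      assume a: "(\<forall>s\<in>S. s + s \<noteq> 0) \<and> (h + - g) + (h + - g) = 0"
      then have "(- g + h) + (- g + h) = 0" using conj_double by blast
      then show ?thesis using double_pm[OF _ s] a by blast
    qed
  qed
  show ?thesis
    unfolding colour_map_def
  proof (intro conjI ballI impI)
    show "\<phi> g = g \<or> \<phi> g = - g" if "g \<in> pm S" for g using flip fixed that by blast
    fix g h assume gh: "g \<in> pm S" "h \<in> pm S" and s: "- g + h \<in> pm S"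
    have eq: "- (- g + h) = - h + g" by (simp only: minus_add minus_minus)
    then have s': "- h + g \<in> pm S" using s pm_uminus[of "- g + h"] by simp
    show "- \<phi> g + \<phi> h = - g + h \<or> - \<phi> g + \<phi> h = - (- g + h)"
    proof (cases "inverted g"; cases "inverted h")
      assume "\<not> inverted g" "\<not> inverted h"
      then show ?thesis using fixed gh by simp
    next
      assume i: "inverted g" "\<not> inverted h"
      have "- \<phi> g + \<phi> h = g + h" using flip[OF gh(1) i(1)] fixed[OF gh(2) i(2)] by simp
      then show ?thesis using one[OF gh(1) i(1) gh(2) i(2) s] by simp
    next
      assume i: "\<not> inverted g" "inverted h"
      have e: "- \<phi> g + \<phi> h = - (h + g)"
        using flip[OF gh(2) i(2)] fixed[OF gh(1) i(1)] by (simp only: minus_add)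
      from one[OF gh(2) i(2) gh(1) i(1) s'] show ?thesis
      proof
        assume "h + g = - h + g"
        then have "- \<phi> g + \<phi> h = - (- h + g)" using e by simp
        then show ?thesis by (simp only: minus_add minus_minus simp_thms)
      next
        assume "h + g = - (- h + g)"
        then have "- \<phi> g + \<phi> h = - h + g" using e by simp
        then show ?thesis unfolding eq by blast
      qed
    next
      assume i: "inverted g" "inverted h"
      have e: "- \<phi> g + \<phi> h = g + - h" using flip[OF gh(1) i(1)] flip[OF gh(2) i(2)] by simp
      consider "g + g \<noteq> 0" | "h + h \<noteq> 0" | "g + g = 0" "h + h = 0" by blast
      then show ?thesis
      proof cases
        case 1
        then show ?thesis using both[OF gh(1) i(1) 1 gh(2) i(2) s] e by simp
      next
        case 2
        have "h + - g = - h + g" by (rule both[OF gh(2) i(2) 2 gh(1) i(1) s'])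
        then have "- (h + - g) = - (- h + g)" by (rule arg_cong)
        then have "g + - h = - g + h" by (simp only: minus_add minus_minus)
        then show ?thesis using e by simp
      next
        case 3
        then have "- g = g" "- h = h" by (simp_all only: minus_unique)
        then show ?thesis using e by simp
      qed
    qed
  qed
qed

lemma extended_insert_z:
  assumes y: "y = c b" "y \<notin> words S" "y + y \<notin> words S"
    and V: "finite V" "\<And>v. - v \<in> V \<longleftrightarrow> v \<in> V" "card V \<le> 4 * k"
    and z: "z \<in> H" "z \<notin> words (insert y S)" "z + z \<in> words S" "z + z \<noteq> 0"
  shows "extended_rigidity c N S H k (insert z (insert y S)) V y b"
proof -
  interpret E: extended_rigidity c N S H k "insert y S" V y b
    by (rule extended_insert_y[OF y V])
  have w: "x \<in> words (insert y S)" if "x \<in> pm0 (insert y S)" for x using that by (rule wordsI1)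
  have z0: "z \<noteq> 0" using z(4) by auto
  have zS: "z \<notin> insert y S" "- z \<notin> insert y S"
    using z(2) w[of z] by (auto simp: pm0_def in_pm)
  show ?thesis
  proof unfold_locales
    show "finite (insert z (insert y S))" using E.fin' by simp
    show "0 \<notin> pm (insert z (insert y S))" using E.zero' z0 by (auto simp: in_pm)
    show "insert y S \<subseteq> insert z (insert y S)" by blast
    show "insert z (insert y S) \<subseteq> H" using E.S'_H z(1) by blast
    show "- s = s" if s: "s \<in> insert z (insert y S)" "- s \<in> insert z (insert y S)" for s
    proof (cases "s = z")
      case True
      then show ?thesis using s zS by blast
    next
      case False
      then have "s \<in> insert y S" using s by blast
      moreover have "- s \<noteq> z" using zS(2) \<open>s \<in> insert y S\<close> by auto
      ultimately show ?thesis using s(2) E.reduced' by blast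
    qed
    show "s + s \<noteq> 0" if "s \<in> insert z (insert y S)" "\<forall>s\<in>S. s + s \<noteq> 0" for s
      using that E.double' z(4) by blast
    show "s + s \<in> words S" if "s \<in> insert z (insert y S)" "s \<noteq> y" for s
      using that E.double_words z(3) by blast
  qed (use y V in auto)
qed

end

lemma (in extended_rigidity) plain_words:
  assumes "plain v X" "u \<in> pm S'" "link X u \<noteq> {}"
  shows "u \<in> words (insert y S)"
  using assms unfolding plain_def hub_spec_def by blast

text \<open>Ties with the auxiliary inverted element \<open>z\<close> make all inverted generators change sign
  simultaneously; an obstructing pair, if there is one, is detected by one more hub.\<close>

theorem (in rigidity) mixed_case:
  assumes J: "flippable \<noteq> {}" and all: "\<And>s. s \<in> S \<Longrightarrow> weakly_central s \<or> inverted s"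
  shows "\<exists>T. rigid T"
proof -
  obtain g0 where g0: "g0 \<in> S" "inverted g0" "g0 + g0 \<noteq> 0" using J by blast
  obtain f0 where f0: "f0 \<in> {1..bound}" "inverts (int f0) g0" using g0(2) unfolding inverted_def by blast
  have k2: "2 \<le> k"
  proof (rule ccontr)
    assume "\<not> 2 \<le> k"
    then have "k = 1" using k(2) by simp
    then have "weakly_central g0"
      unfolding weakly_central_def using single[OF _ g0(1)] by (intro bexI[of _ 1]) auto
    then show False using not_weakly_central_inverted inverted_weakly[OF g0(2)] by blast
  qed
  have finJ: "finite flippable" "card flippable \<le> k"
    using fin k(1) card_mono[OF fin, of flippable] by auto
  have RpS: "S \<subseteq> pm S" by (rule subset_pm)
  \<comment> \<open>An obstructing pair is taken if there is one. Otherwise \<open>g1\<close>,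
    \<open>w\<close> and \<open>e\<close> are arbitrary, so that both situations can be treated
    together.\<close>
  have "\<exists>g1 w e. g1 \<in> flippable \<and> w \<in> pm S \<and> e \<in> {1..bound ^ 2} \<and>
    (obstruction g1 w \<and> commutes (int e) w \<or> (\<forall>g\<in>flippable. \<forall>w\<in>pm S. \<not> obstruction g w))"
  proof (cases "\<exists>g\<in>flippable. \<exists>w\<in>pm S. obstruction g w")
    case True
    then obtain g1 w where gw: "g1 \<in> flippable" "w \<in> pm S" "obstruction g1 w" by blast
    then obtain e where "e \<in> {1..bound ^ 2}" "commutes (int e) w"
      unfolding obstruction_def weakly_central_def by blast
    then show ?thesis using gw by blast
  next
    case False
    have "(1::nat) \<in> {1..bound ^ 2}" using k2 by simp
    moreover have "g0 \<in> flippable" "g0 \<in> pm S" using g0 RpS by auto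
    ultimately show ?thesis using False by blast
  qed
  then obtain g1 w e where g1: "g1 \<in> flippable" and wpm: "w \<in> pm S" and e: "e \<in> {1..bound ^ 2}"
    and obs: "obstruction g1 w \<and> commutes (int e) w \<or> (\<forall>g\<in>flippable. \<forall>w\<in>pm S. \<not> obstruction g w)"
    by blast
  have g1': "g1 \<in> S" "inverted g1" "g1 + g1 \<noteq> 0" "g1 \<in> pm S" "- g1 \<in> pm S"
    using g1 RpS by auto
  obtain b where b: "int e dvd b" "c b \<notin> words S" "c b + c b \<notin> words S"
    using choose_y[OF e] by blast
  define y where "y = c b"
  obtain c0 where c0: "int f0 dvd c0" "c c0 + g0 \<notin> words (insert y S)"
    using choose_z[OF f0(1), of g0 y] by blast
  \<comment> \<open>\<open>z\<close> inverts the same power as \<open>g0\<close> and has the same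
    double, but it is no short word in \<open>y\<close> and the generators. Hence the words
    containing \<open>z\<close> that a tie touches coincide with no generator.\<close>
  define z where "z = c c0 + g0"
  have z_word: "z \<notin> words (insert y S)" using c0(2) z_def by simp
  have com0: "inverts c0 g0" "commutes f (c c0)" for f
    using inverts_dvd[OF f0(2) c0(1)] by simp_all
  have z_inv: "inverts (int f0) z" unfolding z_def by (rule inverts_add2[OF com0(2) f0(2)])
  then have z_inverted: "inverted z" using f0(1) unfolding inverted_def by blast
  have zz: "z + z = g0 + g0"
  proof -
    have "c c0 + (g0 + c c0) = g0" using com0(1) by (simp only: inverts_iff)
    then have "c c0 + (g0 + c c0) + g0 = g0 + g0" by (rule arg_cong)
    then show ?thesis unfolding z_def by (simp only: add.assoc)
  qed
  define V where "V = pm ((\<lambda>g. - z + (g + g)) ` flippable)"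
  have finV: "finite V" unfolding V_def by (intro finite_pm finite_imageI finJ(1))
  have cardV: "card V \<le> 4 * k"
  proof -
    have "card ((\<lambda>g. - z + (g + g)) ` flippable) \<le> k"
      using card_image_le[OF finJ(1), of "\<lambda>g. - z + (g + g)"] finJ(2) by (rule order_trans)
    moreover have "card V \<le> 2 * card ((\<lambda>g. - z + (g + g)) ` flippable)"
      unfolding V_def by (rule card_pm_le) (intro finite_imageI finJ(1))
    ultimately show ?thesis by linarith
  qed
  have symV: "- v \<in> V \<longleftrightarrow> v \<in> V" for v unfolding V_def by (rule pm_uminus)
  have wV: "- z + (g + g) \<in> V" if "g \<in> flippable" for g
    unfolding V_def by (rule subsetD[OF subset_pm]) (use that in blast)
  let ?S' = "insert z (insert y S)"
  interpret E: extended_rigidity c N S H k ?S' V y b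
  proof (rule extended_insert_z[OF y_def b(2,3)[folded y_def] finV symV cardV _ z_word])
    show "z \<in> H" unfolding z_def using c_H S_H g0(1) by (intro H_add) auto
    show "z + z \<in> words S" "z + z \<noteq> 0"
      unfolding zz using g0 RpS by (auto intro: wordsI2 pm0I)
  qed
  have words: "x \<in> words (insert y S)" if "x \<in> words S" for x
    using that words_mono[of S "insert y S"] by blast
  have pm0: "x \<in> pm0 (insert y S)" if "x \<in> pm S \<or> x = y \<or> x = - y" for x
    using that by (auto simp: pm0_def in_pm)
  have zw: "z \<noteq> x" "- z \<noteq> x" if "x \<in> words (insert y S)" for x
    using that z_word by auto
  have z_pm: "z \<in> pm ?S'" "- z \<in> pm ?S'" by (auto simp: in_pm)
  have zS: "z \<notin> insert y S"
    using zw(1)[OF wordsI1[OF pm0]] RpS by blast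
  have cS': "card ?S' = k + 2" using zS E.y_not_S(1) fin k(1) by simp
  define \<kappa> where "\<kappa> = w + (- g1 + w)"
  obtain R where R: "E.orientation R" "g1 \<in> R" "finite R" "card R \<le> k"
    and \<kappa>: "\<And>u. u \<in> R \<Longrightarrow> - u = \<kappa> \<Longrightarrow> u = g1 \<or> - u = u"
    by (rule E.exists_orientation[OF g1'(1), of \<kappa>]) (rule that; assumption)
  have RpmS: "R \<subseteq> pm S" using R(1) unfolding E.orientation_def by blast
  \<comment> \<open>The special hub has to come first, because its construction starts from
    \<open>S'\<close> without other gadgets.\<close>
  have "\<exists>Zs. good ?S' V Zs \<and> card (total ?S' Zs) \<le> k + 5 \<and>
      (\<forall>X\<in>set Zs. \<exists>i j. E.hub_spec i j w g1 X) \<and> (obstruction g1 w \<longrightarrow> Zs \<noteq> [])"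
  proof (cases "obstruction g1 w")
    case True
    then have ew: "commutes (int e) w" using obs g1 wpm by blast
    have "commutes b w" by (rule commutes_dvd[OF ew b(1)])
    then have wy: "w + y = y + w" by (simp add: slides_def y_def)
    have size: "card ?S' \<le> k + 2" using cS' by simp
    have "\<exists>X. fresh ?S' V ?S' X \<and> card X \<le> 3 \<and> (\<exists>i j. E.hub_spec i j w g1 X)"
      by (rule E.special_hub_step[OF g1'(4) wpm e ew wy size k2])
        (use True in \<open>unfold obstruction_def, blast\<close>)
    then obtain X where X: "fresh ?S' V ?S' X" "card X \<le> 3" "\<exists>i j. E.hub_spec i j w g1 X" by blast
    have "good ?S' V [X]" by (rule good_Cons[OF good_Nil]) (simp add: X(1))
    moreover have "card (total ?S' [X]) \<le> k + 5"
      using card_Un_le[of X ?S'] X(2) cS' by (simp add: total_Cons)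
    ultimately show ?thesis using X(3) by (intro exI[of _ "[X]"]) simp
  next
    case False
    then show ?thesis using good_Nil cS' by (intro exI[of _ "[]"]) simp
  qed
  then obtain Zs where Zs: "good ?S' V Zs" "card (total ?S' Zs) \<le> k + 5"
    "\<And>X. X \<in> set Zs \<Longrightarrow> \<exists>i j. E.hub_spec i j w g1 X" "obstruction g1 w \<Longrightarrow> Zs \<noteq> []" by blast
  have step: "\<exists>X. fresh ?S' V (total ?S' Ys) X \<and> card X \<le> 3 \<and> E.tie_spec g z X"
    if g: "g \<in> flippable" and Ys: "good ?S' V Ys" "card (total ?S' Ys) \<le> 8 * k" for g Ys
  proof -
    have gS: "g \<in> S" "inverted g" "g \<in> pm S" using g RpS by auto
    obtain f where f: "f \<in> {1..bound}" "inverts (int f) g" using gS(2) unfolding inverted_def by blast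
    have D: "0 < f * f0" "f * f0 \<le> bound ^ 2"
      using f(1) f0(1) mult_le_mono[of f bound f0 bound] by (auto simp: power2_eq_square)
    have inv: "inverts (int (f * f0)) g" "inverts (int (f * f0)) z"
      using inverts_dvd[OF f(2), of "int (f * f0)"] inverts_dvd[OF z_inv, of "int (f * f0)"] by simp_all
    have ne: "z \<noteq> g" "z \<noteq> - g"
      using zw(1)[OF wordsI1[OF pm0, of g]] zw(1)[OF wordsI1[OF pm0, of "- g"]] gS(3) by auto
    show ?thesis
      by (rule E.tie_step[OF Ys E.pm_S'[OF gS(3)] inv(1) z_pm(1) inv(2) ne D wV[OF g]])
  qed
  obtain Ys where Ys: "good ?S' V (Ys @ Zs)"
    "card (total ?S' (Ys @ Zs)) \<le> card (total ?S' Zs) + 3 * (card R + card flippable)"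
    "\<And>u. u \<in> R \<Longrightarrow> \<exists>X\<in>set Ys. E.plain u X" "\<And>g. g \<in> flippable \<Longrightarrow> \<exists>X\<in>set Ys. E.tie_spec g z X"
    "\<And>X. X \<in> set Ys \<Longrightarrow> (\<exists>u\<in>R. E.plain u X) \<or> (\<exists>g\<in>flippable. E.tie_spec g z X)"
    by (rule E.exists_hubs[OF Zs(1) R(3) RpmS finJ(1), where P = "\<lambda>g. E.tie_spec g z"])
      ((rule step; assumption), (use Zs(2) R(4) k2 finJ(2) in simp), (rule that; assumption))
  show ?thesis
  proof (rule E.exists_rigid[OF Ys(1)])
    show "nice X" if X: "X \<in> set (Ys @ Zs)" for X
    proof -
      from X have "X \<in> set Ys \<or> X \<in> set Zs" by simp
      then show ?thesis using Ys(5)[of X] Zs(3)[of X] E.nice_specs by blast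
    qed
    show "\<exists>X\<in>set (Ys @ Zs). link X s \<noteq> {}" if s: "s \<in> ?S'" for s
    proof (cases "s = z")
      case True
      from Ys(4)[OF g1] obtain X where X: "X \<in> set Ys" "E.tie_spec g1 z X" by blast
      have "0 < E.row X g1 z" using X(2) unfolding E.tie_spec_def by blast
      from E.row_posD[OF this] show ?thesis using True X(1) by auto
    next
      case False
      have "\<exists>u\<in>R. s = u \<or> s = - u \<or> s = y"
      proof (cases "s = y")
        case sy: False
        then have "s \<in> S" using False s by blast
        then have "s \<in> R \<or> - s \<in> R" using R(1) unfolding E.orientation_def by blast
        then show ?thesis by (metis minus_minus)
      qed (use R(2) in blast)
      then obtain u where u: "u \<in> R" "s = u \<or> s = - u \<or> s = y" by blast
      from Ys(3)[OF u(1)] obtain X where X: "X \<in> set Ys" "E.plain u X" by blast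
      then show ?thesis using E.plain_links[OF X(2)] u(2) by auto
    qed
    have "weakly_central z \<or> inverted z" using z_inverted by blast
    then have sum: "sum rounds ?S' = 8 + 4 * k"
      using zS E.y_not_S(1) fin E.rounds_y sum_rounds_4[OF all] by (simp add: rounds_def[of z])
    have "card (total ?S' (Ys @ Zs)) \<le> 7 * k + 5" using Ys(2) Zs(2) R(4) finJ(2) by simp
    moreover have "7 * k + 5 + 2 * (8 + 4 * k) + (k + 2) * (k + 1) \<le> 2 * k ^ 2 + 28 * k"
    proof -
      have "2 * k \<le> k ^ 2" "(k + 2) * (k + 1) = k ^ 2 + 3 * k + 2"
        using k2 by (simp_all add: power2_eq_square algebra_simps)
      then show ?thesis unfolding \<open>(k + 2) * (k + 1) = k ^ 2 + 3 * k + 2\<close> using k2 by simp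
    qed
    ultimately show "card (total ?S' (Ys @ Zs)) + 2 * sum rounds ?S' +
        card ?S' * (card ?S' - 1) \<le> 2 * k ^ 2 + 28 * k"
      unfolding sum cS' by simp
    fix Is \<phi>
    assume Is: "\<And>X. X \<in> set Is \<Longrightarrow> \<exists>s\<in>?S'. E.increment_spec s X"
      and \<phi>: "separated_automorphism ?S' V (Is @ Ys @ Zs) \<phi>"
    let ?Xs = "Is @ Ys @ Zs"
    interpret separated_automorphism ?S' V ?Xs \<phi> by (rule \<phi>)
    have kinds: "(\<exists>s\<in>?S'. E.increment_spec s X) \<or> (\<exists>v\<in>R. E.plain v X) \<or>
        (\<exists>g\<in>flippable. E.tie_spec g z X) \<or> X \<in> set Zs" if "X \<in> set ?Xs" for X
    proof -
      from that have "X \<in> set Is \<or> X \<in> set Ys \<or> X \<in> set Zs" by auto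
      then show ?thesis using Is Ys(5)[of X] by blast
    qed
    have tie_neutral: "E.neutral X" if g: "g \<in> flippable" and X: "E.tie_spec g z X" for g X
    proof -
      have gpm: "g \<in> pm S" using g RpS by blast
      have "link X l = {}" if l: "l = y \<or> l = - y" for l
      proof (rule ccontr)
        assume ne: "link X l \<noteq> {}"
        have lpm: "l \<in> pm ?S'" using l E.y_pm by blast
        have "l \<in> pm {g, z, g + g, - g + z, - z + (g + g)}"
          using X ne lpm unfolding E.tie_spec_def by blast
        then obtain l' where l': "l' = l \<or> l' = - l" "l' \<in> {g, z, g + g, - g + z, - z + (g + g)}"
          unfolding in_pm by blast
        then have ly: "l' = y \<or> l' = - y" using l by auto
        note p = pm0[of l'] pm0[of g] pm0[of "- g"] pm0[of "- l'"]
        have "l' \<notin> words S" using ly E.y(2) by auto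
        then have "l' \<noteq> g" "l' \<noteq> g + g"
          using wordsI1[OF pm0I[OF gpm]] wordsI2[OF pm0I[OF gpm] pm0I[OF gpm]] by blast+
        moreover have lp: "l' \<in> pm0 (insert y S)" "- l' \<in> pm0 (insert y S)" "g \<in> pm0 (insert y S)"
          using ly gpm by (auto intro!: pm0)
        have "l' \<noteq> z" using zw(1)[OF wordsI1[OF lp(1)]] by blast
        moreover have "l' \<noteq> - g + z"
        proof
          assume "l' = - g + z"
          then have "g + l' = g + (- g + z)" by (rule arg_cong)
          then have "z = g + l'" by (simp del: add_uminus_conv_diff)
          then show False using zw(1)[OF wordsI2[OF lp(3,1)]] by blast
        qed
        moreover have "l' \<noteq> - z + (g + g)"
        proof
          assume "l' = - z + (g + g)"
          then have "- (z + l') = - (z + (- z + (g + g)))" by simp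
          then have "z + l' = g + g" by simp
          then have "z + l' + - l' = g + g + - l'" by (rule arg_cong)
          then have "z = g + (g + - l')" by (simp add: group_word del: add_uminus_conv_diff)
          then show False using zw(1)[OF wordsI3[OF lp(3,3,2)]] by blast
        qed
        ultimately show False using l'(2) by blast
      qed
      then show ?thesis by (simp add: E.neutral_def)
    qed
    have Xs: "E.neutral X \<or> (\<exists>v\<in>R. E.plain v X) \<or> X \<in> set Zs" if "X \<in> set ?Xs" for X
      using kinds[OF that] E.increment_neutral tie_neutral by blast
    have gad: "\<exists>X\<in>set ?Xs. E.plain u X" if "u \<in> R" for u
      using Ys(3)[OF that] by auto
    have Zrow: "E.row X u y \<le> (if u = g1 \<or> u = \<kappa> then 1 else 0)" "E.row X u (- y) \<le> 1"
      "0 < E.row X g1 y" if X: "X \<in> set Zs" and u: "u \<in> pm S" for X u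
    proof -
      obtain i j where h: "E.hub_spec i j w g1 X" using Zs(3)[OF X] by blast
      have "E.row X u y \<le> (if u = g1 \<or> i \<and> u = \<kappa> then 1 else 0)"
        "E.row X u (- y) \<le> (if j \<and> u = - w + (- g1 + w) then 1 else 0)"
        using h u unfolding E.hub_spec_def \<kappa>_def by blast+
      then show "E.row X u y \<le> (if u = g1 \<or> u = \<kappa> then 1 else 0)" "E.row X u (- y) \<le> 1"
        by (auto split: if_splits)
      show "0 < E.row X g1 y" using h unfolding E.hub_spec_def by blast
    qed
    have y: "\<phi> y = y"
    proof -
      have ncent: "\<not> central g1" using g1'(2) not_central_inverted by blast
      from gad[OF R(2)] obtain X0 where X0: "X0 \<in> set ?Xs" "E.plain g1 X0" by blast
      show ?thesis
      proof (rule E.y_not_flipped[OF \<phi> R(1,2) X0 ncent])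
        fix X assume "X \<in> set ?Xs"
        moreover have "E.row X g1 (- y) \<le> E.row X g1 y \<and> E.row X (- g1) (- y) \<le> E.row X g1 y"
          if "X \<in> set Zs"
          using Zrow(2)[OF that g1'(4)] Zrow(2)[OF that g1'(5)] Zrow(3)[OF that g1'(4)] by simp
        ultimately show "E.neutral X \<or> (\<exists>v\<in>R. E.plain v X) \<or>
            E.row X g1 (- y) \<le> E.row X g1 y \<and> E.row X (- g1) (- y) \<le> E.row X g1 y"
          using Xs by blast
      qed
    qed
    have nu: "- u \<noteq> u" if "u + u \<noteq> 0" for u :: 'g
      using that eq_neg_iff_add_eq_0[of u u] by metis
    have ng1: "- u \<noteq> g1" if u: "u \<in> R" "u + u \<noteq> 0" for u
    proof
      assume ug: "- u = g1"
      have "- u = u" using R(1) u(1) R(2)[folded ug] unfolding E.orientation_def by blast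
      then show False using nu[OF u(2)] by blast
    qed
    have Zle: "E.row X (- u) y \<le> E.row X u y" if X: "X \<in> set Zs" and u: "u \<in> R" "u + u \<noteq> 0" for X u
    proof -
      have up: "u \<in> pm S" "- u \<in> pm S" using RpmS u(1) by auto
      show ?thesis
      proof (cases "u = g1")
        case True
        have "E.row X (- u) y \<le> 1" using Zrow(1)[OF X up(2)] by (auto split: if_splits)
        then show ?thesis using Zrow(3)[OF X up(1)] True by simp
      next
        case False
        then have "- u \<noteq> \<kappa>" using \<kappa>[OF u(1)] nu[OF u(2)] by blast
        then show ?thesis using Zrow(1)[OF X up(2)] ng1[OF u] by simp
      qed
    qed
    have fix1: "\<phi> u = u" if u: "u \<in> R" "u + u \<noteq> 0" "\<not> inverted u" for u
    proof -
      from gad[OF u(1)] obtain X0 where X0: "X0 \<in> set ?Xs" "E.plain u X0" by blast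
      show ?thesis
        by (rule E.fixed_y_fixes[OF \<phi> R(1) u(1) X0 u(2,3) y]) (use Xs Zle[OF _ u(1,2)] in blast)
    qed
    have tie_link: "link X v = {}" if g: "g \<in> flippable" and h: "h \<in> flippable" "h \<noteq> g"
      and X: "E.tie_spec h z X" and v: "v = g \<or> v = - g" for X g h v
    proof (rule ccontr)
      assume ne: "link X v \<noteq> {}"
      have gp: "g \<in> pm S" "h \<in> pm S" "v \<in> pm S" using g h v RpS by auto
      have "v \<in> pm {h, z, h + h, - h + z, - z + (h + h)}"
        using X ne E.pm_S'[OF gp(3)] unfolding E.tie_spec_def by blast
      then obtain v' where v'0: "v' = v \<or> v' = - v" and v'2: "v' \<in> {h, z, h + h, - h + z, - z + (h + h)}"
        unfolding in_pm by blast
      have "v' = g \<or> v' = - g" using v v'0 by auto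
      note v' = this v'2
      have v'p: "v' \<in> pm S" using v'(1) gp(1) by auto
      then have lp: "v' \<in> pm0 (insert y S)" "- v' \<in> pm0 (insert y S)" "h \<in> pm0 (insert y S)"
        using gp by (auto intro!: pm0)
      have "v' \<noteq> h"
      proof
        assume vh: "v' = h"
        then have "- g = h" using v'(1) h(2) by auto
        then have "- g = g" using reduced[of g] g h(1) by blast
        then show False using nu[of g] g by blast
      qed
      moreover have "v' \<noteq> z" using zw(1)[OF wordsI1[OF lp(1)]] by blast
      moreover have "v' \<noteq> h + h"
      proof
        assume "v' = h + h"
        moreover have "weakly_central (h + h)"
          using weakly_inverted_double inverted_weakly h(1) by blast
        ultimately have "weakly_central g" using v'(1) by auto
        then show False using g not_weakly_central_inverted inverted_weakly by blast
      qed
      moreover have "v' \<noteq> - h + z"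
      proof
        assume "v' = - h + z"
        then have "h + v' = h + (- h + z)" by (rule arg_cong)
        then have "z = h + v'" by (simp del: add_uminus_conv_diff)
        then show False using zw(1)[OF wordsI2[OF lp(3,1)]] by blast
      qed
      moreover have "v' \<noteq> - z + (h + h)"
      proof
        assume "v' = - z + (h + h)"
        then have "- (z + v') = - (z + (- z + (h + h)))" by simp
        then have "z + v' = h + h" by simp
        then have "z + v' + - v' = h + h + - v'" by (rule arg_cong)
        then have "z = h + (h + - v')" by (simp add: group_word del: add_uminus_conv_diff)
        then show False using zw(1)[OF wordsI3[OF lp(3,3,2)]] by blast
      qed
      ultimately show False using v'(2) by blast
    qed
    have cross: "E.row X (- g) z = 0 \<and> E.row X (- z) g = 0"
      if X: "X \<in> set ?Xs" and g: "g \<in> flippable" for X g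
    proof -
      have gp: "g \<in> pm S" "- g \<in> pm S" "g \<in> S" "inverted g" "g + g \<noteq> 0" using g RpS by auto
      have disj: "E.row X a l = 0" if "link X a = {} \<or> link X l = {}" for a l
        using that by auto
      from kinds[OF X] consider s where "s \<in> ?S'" "E.increment_spec s X" | v where "E.plain v X"
        | h where "h \<in> flippable" "E.tie_spec h z X" | "X \<in> set Zs" by blast
      then show ?thesis
      proof cases
        case 1
        have "link X a = {} \<or> link X l = {}" if a: "a = g \<or> a = - g" and l: "l = z \<or> l = - z" for a l
        proof (rule ccontr)
          assume "\<not> ?thesis"
          then have ne: "link X a \<noteq> {}" "link X l \<noteq> {}" by auto
          have "a \<in> pm ?S'" "l \<in> pm ?S'" using a l z_pm E.pm_S' gp by auto
          then have sub: "a = s \<or> a = - s \<or> weakly_inverted s \<and> (a = s + s \<or> a = - (s + s))"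
            "l = s \<or> l = - s \<or> weakly_inverted s \<and> (l = s + s \<or> l = - (s + s))"
            using 1(2) ne unfolding E.increment_spec_def by blast+
          have wi: "weakly_inverted a" "weakly_inverted l"
            using a l gp(4) z_inverted inverted_weakly by auto
          have "\<not> weakly_central a" "\<not> weakly_central l"
            using wi not_weakly_central_inverted by blast+
          moreover have "weakly_central x" if "weakly_inverted s" "x = s + s \<or> x = - (s + s)" for x
            using that weakly_inverted_double[OF that(1)]
            by (elim disjE) (simp_all only: weakly_central_uminus)
          ultimately have "a = s \<or> a = - s" "l = s \<or> l = - s" using sub by blast+
          then have "l = a \<or> l = - a" by auto
          then have "z = a \<or> z = - a" using l by auto
          then have "z \<in> words (insert y S)"
            using wordsI1[OF pm0, of a] wordsI1[OF pm0, of "- a"] a gp(1,2) by auto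
          then show False using z_word by blast
        qed
        then show ?thesis by (intro conjI disj) blast+
      next
        case 2
        have "link X z = {}" "link X (- z) = {}"
          using E.plain_words[OF 2] z_pm z_word words_uminus_iff[of z "insert y S"] by blast+
        then show ?thesis by (intro conjI disj) blast+
      next
        case 3
        show ?thesis
        proof (cases "h = g")
          case True
          have "z + z \<noteq> 0" unfolding zz by (rule g0(3))
          then show ?thesis
            using 3(2) gp(5) unfolding True E.tie_spec_def by (simp only: Int_commute simp_thms)
        next
          case False
          then show ?thesis
            by (intro conjI disj) (use tie_link[OF g 3(1) False 3(2)] in blast)+
        qed
      next
        case 4
        obtain i j where h: "E.hub_spec i j w g1 X" using Zs(3)[OF 4] by blast
        then have "link X z = {}" "link X (- z) = {}"
          using z_pm z_word words_uminus_iff[of z "insert y S"] unfolding E.hub_spec_def by blast+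
        then show ?thesis by (intro conjI disj) blast+
      qed
    qed
    \<comment> \<open>\<open>g\<close> and \<open>z\<close> have a common neighbour, but
      \<open>- g\<close> and \<open>z\<close> have none, nor have \<open>- z\<close> and
      \<open>g\<close>, by \<open>cross\<close>. So neither of \<open>g\<close> and \<open>z\<close>
      can be fixed without the other.\<close>
    have tie: "\<phi> g = g \<longleftrightarrow> \<phi> z = z" if g: "g \<in> flippable" for g
    proof -
      have gp: "g \<in> pm S" using g RpS by auto
      from Ys(4)[OF g] obtain X1 where X1: "X1 \<in> set Ys" "E.tie_spec g z X1" by blast
      then have X1Xs: "X1 \<in> set ?Xs" by simp
      have pos: "0 < E.row X1 g z" using X1(2) unfolding E.tie_spec_def by blast
      have pos': "0 < E.row X1 z g" using pos by (simp only: Int_commute)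
      note z0 = conjunct1[OF cross[OF _ g]] and g0 = conjunct2[OF cross[OF _ g]]
      have lt: "E.row X1 (- g) z < E.row X1 g z" "E.row X1 (- z) g < E.row X1 z g"
        using pos pos' z0[OF X1Xs] g0[OF X1Xs] by simp_all
      have "common_count ?Xs (- g) z < common_count ?Xs g z"
        by (rule common_count_less[OF _ X1Xs lt(1)]) (simp add: z0)
      moreover have "common_count ?Xs (- z) g < common_count ?Xs z g"
        by (rule common_count_less[OF _ X1Xs lt(2)]) (simp add: g0)
      ultimately show ?thesis
        using map_fixed[OF E.pm_S'[OF gp] z_pm(1)] map_fixed[OF z_pm(1) E.pm_S'[OF gp]] by blast
    qed
    have map_S: "\<phi> u = u \<or> \<phi> u = - u" "\<phi> (- u) = - \<phi> u" if "u \<in> pm S" for u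
      using map_pm[OF E.pm_S'[OF that]] map_uminus[OF E.pm_S'[OF that]] by blast+
    have reps: "u \<in> R \<or> - u \<in> R" if "u \<in> pm S" for u
    proof -
      have "u \<in> S \<or> - u \<in> S" using that by (simp only: in_pm)
      then show ?thesis
      proof
        assume "- u \<in> S"
        then have "- u \<in> R \<or> - (- u) \<in> R" using R(1) unfolding E.orientation_def by blast
        then show ?thesis by auto
      qed (use R(1) in \<open>unfold E.orientation_def, blast\<close>)
    qed
    have flip_rep: "u \<in> flippable \<or> - u \<in> flippable" if "u \<in> pm S" "inverted u" "u + u \<noteq> 0" for u
    proof -
      have "- u + - u = - (u + u)" by (simp only: minus_add)
      then show ?thesis using that by (auto simp: in_pm simp del: add_uminus_conv_diff)
    qed
    show "colour_map \<phi>"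
    proof (cases "\<phi> z = z")
      case z: True
      show ?thesis
      proof (rule E.colour_map_fixed[OF \<phi> R(1)])
        fix u assume u: "u \<in> R" "u + u \<noteq> 0"
        have up: "u \<in> pm S" using RpmS u(1) by blast
        show "\<phi> u = u"
        proof (cases "inverted u")
          case True
          from flip_rep[OF up True u(2)] show ?thesis
          proof
            assume "u \<in> flippable"
            then show ?thesis using tie z by blast
          next
            assume "- u \<in> flippable"
            then have "\<phi> (- u) = - u" using tie z by blast
            then show ?thesis using map_S(2)[OF up] by simp
          qed
        qed (rule fix1[OF u])
      qed
    next
      case z: False
      \<comment> \<open>If \<open>z\<close> is negated, so is \<open>g1\<close>. For an obstructing
        pair, however, the special hub favours the pair \<open>g1\<close>, \<open>y\<close> over
        \<open>- g1\<close>, \<open>y\<close> and would fix \<open>g1\<close>. Hence there is no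
        obstructing pair at all, and negating the inverted generators preserves colours.\<close>
      have "\<not> obstruction g1 w"
      proof
        assume o: "obstruction g1 w"
        then obtain X0 where X0: "X0 \<in> set Zs" using Zs(4) by (cases Zs) auto
        then have X0Xs: "X0 \<in> set ?Xs" by simp
        have "- g1 \<noteq> \<kappa>"
        proof
          assume "- g1 = \<kappa>"
          then have "- w + (- g1 + - w) = - w + (\<kappa> + - w)" by simp
          then have "- w + (- g1 + - w) = - g1"
            unfolding \<kappa>_def by (simp add: group_word del: add_uminus_conv_diff)
          then have "- (- w + (- g1 + - w)) = - (- g1)" by (rule arg_cong)
          then have "w + (g1 + w) = g1" by (simp only: minus_add minus_minus add.assoc)
          then show False using o unfolding obstruction_def by blast
        qed
        then have "E.row X0 (- g1) y = 0"
          using Zrow(1)[OF X0 g1'(5)] nu[OF g1'(3)] by simp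
        then have lt: "E.row X0 (- g1) y < E.row X0 g1 y" using Zrow(3)[OF X0 g1'(4)] by simp
        have "E.row X (- g1) y \<le> E.row X g1 y" if X: "X \<in> set ?Xs" for X
          using Xs[OF X] Zle[OF _ R(2) g1'(3)] E.plain_rows(5)[OF R(1,2) _ _ g1'(3), of _ X]
            E.neutral_rows[OF _ g1'(5), of X] by auto
        then have "common_count ?Xs (- g1) y < common_count ?Xs g1 y"
          using common_count_less[OF _ X0Xs lt] by blast
        then have "\<phi> g1 = g1" by (rule map_fixed[OF E.pm_S'[OF g1'(4)] E.y_pm(1) y])
        then show False using tie[OF g1] z by blast
      qed
      then have free: "\<not> obstruction g v" if "g \<in> flippable" "v \<in> pm S" for g v
        using obs that by blast
      show ?thesis
      proof (rule colour_map_flip[OF all free])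
        fix u assume u: "u \<in> pm S" "inverted u"
        show "\<phi> u = - u"
        proof (cases "u + u = 0")
          case True
          then have "- u = u" by (rule minus_unique)
          then show ?thesis using map_S(1)[OF u(1)] by metis
        next
          case False
          from flip_rep[OF u False] show ?thesis
          proof
            assume "u \<in> flippable"
            then show ?thesis using tie[of u] z map_S(1)[OF u(1)] by blast
          next
            assume "- u \<in> flippable"
            then have "\<phi> (- u) \<noteq> - u" using tie z by blast
            then show ?thesis using map_S[OF u(1)] by auto
          qed
        qed
      next
        fix u assume u: "u \<in> pm S" "\<not> inverted u"
        show "\<phi> u = u"
        proof (cases "u + u = 0")
          case True
          then have "- u = u" by (rule minus_unique)
          then show ?thesis using map_S(1)[OF u(1)] by metis
        next
          case False
          from reps[OF u(1)] show ?thesis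
          proof
            assume "u \<in> R"
            then show ?thesis by (rule fix1[OF _ False u(2)])
          next
            assume nR: "- u \<in> R"
            have "- u + - u = - (u + u)" by (simp only: minus_add)
            then have "- u + - u \<noteq> 0" using False by simp
            then have "\<phi> (- u) = - u" by (rule fix1[OF nR]) (simp add: u(2))
            then show ?thesis using map_S(2)[OF u(1)] by simp
          qed
        qed
      qed (fact+)?
    qed
  qed
qed

theorem (in rigidity) exists_rigid_superset: "\<exists>T. rigid T"
proof (cases "flippable = {}")
  case True
  then have J: "\<not> inverted s" if "s \<in> S" "s + s \<noteq> 0" for s using that by blast
  show ?thesis
  proof (cases "(\<exists>s\<in>S. \<not> central s) \<or> (\<forall>w\<in>S. \<forall>g\<in>S. g + g \<noteq> 0 \<longrightarrow> w + g = g + w)")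
    case False
    then obtain w g where wg: "w \<in> S" "g \<in> S" "g + g \<noteq> 0" "w + g \<noteq> g + w" by blast
    show ?thesis by (rule noncommuting_case[OF _ wg]) (use False in blast)
  qed (rule plain_case[OF J])
next
  case False
  then show ?thesis using shifted_case mixed_case by blast
qed

section \<open>The bounds\<close>

text \<open>The representative is chosen from \<open>{s, - s}\<close>, which is the same set for
  \<open>s\<close> and \<open>- s\<close>, so opposite elements get the same one.\<close>

lemma exists_reduced:
  fixes S :: "'g::group_add set"
  obtains S0 where "S0 \<subseteq> S" "pm S0 = pm S" "\<And>s. s \<in> S0 \<Longrightarrow> - s \<in> S0 \<Longrightarrow> - s = s"
proof -
  define r where "r s = (SOME t. t \<in> {s, - s} \<inter> S)" for s
  have r: "r s \<in> {s, - s} \<inter> S" if "s \<in> pm S" for s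
    unfolding r_def by (rule someI_ex) (use that in \<open>auto simp: in_pm\<close>)
  have r_uminus: "r (- s) = r s" for s
    unfolding r_def by (simp add: insert_commute)
  have r_id: "r (r s) = r s" if "s \<in> S" for s
  proof -
    have "r s = s \<or> r s = - s" using r[of s] that by (auto simp: in_pm)
    then show ?thesis using r_uminus[of s] by auto
  qed
  show ?thesis
  proof (rule that[of "r ` S"])
    show "r ` S \<subseteq> S" using r by (auto simp: in_pm)
    show "pm (r ` S) = pm S"
    proof
      show "pm (r ` S) \<subseteq> pm S" by (rule pm_mono) (use r in \<open>auto simp: in_pm\<close>)
      have "s \<in> pm (r ` S)" if "s \<in> S" for s
      proof -
        have "r s \<in> r ` S" using that by blast
        moreover have "r s = s \<or> r s = - s" using r[of s] that by (auto simp: in_pm)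
        ultimately show ?thesis unfolding in_pm by auto
      qed
      then show "pm S \<subseteq> pm (r ` S)" by (metis in_pm pm_uminus subsetI)
    qed
    fix s assume s: "s \<in> r ` S" "- s \<in> r ` S"
    then have "r s = s" "r (- s) = - s" using r_id by auto
    then show "- s = s" using r_uminus[of s] by simp
  qed
qed

text \<open>For \<open>k\<close> at least \<open>2\<close>, \<open>n\<close> is at least
  \<open>30 * k\<close> and \<open>F_bound n\<close> at least \<open>16 * n ^ 6\<close>, more than
  twice what is needed. For \<open>k = 1\<close> this estimate is too weak, but
  \<open>n = 26\<close> gives exactly 5934025440.\<close>

lemma F_bound_ge:
  fixes k :: int
  assumes "1 \<le> k"
  shows "5500000000 * k ^ 6 \<le> F_bound (2 * k ^ 2 + 28 * k - 4)"
proof (cases "k = 1")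
  case True
  then show ?thesis by (simp add: F_bound_def)
next
  case False
  define n where "n = 2 * k ^ 2 + 28 * k - 4"
  have k: "2 \<le> k" using assms False by simp
  then have "2 * k \<le> k * k" by (rule mult_right_mono) (use k in simp)
  with k have n: "30 * k \<le> n" "1 \<le> n" unfolding n_def power2_eq_square by linarith+
  have "0 \<le> 30 * k" using assms by simp
  with n(1) have "(30 * k) ^ 6 \<le> n ^ 6" by (rule power_mono)
  then have "729000000 * k ^ 6 \<le> n ^ 6" by (simp add: power_mult_distrib)
  moreover have "16 * n ^ 6 = 2 * (2 * n ^ 2) ^ 2 * (2 * n ^ 2)"
    by (simp add: power_mult_distrib power_add[symmetric] power_mult[symmetric])
  moreover have "2 * (2 * n ^ 2) ^ 2 * (2 * n ^ 2) \<le> F_bound n"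
    unfolding F_bound_def
  proof (rule mult_mono)
    have "(2 * n ^ 2) ^ 2 \<le> (2 * n ^ 2 + 3 * n - 2) ^ 2" by (rule power_mono) (use n(2) in simp_all)
    then show "2 * (2 * n ^ 2) ^ 2 \<le> 2 * (2 * n ^ 2 + 3 * n - 2) ^ 2" by linarith
  qed (use n(2) in simp_all)
  moreover have "0 \<le> k ^ 6" using assms by simp
  ultimately show ?thesis unfolding n_def[symmetric] by linarith
qed

text \<open>The bounds differ by twice a square. So the assumption on the order in the second claim
  implies the one in the first.\<close>

lemma F_bound_le_check: "F_bound n \<le> F_check_bound n"
proof -
  have "F_check_bound n - F_bound n = 2 * (2 * n ^ 2 + 3 * n - 2) ^ 2"
    unfolding F_bound_def F_check_bound_def by (simp add: algebra_simps power2_eq_square)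
  moreover have "0 \<le> 2 * (2 * n ^ 2 + 3 * n - 2) ^ 2" by simp
  ultimately show ?thesis by linarith
qed

text \<open>The construction runs on representatives up to sign, and the other generators are put
  back at the end. This changes neither \<open>pm\<close> of the result nor its automorphisms, and
  the linear term of the size bound has room for it. The empty set is treated apart, as the
  construction needs a generator.\<close>

lemma exists_rigid_set:
  fixes S H :: "'g::group_add set" and c :: "int \<Rightarrow> 'g"
  assumes S: "finite S" "0 \<notin> S" "S \<subseteq> H"
    and H: "\<And>x y. x \<in> H \<Longrightarrow> y \<in> H \<Longrightarrow> x + y \<in> H" "\<And>x. x \<in> H \<Longrightarrow> - x \<in> H"
    and c: "\<And>i j. c (i + j) = c i + c j" "\<And>i. c i \<in> H"
      "\<And>i. 0 < i \<Longrightarrow> i < F_bound (2 * int (card S) ^ 2 + 28 * int (card S) - 4) \<Longrightarrow> c i \<noteq> 0"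
    and single: "\<And>s. S \<subseteq> pm {s} \<Longrightarrow> c 1 + s = s + c 1"
  obtains T where "S \<subseteq> T" "finite T" "T \<subseteq> H" "0 \<notin> T" "card T \<le> 2 * card S ^ 2 + 28 * card S"
    "(\<forall>s\<in>S. s + s \<noteq> 0) \<longrightarrow> (\<forall>t\<in>T. t + t \<noteq> 0)"
    "\<And>\<phi> g. link_automorphism T \<phi> \<Longrightarrow> g \<in> pm S \<Longrightarrow> \<phi> g = g \<or> \<phi> g = - g"
    "\<And>\<phi> g h. link_automorphism T \<phi> \<Longrightarrow> g \<in> pm S \<Longrightarrow> h \<in> pm S \<Longrightarrow> - g + h \<in> pm S \<Longrightarrow>
      - \<phi> g + \<phi> h = - g + h \<or> - \<phi> g + \<phi> h = - (- g + h)"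
proof (cases "S = {}")
  case True
  then show ?thesis using that[of "{}"] by (simp add: pm_def)
next
  case False
  obtain S0 where S0: "S0 \<subseteq> S" "pm S0 = pm S" "\<And>s. s \<in> S0 \<Longrightarrow> - s \<in> S0 \<Longrightarrow> - s = s"
    by (rule exists_reduced[of S]) (rule that; assumption)
  define k where "k = card S0"
  let ?K = "card S"
  have fin0: "finite S0" using S0(1) S(1) by (rule finite_subset)
  have kK: "0 < k" "k \<le> ?K"
  proof -
    have "S0 \<noteq> {}" using False S0(2) by (auto simp: pm_def)
    then show "0 < k" using fin0 by (simp add: k_def card_gt_0_iff)
    show "k \<le> ?K" unfolding k_def by (rule card_mono[OF S(1) S0(1)])
  qed
  interpret rigidity c "F_bound (2 * int ?K ^ 2 + 28 * int ?K - 4)" S0 H k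
  proof unfold_locales
    have "int k ^ 6 \<le> int ?K ^ 6" using kK by (intro power_mono) auto
    moreover have "5500000000 * int ?K ^ 6 \<le> F_bound (2 * int ?K ^ 2 + 28 * int ?K - 4)"
      by (rule F_bound_ge) (use kK in simp)
    ultimately show "5500000000 * int k ^ 6 \<le> F_bound (2 * int ?K ^ 2 + 28 * int ?K - 4)"
      by linarith
    have comm: "c 1 + s = s + c 1" if "k = 1" "s \<in> S0" for s
    proof (rule single)
      have "S0 = {s}" using that unfolding k_def by (metis card_1_singletonE singletonD)
      then show "S \<subseteq> pm {s}" using S0(2) subset_pm[of S] by simp
    qed
    interpret cyclic_part c "F_bound (2 * int ?K ^ 2 + 28 * int ?K - 4)"
      by unfold_locales (use c in blast)+
    show "slides 1 1 s" if "k = 1" "s \<in> S0" for s using comm[OF that] by (simp only: slides_def)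
    show "c (i + j) = c i + c j" "c i \<in> H" for i j by (rule c)+
    show "c i \<noteq> 0" if "0 < i" "i < F_bound (2 * int ?K ^ 2 + 28 * int ?K - 4)" for i
      by (rule c(3)[OF that])
    show "0 \<notin> S0" "S0 \<subseteq> H" using S(2,3) S0(1) by blast+
    show "- s = s" if "s \<in> S0" "- s \<in> S0" for s by (rule S0(3)[OF that])
    show "finite S0" "card S0 = k" "0 < k" by (fact fin0 kK(1) k_def[symmetric])+
    show "x + y \<in> H" if "x \<in> H" "y \<in> H" for x y by (rule H(1)[OF that])
    show "- x \<in> H" if "x \<in> H" for x by (rule H(2)[OF that])
  qed
  obtain T0 where "rigid T0" using exists_rigid_superset by blast
  note r = \<open>rigid T0\<close>[unfolded rigid_def]
  have T0: "S0 \<subseteq> T0" "finite T0" "0 \<notin> T0" "card T0 \<le> 2 * k ^ 2 + 28 * k" "nice T0"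
    by (rule r[THEN conjunct1] r[THEN conjunct2, THEN conjunct1]
      r[THEN conjunct2, THEN conjunct2, THEN conjunct1]
      r[THEN conjunct2, THEN conjunct2, THEN conjunct2, THEN conjunct1]
      r[THEN conjunct2, THEN conjunct2, THEN conjunct2, THEN conjunct2, THEN conjunct1])+
  have T0_map: "colour_map \<phi>" if "link_automorphism T0 \<phi>" for \<phi>
    using r[THEN conjunct2, THEN conjunct2, THEN conjunct2, THEN conjunct2, THEN conjunct2] that
    by (elim allE impE)
  have pmT: "pm (T0 \<union> S) = pm T0"
    using S0(2) pm_mono[OF T0(1)] unfolding pm_Un by blast
  have auto: "link_automorphism T0 \<phi>" if "link_automorphism (T0 \<union> S) \<phi>" for \<phi>
    using that unfolding link_automorphism_def pmT .
  show ?thesis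
  proof (rule that[of "T0 \<union> S"])
    show "S \<subseteq> T0 \<union> S" "finite (T0 \<union> S)" "0 \<notin> T0 \<union> S"
      using T0(2,3) S(1,2) by simp_all
    show "T0 \<union> S \<subseteq> H" using T0(5)[unfolded nice_def, THEN conjunct1] S(3) by (rule Un_least)
    have "T0 \<union> S = T0 \<union> (S - S0)" using T0(1) by blast
    then have "card (T0 \<union> S) \<le> card T0 + card (S - S0)" by (simp only: card_Un_le)
    also have "card (S - S0) = ?K - k" unfolding k_def by (rule card_Diff_subset[OF fin0 S0(1)])
    also have "card T0 + (?K - k) \<le> 2 * k ^ 2 + 27 * k + ?K" using T0(4) kK by simp
    also have "\<dots> \<le> 2 * ?K ^ 2 + 28 * ?K"
    proof -
      have "k ^ 2 \<le> ?K ^ 2" using kK(2) by (rule power_mono) simp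
      then show ?thesis using kK(2) by linarith
    qed
    finally show "card (T0 \<union> S) \<le> 2 * ?K ^ 2 + 28 * ?K" .
    show "(\<forall>s\<in>S. s + s \<noteq> 0) \<longrightarrow> (\<forall>t\<in>T0 \<union> S. t + t \<noteq> 0)"
    proof (intro impI ballI)
      fix t assume all: "\<forall>s\<in>S. s + s \<noteq> 0" and t: "t \<in> T0 \<union> S"
      have "\<forall>s\<in>S0. s + s \<noteq> 0" using all S0(1) by blast
      then have "\<forall>t\<in>T0. t + t \<noteq> 0" by (rule T0(5)[unfolded nice_def, THEN conjunct2, THEN mp])
      with t all show "t + t \<noteq> 0" by (elim UnE) (drule (1) bspec, assumption)+
    qed
    show "\<phi> g = g \<or> \<phi> g = - g" if "link_automorphism (T0 \<union> S) \<phi>" "g \<in> pm S" for \<phi> g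
      by (rule T0_map[OF auto[OF that(1)], unfolded colour_map_def S0(2), THEN conjunct1, THEN bspec, OF that(2)])
    show "- \<phi> g + \<phi> h = - g + h \<or> - \<phi> g + \<phi> h = - (- g + h)"
      if "link_automorphism (T0 \<union> S) \<phi>" "g \<in> pm S" "h \<in> pm S" "- g + h \<in> pm S" for \<phi> g h
      by (rule T0_map[OF auto[OF that(1)], unfolded colour_map_def S0(2), THEN conjunct2, THEN bspec,
            OF that(2), THEN bspec, OF that(3), THEN mp, OF that(4)])
  qed
qed

section \<open>Transfer to Cayley graphs\<close>

text \<open>Left translation is continued by the identity outside the carrier, so that it is a
  permutation of the whole type.\<close>

definition translation :: "('a, 'b) monoid_scheme \<Rightarrow> 'a \<Rightarrow> 'a bijection" where
  "translation G g = Bijection (\<lambda>h. if h \<in> carrier G then g \<otimes>\<^bsub>G\<^esub> h else h)"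

context group
begin

lemma apply_translation:
  assumes "g \<in> carrier G"
  shows "apply_bijection (translation G g) = (\<lambda>h. if h \<in> carrier G then g \<otimes> h else h)"
proof -
  have "bij (\<lambda>h. if h \<in> carrier G then g \<otimes> h else h)"
    by (rule bij_betw_byWitness[where f' = "\<lambda>h. if h \<in> carrier G then inv g \<otimes> h else h"])
      (use assms in \<open>auto simp: m_assoc[symmetric]\<close>)
  then show ?thesis by (simp add: translation_def Bijection_inverse)
qed

lemma translation_mult:
  assumes "g \<in> carrier G" "h \<in> carrier G"
  shows "translation G (g \<otimes> h) = translation G g + translation G h"
  by (rule apply_bijection_inject[THEN iffD1])
    (use assms in \<open>auto simp: apply_bijection_plus apply_translation m_assoc\<close>)

lemma translation_eq_iff:
  assumes "g \<in> carrier G" "h \<in> carrier G"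
  shows "translation G g = translation G h \<longleftrightarrow> g = h"
proof
  assume "translation G g = translation G h"
  then have "apply_bijection (translation G g) \<one> = apply_bijection (translation G h) \<one>" by simp
  then show "g = h" using assms by (simp add: apply_translation)
qed simp

lemma translation_one: "translation G \<one> = 0"
proof -
  have "translation G \<one> + translation G \<one> = translation G \<one> + 0"
    using translation_mult[OF one_closed one_closed] by simp
  then show ?thesis by (simp only: add_left_cancel)
qed

lemma translation_inv:
  assumes "g \<in> carrier G"
  shows "translation G (inv g) = - translation G g"
proof -
  have "translation G (inv g) + translation G g = 0"
    using assms translation_one by (simp add: translation_mult[symmetric])
  then show ?thesis by (simp only: eq_neg_iff_add_eq_0)
qed

lemma translation_eq_0_iff: "g \<in> carrier G \<Longrightarrow> translation G g = 0 \<longleftrightarrow> g = \<one>"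
  using translation_eq_iff[of g \<one>] by (simp add: translation_one)

lemma in_sym_closure_iff:
  assumes "S \<subseteq> carrier G" "g \<in> carrier G"
  shows "g \<in> sym_closure G S \<longleftrightarrow> translation G g \<in> pm (translation G ` S)"
proof -
  have "translation G g \<in> translation G ` S \<longleftrightarrow> g \<in> S" if "g \<in> carrier G" for g
    using that assms(1) translation_eq_iff by (auto dest: subsetD)
  from this[of g] this[of "inv g"] have "translation G g \<in> pm (translation G ` S) \<longleftrightarrow> g \<in> S \<or> inv g \<in> S"
    using assms(2) by (simp add: in_pm translation_inv[symmetric])
  moreover have "g \<in> sym_closure G S \<longleftrightarrow> g \<in> S \<or> inv g \<in> S"
    using assms by (auto simp: sym_closure_def SET_INV_def dest: subsetD intro: bexI[of _ "inv g"])
  ultimately show ?thesis by simp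
qed

lemma double_eq_0_iff:
  assumes "g \<in> carrier G" "g \<noteq> \<one>"
  shows "translation G g + translation G g = 0 \<longleftrightarrow> ord g = 2"
proof -
  have "translation G g + translation G g = 0 \<longleftrightarrow> g [^] (2 :: nat) = \<one>"
    using assms(1) translation_eq_0_iff[of "g \<otimes> g"]
    by (simp add: translation_mult numeral_2_eq_2)
  also have "\<dots> \<longleftrightarrow> ord g dvd 2" using assms(1) by (rule pow_eq_id)
  also have "\<dots> \<longleftrightarrow> ord g = 2"
  proof
    assume d: "ord g dvd 2"
    have "ord g \<noteq> 0" by (rule notI) (use d in simp)
    moreover have "ord g \<le> 2" by (rule dvd_imp_le[OF d]) simp
    ultimately show "ord g = 2" using ord_eq_1[OF assms(1)] assms(2) by linarith
  qed simp
  finally show ?thesis .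
qed

text \<open>All generators become \<open>s\<close> or \<open>- s\<close>, so \<open>s\<close>
  commutes with every product of them. Applied to the element of large order, this supplies the
  assumption about a single generator.\<close>

lemma generate_commute:
  assumes "S \<subseteq> carrier G" "translation G ` S \<subseteq> pm {s}" "g \<in> generate G S"
  shows "translation G g + s = s + translation G g"
  using assms(3)
proof (induction rule: generate.induct)
  case one
  then show ?case by (simp add: translation_one)
next
  case (incl h)
  then have "translation G h \<in> pm {s}" using assms(2) by blast
  then have "translation G h = s \<or> translation G h = - s" unfolding in_pm by (metis minus_minus singletonD)
  then show ?case by (rule commute_pm[OF refl]) simp
next
  case (inv h)
  then have "translation G h \<in> pm {s}" "h \<in> carrier G" using assms(1,2) by blast+
  then have "translation G (inv h) = - s \<or> translation G (inv h) = s"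
    unfolding in_pm by (metis minus_minus singletonD translation_inv)
  then show ?case by (intro commute_pm[OF refl, of _ s]) blast+
next
  case (eng h1 h2)
  have "h1 \<in> carrier G" "h2 \<in> carrier G" using eng generate_in_carrier[OF assms(1)] by auto
  then have "translation G (h1 \<otimes> h2) = translation G h1 + translation G h2" by (rule translation_mult)
  moreover have "a + b + s = s + (a + b)" if "a + s = s + a" "b + s = s + b" for a b
  proof -
    have "a + b + s = a + (s + b)" using that(2) by (simp only: add.assoc)
    also have "\<dots> = s + a + b" using that(1) by (simp only: add.assoc[symmetric])
    finally show ?thesis by (simp only: add.assoc)
  qed
  ultimately show ?case using eng.IH by simp
qed

end

context group
begin

lemma translation_int_pow:
  assumes "x \<in> carrier G"
  shows "translation G (x [^] (i + j :: int)) = translation G (x [^] i) + translation G (x [^] j)"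
  using assms by (simp add: int_pow_mult translation_mult)

lemma translation_int_pow_neq_0:
  assumes x: "x \<in> carrier G" "order_at_least G x N" and i: "0 < i" "i < N"
  shows "translation G (x [^] i) \<noteq> 0"
proof
  assume "translation G (x [^] i) = 0"
  then have "x [^] i = \<one>" using x(1) by (simp add: translation_eq_0_iff)
  then have d: "int (ord x) dvd i" using x(1) by (simp add: int_pow_eq_id)
  have "ord x \<noteq> 0" by (rule notI) (use d i(1) in simp)
  moreover have "int (ord x) \<le> i" by (rule zdvd_imp_le[OF d i(1)])
  ultimately show False using x(2) i(2) unfolding order_at_least_def by linarith
qed

lemma pverts_cayley_ball: "pverts (cayley_ball G S) = insert \<one> (sym_closure G S)"
  by (simp add: cayley_ball_def pair_induce_subgraph_def)

lemma parcs_cayley_ball: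
  assumes "S \<subseteq> carrier G"
  shows "(g, h) \<in> parcs (cayley_ball G S) \<longleftrightarrow> g \<in> insert \<one> (sym_closure G S) \<and>
    h \<in> insert \<one> (sym_closure G S) \<and> inv g \<otimes> h \<in> sym_closure G S"
  using sym_closure_inv(1)[OF is_group assms]
  by (auto simp: cayley_ball_def pair_induce_subgraph_def cayley_graph_def)

lemma one_notin_sym_closure:
  assumes "generating_set G S"
  shows "\<one> \<notin> sym_closure G S"
proof -
  have S: "S \<subseteq> carrier G" "\<one> \<notin> S" using assms by (auto simp: generating_set_def)
  then have "0 \<notin> pm (translation G ` S)"
    using translation_eq_0_iff by (auto simp: in_pm dest: subsetD)
  then show ?thesis using in_sym_closure_iff[OF S(1) one_closed] translation_one by simp
qed

text \<open>Removing the fixed centre from the ball leaves its link, which translation identifies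
  with \<open>pm\<close> of the image of \<open>T\<close>; \<psi> is \<phi> in these
  coordinates.\<close>

lemma conjugate_link_automorphism:
  assumes T: "generating_set G T" and \<phi>: "graph_automorphism (cayley_ball G T) \<phi>" "\<phi> \<one> = \<one>"
  defines "\<psi> \<equiv> \<lambda>x. translation G (\<phi> (inv_into (carrier G) (translation G) x))"
  shows "link_automorphism (translation G ` T) \<psi>"
    and "\<And>g. g \<in> carrier G \<Longrightarrow> \<psi> (translation G g) = translation G (\<phi> g)"
    and "\<And>g. g \<in> sym_closure G T \<Longrightarrow> \<phi> g \<in> sym_closure G T"
proof -
  let ?U = "sym_closure G T" and ?\<rho> = "translation G"
  have Tc: "T \<subseteq> carrier G" using T by (simp add: generating_set_def)
  have Uc: "?U \<subseteq> carrier G" using sym_closure_inv(1)[OF is_group Tc] by blast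
  have inj: "inj_on ?\<rho> (carrier G)" using translation_eq_iff by (auto simp: inj_on_def)
  have one: "\<one> \<notin> ?U" by (rule one_notin_sym_closure[OF T])
  have pm: "pm (?\<rho> ` T) = ?\<rho> ` ?U"
  proof
    show "?\<rho> ` ?U \<subseteq> pm (?\<rho> ` T)" using in_sym_closure_iff[OF Tc] Uc by blast
    show "pm (?\<rho> ` T) \<subseteq> ?\<rho> ` ?U"
    proof
      fix x assume x: "x \<in> pm (?\<rho> ` T)"
      then obtain t where t: "t \<in> T" "x = ?\<rho> t \<or> x = - ?\<rho> t"
        unfolding in_pm by (metis imageE minus_minus)
      then have "x = ?\<rho> t \<or> x = ?\<rho> (inv t)" "t \<in> carrier G" using Tc translation_inv by auto
      then obtain g where "g \<in> carrier G" "x = ?\<rho> g" by blast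
      then show "x \<in> ?\<rho> ` ?U" using x in_sym_closure_iff[OF Tc] by blast
    qed
  qed
  have bij: "bij_betw \<phi> (insert \<one> ?U) (insert \<one> ?U)"
    using \<phi>(1) by (simp add: graph_automorphism_def pverts_cayley_ball)
  have "bij_betw \<phi> (insert \<one> ?U - {\<one>}) (insert \<one> ?U - {\<phi> \<one>})"
    by (rule bij_betw_DiffI[OF bij]) (use \<phi>(2) in \<open>auto simp: bij_betw_def\<close>)
  then have bijU: "bij_betw \<phi> ?U ?U" using one \<phi>(2) by simp
  then show U: "\<And>g. g \<in> ?U \<Longrightarrow> \<phi> g \<in> ?U" by (auto simp: bij_betw_def)
  show \<psi>: "\<And>g. g \<in> carrier G \<Longrightarrow> \<psi> (?\<rho> g) = ?\<rho> (\<phi> g)"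
    unfolding \<psi>_def by (simp add: inv_into_f_f[OF inj])
  show "link_automorphism (?\<rho> ` T) \<psi>"
  proof (unfold_locales, unfold pm)
    show "bij_betw \<psi> (?\<rho> ` ?U) (?\<rho> ` ?U)"
    proof (rule bij_betw_imageI)
      show "inj_on \<psi> (?\<rho> ` ?U)"
      proof (rule inj_onI)
        fix a b assume ab: "a \<in> ?\<rho> ` ?U" "b \<in> ?\<rho> ` ?U" and eq: "\<psi> a = \<psi> b"
        then obtain g h where gh: "g \<in> ?U" "a = ?\<rho> g" "h \<in> ?U" "b = ?\<rho> h" by blast
        have "?\<rho> (\<phi> g) = ?\<rho> (\<phi> h)" using eq gh \<psi>[of g] \<psi>[of h] Uc by (simp add: subsetD)
        then have "\<phi> g = \<phi> h" using U[OF gh(1)] U[OF gh(3)] Uc translation_eq_iff by blast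
        then have "g = h" using bijU gh by (auto simp: bij_betw_def dest: inj_onD)
        then show "a = b" using gh by simp
      qed
      have "\<psi> ` ?\<rho> ` ?U = (\<lambda>g. ?\<rho> (\<phi> g)) ` ?U"
        unfolding image_image by (rule image_cong) (use \<psi> Uc in auto)
      also have "\<dots> = ?\<rho> ` \<phi> ` ?U" by (simp only: image_image)
      finally show "\<psi> ` ?\<rho> ` ?U = ?\<rho> ` ?U" using bijU by (simp add: bij_betw_def)
    qed
    fix u v assume "u \<in> ?\<rho> ` ?U" "v \<in> ?\<rho> ` ?U"
    then obtain g h where gh: "g \<in> ?U" "u = ?\<rho> g" "h \<in> ?U" "v = ?\<rho> h" by blast
    have c: "g \<in> carrier G" "h \<in> carrier G" "\<phi> g \<in> carrier G" "\<phi> h \<in> carrier G"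
      using gh U Uc by blast+
    have diff: "- ?\<rho> a + ?\<rho> b \<in> ?\<rho> ` ?U \<longleftrightarrow> (a, b) \<in> parcs (cayley_ball G T)"
      if "a \<in> ?U" "b \<in> ?U" for a b
    proof -
      have ab: "a \<in> carrier G" "b \<in> carrier G" using that Uc by blast+
      then have "- ?\<rho> a + ?\<rho> b = ?\<rho> (inv a \<otimes> b)" by (simp add: translation_mult translation_inv)
      moreover have "?\<rho> (inv a \<otimes> b) \<in> ?\<rho> ` ?U \<longleftrightarrow> inv a \<otimes> b \<in> ?U"
        using in_sym_closure_iff[OF Tc, of "inv a \<otimes> b"] ab unfolding pm by simp
      ultimately show ?thesis using parcs_cayley_ball[OF Tc] that by simp
    qed
    have "(\<phi> g, \<phi> h) \<in> parcs (cayley_ball G T) \<longleftrightarrow> (g, h) \<in> parcs (cayley_ball G T)"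
      using \<phi>(1) gh unfolding graph_automorphism_def pverts_cayley_ball by blast
    then show "- \<psi> u + \<psi> v \<in> ?\<rho> ` ?U \<longleftrightarrow> - u + v \<in> ?\<rho> ` ?U"
      using diff[OF gh(1,3)] diff[OF U[OF gh(1)] U[OF gh(3)]] \<psi>[OF c(1)] \<psi>[OF c(2)] gh by simp
  qed
qed

text \<open>An edge of the ball has the centre as an end, where \<open>colours\<close> applies, or
  joins two neighbours of the centre, where \<open>edges\<close> applies. Surjectivity is free
  because \<open>S\<close> is finite.\<close>

lemma colour_preserving_automorphismI:
  assumes S: "generating_set G S" "finite S" and one: "\<phi> \<one> = \<one>"
    and inj: "inj_on \<phi> (insert \<one> (sym_closure G S))"
    and colours: "\<And>g. g \<in> sym_closure G S \<Longrightarrow> \<phi> g = g \<or> \<phi> g = inv g"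
    and edges: "\<And>g h. g \<in> sym_closure G S \<Longrightarrow> h \<in> sym_closure G S \<Longrightarrow> inv g \<otimes> h \<in> sym_closure G S \<Longrightarrow>
      inv (\<phi> g) \<otimes> \<phi> h = inv g \<otimes> h \<or> inv (\<phi> g) \<otimes> \<phi> h = inv (inv g \<otimes> h)"
  shows "colour_preserving_automorphism G S (cayley_ball G S) \<phi>"
  unfolding colour_preserving_automorphism_def pverts_cayley_ball
proof (intro conjI ballI impI)
  have Sc: "S \<subseteq> carrier G" using S by (simp add: generating_set_def)
  note symc = sym_closure_inv[OF is_group Sc]
  have fin: "finite (sym_closure G S)" using S(2) by (simp add: sym_closure_def SET_INV_def)
  have map: "\<phi> g \<in> sym_closure G S" if "g \<in> sym_closure G S" for g
    using colours[OF that] symc[OF that] that by auto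
  have "\<phi> ` insert \<one> (sym_closure G S) \<subseteq> insert \<one> (sym_closure G S)" using map one by auto
  then have "\<phi> ` insert \<one> (sym_closure G S) = insert \<one> (sym_closure G S)"
    using inj fin by (intro endo_inj_surj) auto
  with inj show "bij_betw \<phi> (insert \<one> (sym_closure G S)) (insert \<one> (sym_closure G S))"
    by (simp add: bij_betw_def)
  fix g s assume g: "g \<in> carrier G" and s: "s \<in> sym_closure G S"
    and "(g, g \<otimes> s) \<in> parcs (cayley_ball G S)"
  then have arc: "g \<in> insert \<one> (sym_closure G S)" "g \<otimes> s \<in> insert \<one> (sym_closure G S)"
    using parcs_cayley_ball[OF Sc] by auto
  have sc: "s \<in> carrier G" using symc(1)[OF s] .
  consider "g = \<one>" | "g \<otimes> s = \<one>" | "g \<in> sym_closure G S" "g \<otimes> s \<in> sym_closure G S"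
    using arc by blast
  then show "\<phi> (g \<otimes> s) \<in> {\<phi> g \<otimes> s, \<phi> g \<otimes> inv s}"
  proof cases
    case 1
    then show ?thesis using colours[OF s] one sc by auto
  next
    case 2
    then have gs: "g = inv s" using g sc by (simp add: inv_equality)
    then have "\<phi> g = inv s \<or> \<phi> g = s" using colours[OF symc(2)[OF s]] sc by auto
    then show ?thesis using 2 one sc by auto
  next
    case 3
    have "inv g \<otimes> (g \<otimes> s) = s" using g sc by (simp add: m_assoc[symmetric])
    then have e: "inv (\<phi> g) \<otimes> \<phi> (g \<otimes> s) = s \<or> inv (\<phi> g) \<otimes> \<phi> (g \<otimes> s) = inv s"
      using edges[OF 3] s by simp
    have c: "\<phi> g \<in> carrier G" "\<phi> (g \<otimes> s) \<in> carrier G" using map 3 symc(1) by blast+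
    then have "\<phi> (g \<otimes> s) = \<phi> g \<otimes> (inv (\<phi> g) \<otimes> \<phi> (g \<otimes> s))" by (simp add: m_assoc[symmetric])
    then show ?thesis using e by auto
  qed
qed

text \<open>The clause on orders is an implication about the same \<open>T\<close>, so that both
  claims of the result follow from this one statement.\<close>

theorem exists_strong_colour_rigid_triple:
  assumes S: "finite S" "generating_set G S"
    and x: "x \<in> carrier G" "order_at_least G x (F_bound (2 * int (card S) ^ 2 + 28 * int (card S) - 4))"
  shows "\<exists>T. S \<subseteq> T \<and> generating_set G T \<and> finite T \<and> card T \<le> 2 * card S ^ 2 + 28 * card S \<and>
    strong_colour_rigid_triple G S T \<and> ((\<forall>s\<in>S. ord s \<noteq> 2) \<longrightarrow> (\<forall>t\<in>T. ord t \<noteq> 2))"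
proof -
  let ?\<rho> = "translation G" and ?H = "translation G ` carrier G"
  have Sc: "S \<subseteq> carrier G" "\<one> \<notin> S" "generate G S = carrier G"
    using S(2) by (auto simp: generating_set_def)
  have inj: "inj_on ?\<rho> (carrier G)" using translation_eq_iff by (auto simp: inj_on_def)
  have card: "card (?\<rho> ` S) = card S" by (rule card_image[OF inj_on_subset[OF inj Sc(1)]])
  obtain T' where T': "?\<rho> ` S \<subseteq> T'" "finite T'" "T' \<subseteq> ?H" "0 \<notin> T'"
    "card T' \<le> 2 * card (?\<rho> ` S) ^ 2 + 28 * card (?\<rho> ` S)"
    "(\<forall>s\<in>?\<rho> ` S. s + s \<noteq> 0) \<longrightarrow> (\<forall>t\<in>T'. t + t \<noteq> 0)"
    "\<And>\<phi> g. link_automorphism T' \<phi> \<Longrightarrow> g \<in> pm (?\<rho> ` S) \<Longrightarrow> \<phi> g = g \<or> \<phi> g = - g"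
    "\<And>\<phi> g h. link_automorphism T' \<phi> \<Longrightarrow> g \<in> pm (?\<rho> ` S) \<Longrightarrow> h \<in> pm (?\<rho> ` S) \<Longrightarrow>
      - g + h \<in> pm (?\<rho> ` S) \<Longrightarrow> - \<phi> g + \<phi> h = - g + h \<or> - \<phi> g + \<phi> h = - (- g + h)"
  proof (rule exists_rigid_set[of "?\<rho> ` S" ?H "\<lambda>i. ?\<rho> (x [^] i)"])
    show "finite (?\<rho> ` S)" using S(1) by simp
    show "0 \<notin> ?\<rho> ` S" using Sc translation_eq_0_iff by (auto dest: subsetD)
    show "?\<rho> ` S \<subseteq> ?H" using Sc(1) by (rule image_mono)
    show "a + b \<in> ?H" if "a \<in> ?H" "b \<in> ?H" for a b
    proof -
      from that obtain g h where gh: "g \<in> carrier G" "a = ?\<rho> g" "h \<in> carrier G" "b = ?\<rho> h" by blast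
      have "?\<rho> (g \<otimes> h) \<in> ?H" using gh by simp
      then show ?thesis using gh by (simp add: translation_mult)
    qed
    show "- a \<in> ?H" if "a \<in> ?H" for a
    proof -
      from that obtain g where g: "g \<in> carrier G" "a = ?\<rho> g" by blast
      have "?\<rho> (inv g) \<in> ?H" using g by simp
      then show ?thesis using g by (simp add: translation_inv)
    qed
    show "?\<rho> (x [^] (i + j)) = ?\<rho> (x [^] i) + ?\<rho> (x [^] j)" for i j :: int
      by (rule translation_int_pow[OF x(1)])
    show "?\<rho> (x [^] i) \<in> ?H" for i :: int using x(1) by simp
    show "?\<rho> (x [^] i) \<noteq> 0"
      if "0 < i" "i < F_bound (2 * int (card (?\<rho> ` S)) ^ 2 + 28 * int (card (?\<rho> ` S)) - 4)" for i :: int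
      by (rule translation_int_pow_neq_0[OF x that(1)]) (use that(2) card in simp)
    show "?\<rho> (x [^] (1 :: int)) + s = s + ?\<rho> (x [^] (1 :: int))" if "?\<rho> ` S \<subseteq> pm {s}" for s
      by (rule generate_commute[OF Sc(1) that]) (use x(1) Sc(3) in simp)
  qed (rule that; assumption)
  define T where "T = {t \<in> carrier G. ?\<rho> t \<in> T'}"
  have Tim: "?\<rho> ` T = T'" using T'(3) unfolding T_def by auto
  have Tc: "T \<subseteq> carrier G" unfolding T_def by blast
  have injT: "inj_on ?\<rho> T" using inj Tc by (rule inj_on_subset)
  have finT: "finite T" using T'(2) injT Tim finite_imageD by blast
  have cardT: "card T = card T'" using card_image[OF injT] Tim by simp
  have ST: "S \<subseteq> T" using T'(1) Sc(1) unfolding T_def by blast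
  have oneT: "\<one> \<notin> T" using T'(4) translation_one unfolding T_def by auto
  have genT: "generating_set G T"
    unfolding generating_set_def
  proof (intro conjI Tc oneT)
    show "generate G T = carrier G"
      using generate_incl[OF Tc] mono_generate[OF ST] Sc(3) by blast
  qed
  have sub: "sym_closure G S \<subseteq> sym_closure G T"
    using ST by (auto simp: sym_closure_def SET_INV_def)
  note symS = sym_closure_inv[OF is_group Sc(1)]
  have "colour_preserving_automorphism G S (cayley_ball G S) \<phi>"
    if \<phi>: "graph_automorphism (cayley_ball G T) \<phi>" "\<phi> \<one> = \<one>" for \<phi>
  proof -
    define \<psi> where "\<psi> = (\<lambda>x. ?\<rho> (\<phi> (inv_into (carrier G) ?\<rho> x)))"
    note conj = conjugate_link_automorphism[OF genT \<phi>]
    have \<psi>_\<rho>: "\<psi> (?\<rho> g) = ?\<rho> (\<phi> g)" if "g \<in> carrier G" for g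
      unfolding \<psi>_def by (rule conj(2)[OF that])
    have \<psi>: "link_automorphism T' \<psi>" using conj(1) unfolding Tim \<psi>_def .
    have Tsym: "sym_closure G T \<subseteq> carrier G" using sym_closure_inv(1)[OF is_group Tc] by blast
    have \<phi>c: "\<phi> g \<in> carrier G" if "g \<in> sym_closure G S" for g
      using conj(3)[of g] that sub Tsym by blast
    have pmS: "?\<rho> g \<in> pm (?\<rho> ` S)" if "g \<in> sym_closure G S" for g
      using in_sym_closure_iff[OF Sc(1) symS(1)[OF that]] that by blast
    show ?thesis
    proof (rule colour_preserving_automorphismI[where \<phi> = \<phi>, OF S(2,1) \<phi>(2)])
      have "inj_on \<phi> (insert \<one> (sym_closure G T))"
        by (rule bij_betw_imp_inj_on[OF \<phi>(1)[unfolded graph_automorphism_def pverts_cayley_ball, THEN conjunct1]])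
      then show "inj_on \<phi> (insert \<one> (sym_closure G S))"
        by (rule inj_on_subset) (use sub in blast)
      fix g assume g: "g \<in> sym_closure G S"
      note gc = symS(1)[OF g]
      have "?\<rho> (\<phi> g) = ?\<rho> g \<or> ?\<rho> (\<phi> g) = ?\<rho> (inv g)"
        using T'(7)[OF \<psi> pmS[OF g]] unfolding \<psi>_\<rho>[OF gc] translation_inv[OF gc] .
      then show "\<phi> g = g \<or> \<phi> g = inv g"
        unfolding translation_eq_iff[OF \<phi>c[OF g] gc] translation_eq_iff[OF \<phi>c[OF g] inv_closed[OF gc]] .
      fix h assume h: "h \<in> sym_closure G S" and gh: "inv g \<otimes> h \<in> sym_closure G S"
      note hc = symS(1)[OF h]
      have diff: "?\<rho> (inv a \<otimes> b) = - ?\<rho> a + ?\<rho> b" if "a \<in> carrier G" "b \<in> carrier G" for a b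
        using that by (simp add: translation_mult translation_inv)
      have "- \<psi> (?\<rho> g) + \<psi> (?\<rho> h) = - ?\<rho> g + ?\<rho> h \<or> - \<psi> (?\<rho> g) + \<psi> (?\<rho> h) = - (- ?\<rho> g + ?\<rho> h)"
        by (rule T'(8)[OF \<psi> pmS[OF g] pmS[OF h]]) (use pmS[OF gh, unfolded diff[OF gc hc]] in assumption)
      then have "?\<rho> (inv (\<phi> g) \<otimes> \<phi> h) = ?\<rho> (inv g \<otimes> h) \<or>
          ?\<rho> (inv (\<phi> g) \<otimes> \<phi> h) = ?\<rho> (inv (inv g \<otimes> h))"
        unfolding \<psi>_\<rho>[OF gc] \<psi>_\<rho>[OF hc] diff[OF gc hc, symmetric]
          diff[OF \<phi>c[OF g] \<phi>c[OF h], symmetric] translation_inv[OF symS(1)[OF gh], symmetric] .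
      then show "inv (\<phi> g) \<otimes> \<phi> h = inv g \<otimes> h \<or> inv (\<phi> g) \<otimes> \<phi> h = inv (inv g \<otimes> h)"
        using translation_eq_iff[OF m_closed[OF inv_closed[OF \<phi>c[OF g]] \<phi>c[OF h]]] symS(1)[OF gh] inv_closed
        by blast
    qed
  qed
  then have rigid: "strong_colour_rigid_triple G S T"
    unfolding strong_colour_rigid_triple_def by (intro conjI allI impI S(2) genT ST) (elim conjE)
  have ord: "(\<forall>s\<in>S. ord s \<noteq> 2) \<longrightarrow> (\<forall>t\<in>T. ord t \<noteq> 2)"
  proof
    assume "\<forall>s\<in>S. ord s \<noteq> 2"
    have no: "?\<rho> s + ?\<rho> s \<noteq> 0 \<longleftrightarrow> ord s \<noteq> 2" if "s \<in> T" for s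
    proof -
      have "s \<in> carrier G" "s \<noteq> \<one>" using that Tc oneT by auto
      then show ?thesis using double_eq_0_iff by simp
    qed
    have "?\<rho> s + ?\<rho> s \<noteq> 0" if "s \<in> S" for s
      using \<open>\<forall>s\<in>S. ord s \<noteq> 2\<close> that no[of s] ST by blast
    then have "\<forall>s\<in>?\<rho> ` S. s + s \<noteq> 0" unfolding ball_simps by blast
    then have *: "\<forall>t\<in>T'. t + t \<noteq> 0" by (rule T'(6)[THEN mp])
    show "\<forall>t\<in>T. ord t \<noteq> 2"
    proof
      fix t assume t: "t \<in> T"
      then have "?\<rho> t \<in> T'" unfolding T_def by blast
      then have "?\<rho> t + ?\<rho> t \<noteq> 0" by (rule *[THEN bspec])
      then show "ord t \<noteq> 2" using no[OF t] by simp
    qed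
  qed
  show ?thesis
  proof (intro exI[of _ T] conjI ST genT finT rigid ord)
    show "card T \<le> 2 * card S ^ 2 + 28 * card S" using T'(5) unfolding cardT card .
  qed
qed

end

lemma order_at_least_mono: "order_at_least G x N \<Longrightarrow> M \<le> N \<Longrightarrow> order_at_least G x M"
  by (auto simp: order_at_least_def)

theorem theorem9:
  fixes G :: "('a, 'b) monoid_scheme" and S :: "'a set"
  assumes "group G" and "finite S" and "generating_set G S"
  shows
    "((\<exists>x\<in>carrier G. order_at_least G x (F_bound (2 * int (card S)^2 + 28 * int (card S) - 4))) \<longrightarrow>
        (\<exists>T. S \<subseteq> T \<and> generating_set G T \<and> finite T \<and> card T \<le> 2 * card S^2 + 28 * card S \<and>
          strong_colour_rigid_triple G S T)) \<and>
     ((\<forall>s\<in>S. group.ord G s \<noteq> 2) \<and>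
      (\<exists>x\<in>carrier G. order_at_least G x (F_check_bound (2 * int (card S)^2 + 28 * int (card S) - 4))) \<longrightarrow>
        (\<exists>T. S \<subseteq> T \<and> generating_set G T \<and> finite T \<and> card T \<le> 2 * card S^2 + 28 * card S \<and>
          strong_colour_rigid_triple G S T \<and> (\<forall>t\<in>T. group.ord G t \<noteq> 2)))"
proof -
  interpret group G by fact
  note ex = exists_strong_colour_rigid_triple[OF assms(2,3)]
  show ?thesis
  proof (intro conjI impI)
    assume "\<exists>x\<in>carrier G. order_at_least G x (F_bound (2 * int (card S)^2 + 28 * int (card S) - 4))"
    then show "\<exists>T. S \<subseteq> T \<and> generating_set G T \<and> finite T \<and> card T \<le> 2 * card S^2 + 28 * card S \<and>
        strong_colour_rigid_triple G S T"
      using ex by blast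
  next
    assume a: "(\<forall>s\<in>S. group.ord G s \<noteq> 2) \<and>
      (\<exists>x\<in>carrier G. order_at_least G x (F_check_bound (2 * int (card S)^2 + 28 * int (card S) - 4)))"
    then obtain x where x: "x \<in> carrier G"
      "order_at_least G x (F_check_bound (2 * int (card S)^2 + 28 * int (card S) - 4))" by blast
    show "\<exists>T. S \<subseteq> T \<and> generating_set G T \<and> finite T \<and> card T \<le> 2 * card S^2 + 28 * card S \<and>
        strong_colour_rigid_triple G S T \<and> (\<forall>t\<in>T. group.ord G t \<noteq> 2)"
      using ex[OF x(1) order_at_least_mono[OF x(2) F_bound_le_check]] a by blast
  qed
qed

end
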